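(* Let $\sigma$ be a finite relational signature. For the class $\mathcal C$ of all $\sigma$-structures and any $N\in\mathbb N$: every instance $(\mathcal A_0,P)$, $\mathcal A_0\in\mathcal C$, of the extension problem for partial automorphisms over $\mathcal C$ admits finite solutions $\mathcal A\in\mathcal C$ which are fully symmetric and whose atlas is $N$-acyclic.
   Context: Substructures are induced. A partial isomorphism in $\mathcal A_0$ (partial automorphism) is an isomorphism $p\colon\mathcal A_0\restriction\mathrm{dom}(p)\simeq\mathcal A_0\restriction\mathrm{image}(p)$ between induced substructures. **Extension problem.** An instance of the extension problem for partial automorphisms over a class $\mathcal C$ of $\sigma$-structures is a pair $(\mathcal A_0,P)$ of a finite $\mathcal A_0\in\mathcal C$ and a set $P$ of partial isomorphisms in $\mathcal A_0$; $P$ is always assumed closed under inverses. A solution is any $\mathcal A\in\mathcal C$ into which $\mathcal A_0$ embeds isomorphically (as an induced substructure) such that the image of each $p\in P$ extends to a full automorphism of $\mathcal A$. **Fully symmetric solutions.** A solution $\mathcal A$ is fully symmetric if it possesses an atlas $(\mathcal A,U,(\pi_u)_{u\in U})$ with single co-ordinate structure $\mathcal A_0$, that is, a set $U$ of subsets $u\subseteq A$ (co-ordinate domains), such that every element of $A$ and every tuple in every relation of $\mathcal A$ is contained in some $u\in U$, together with one isomorphism (chart) $\pi_u\colon\mathcal A\restriction u\simeq\mathcal A_0$ for each $u\in U$, such that: (i) the automorphism group of $\mathcal A$ acts transitively on the set $U$ of co-ordinate domains in a manner compatible with the charts, i.e. by symmetries of the atlas that are rigid w.r.t. the single co-ordinate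 structure (automorphisms $f$ of $\mathcal A$ that permute $U$ and satisfy $\pi_{f(u)}\circ f=\pi_u$ on $u$, for all $u\in U$); (ii) any two co-ordinate domains $u,u'\in U$ with non-trivial (non-empty) intersection are related by the action of a composition of partial isomorphisms from $P$, in the sense that $\pi_{u'}\circ\pi_u^{-1}=p_n\circ\cdots\circ p_1$ for some finite word $p_1\cdots p_n$ over $P$ (equality of partial compositions, including equality of the domains; the empty composition is $\mathrm{id}_{A_0}$). **Hypergraph acyclicity.** A hypergraph $(A,U)$ consists of a vertex set $A$ and a set $U$ of finite non-empty subsets of $A$ (hyperedges) with $A=\bigcup U$. Its Gaifman graph links distinct $a,a'\in A$ if they lie in a common hyperedge. It is acyclic if its Gaifman graph has no chordless cycles of length greater than $3$ and every clique in the Gaifman graph is contained in some hyperedge. It is $N$-acyclic if every induced sub-hypergraph (vertex set $A_0\subseteq A$, hyperedges the non-empty sets $u\cap A_0$, $u\in U$) with up to $N$ vertices is acyclic. The atlas is $N$-acyclic if the hypergraph $(A,U)$ of its co-ordinate domains is $N$-acyclic. *)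

theory Defs imports Main begin

section \<open>Relational structures\<close>

record 's signature =
  symbols :: "'s set"
  arity :: "'s \<Rightarrow> nat"

record ('a, 's) struct =
  univ :: "'a set"
  rel :: "'s \<Rightarrow> 'a list set"

text \<open>Interpretations of symbols outside the signature are irrelevant throughout.
  Empty universes and nullary symbols are not excluded.\<close>

definition structures :: "'s signature \<Rightarrow> ('a, 's) struct set" where
  "structures \<sigma> = {A. \<forall>R\<in>symbols \<sigma>. \<forall>xs\<in>rel A R. length xs = arity \<sigma> R \<and> set xs \<subseteq> univ A}"

definition induced :: "('a, 's) struct \<Rightarrow> 'a set \<Rightarrow> ('a, 's) struct" where
  "induced A u = \<lparr>univ = univ A \<inter> u, rel = (\<lambda>R. {xs \<in> rel A R. set xs \<subseteq> u})\<rparr>"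

definition isomorphism ::
  "'s signature \<Rightarrow> ('a \<Rightarrow> 'b) \<Rightarrow> ('a, 's) struct \<Rightarrow> ('b, 's) struct \<Rightarrow> bool" where
  "isomorphism \<sigma> f A B \<longleftrightarrow>
     bij_betw f (univ A) (univ B) \<and>
     (\<forall>R\<in>symbols \<sigma>. \<forall>xs. length xs = arity \<sigma> R \<and> set xs \<subseteq> univ A \<longrightarrow>
        (xs \<in> rel A R \<longleftrightarrow> map f xs \<in> rel B R))"

definition automorphism :: "'s signature \<Rightarrow> ('a, 's) struct \<Rightarrow> ('a \<Rightarrow> 'a) \<Rightarrow> bool" where
  "automorphism \<sigma> A f \<longleftrightarrow> isomorphism \<sigma> f A A"

definition embedding ::
  "'s signature \<Rightarrow> ('a \<Rightarrow> 'b) \<Rightarrow> ('a, 's) struct \<Rightarrow> ('b, 's) struct \<Rightarrow> bool" where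
  "embedding \<sigma> e A B \<longleftrightarrow>
     e ` univ A \<subseteq> univ B \<and> isomorphism \<sigma> e A (induced B (e ` univ A))"

section \<open>Partial isomorphisms\<close>

definition partial_iso :: "'s signature \<Rightarrow> ('a, 's) struct \<Rightarrow> ('a \<rightharpoonup> 'a) \<Rightarrow> bool" where
  "partial_iso \<sigma> A p \<longleftrightarrow>
     dom p \<subseteq> univ A \<and> ran p \<subseteq> univ A \<and>
     isomorphism \<sigma> (\<lambda>x. the (p x)) (induced A (dom p)) (induced A (ran p))"

text \<open>Only meaningful for partial maps that are injective on their domain.\<close>

definition pinv :: "('a \<rightharpoonup> 'b) \<Rightarrow> ('b \<rightharpoonup> 'a)" where
  "pinv p = (\<lambda>y. if y \<in> ran p then Some (THE x. p x = Some y) else None)"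

definition graph_on :: "'a set \<Rightarrow> ('a \<Rightarrow> 'b) \<Rightarrow> ('a \<rightharpoonup> 'b)" where
  "graph_on u f = (\<lambda>x. if x \<in> u then Some (f x) else None)"

text \<open>The list \<open>[p\<^sub>1, \<dots>, p\<^sub>n]\<close> denotes \<open>p\<^sub>n \<circ> \<dots> \<circ> p\<^sub>1\<close>, with its maximal domain of
  definition in \<open>V\<close>; the empty list denotes the identity on \<open>V\<close>.\<close>

definition word_comp :: "'a set \<Rightarrow> ('a \<rightharpoonup> 'a) list \<Rightarrow> ('a \<rightharpoonup> 'a)" where
  "word_comp V ps = fold (\<lambda>p q. p \<circ>\<^sub>m q) ps (graph_on V id)"

section \<open>The extension problem for partial automorphisms\<close>

definition extension_instance ::
  "'s signature \<Rightarrow> ('a, 's) struct set \<Rightarrow> ('a, 's) struct \<Rightarrow> ('a \<rightharpoonup> 'a) set \<Rightarrow> bool" where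
  "extension_instance \<sigma> \<C> A0 P \<longleftrightarrow>
     A0 \<in> \<C> \<and> finite (univ A0) \<and>
     (\<forall>p\<in>P. partial_iso \<sigma> A0 p) \<and> (\<forall>p\<in>P. pinv p \<in> P)"

text \<open>The class is a parameter at the type of the solution, which may differ from the type
  of the instance.\<close>

definition solution ::
  "'s signature \<Rightarrow> ('b, 's) struct set \<Rightarrow> ('a, 's) struct \<Rightarrow> ('a \<rightharpoonup> 'a) set \<Rightarrow> ('b, 's) struct \<Rightarrow> bool" where
  "solution \<sigma> \<C> A0 P A \<longleftrightarrow>
     A \<in> \<C> \<and>
     (\<exists>e. embedding \<sigma> e A0 A \<and>
        (\<forall>p\<in>P. \<exists>f. automorphism \<sigma> A f \<and> (\<forall>x y. p x = Some y \<longrightarrow> f (e x) = e y)))"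

section \<open>Atlases and full symmetry\<close>

definition atlas ::
  "'s signature \<Rightarrow> ('a, 's) struct \<Rightarrow> ('b, 's) struct \<Rightarrow> 'b set set \<Rightarrow> ('b set \<Rightarrow> 'b \<Rightarrow> 'a) \<Rightarrow> bool" where
  "atlas \<sigma> A0 A U \<pi> \<longleftrightarrow>
     (\<forall>u\<in>U. u \<subseteq> univ A) \<and>
     (\<forall>a\<in>univ A. \<exists>u\<in>U. a \<in> u) \<and>
     (\<forall>R\<in>symbols \<sigma>. \<forall>xs\<in>rel A R. \<exists>u\<in>U. set xs \<subseteq> u) \<and>
     (\<forall>u\<in>U. isomorphism \<sigma> (\<pi> u) (induced A u) A0)"

definition rigid_symmetry ::
  "'s signature \<Rightarrow> ('b, 's) struct \<Rightarrow> 'b set set \<Rightarrow> ('b set \<Rightarrow> 'b \<Rightarrow> 'a) \<Rightarrow> ('b \<Rightarrow> 'b) \<Rightarrow> bool" where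
  "rigid_symmetry \<sigma> A U \<pi> f \<longleftrightarrow>
     automorphism \<sigma> A f \<and> bij_betw (image f) U U \<and>
     (\<forall>u\<in>U. \<forall>x\<in>u. \<pi> (f ` u) (f x) = \<pi> u x)"

definition fully_symmetric_atlas ::
  "'s signature \<Rightarrow> ('a, 's) struct \<Rightarrow> ('a \<rightharpoonup> 'a) set \<Rightarrow> ('b, 's) struct \<Rightarrow>
   'b set set \<Rightarrow> ('b set \<Rightarrow> 'b \<Rightarrow> 'a) \<Rightarrow> bool" where
  "fully_symmetric_atlas \<sigma> A0 P A U \<pi> \<longleftrightarrow>
     atlas \<sigma> A0 A U \<pi> \<and>
     (\<forall>u\<in>U. \<forall>u'\<in>U. \<exists>f. rigid_symmetry \<sigma> A U \<pi> f \<and> f ` u = u') \<and>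
     (\<forall>u\<in>U. \<forall>u'\<in>U. u \<inter> u' \<noteq> {} \<longrightarrow>
        (\<exists>ps. set ps \<subseteq> P \<and>
           graph_on u' (\<pi> u') \<circ>\<^sub>m pinv (graph_on u (\<pi> u)) = word_comp (univ A0) ps))"

section \<open>Hypergraph acyclicity\<close>

definition hypergraph :: "'b set \<Rightarrow> 'b set set \<Rightarrow> bool" where
  "hypergraph A U \<longleftrightarrow> (\<forall>u\<in>U. finite u \<and> u \<noteq> {}) \<and> A = \<Union>U"

definition gaifman :: "'b set set \<Rightarrow> 'b \<Rightarrow> 'b \<Rightarrow> bool" where
  "gaifman U a a' \<longleftrightarrow> a \<noteq> a' \<and> (\<exists>u\<in>U. a \<in> u \<and> a' \<in> u)"

definition chordless_cycle :: "('b \<Rightarrow> 'b \<Rightarrow> bool) \<Rightarrow> 'b list \<Rightarrow> bool" where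
  "chordless_cycle E xs \<longleftrightarrow>
     length xs \<ge> 3 \<and> distinct xs \<and>
     (\<forall>i<length xs. E (xs ! i) (xs ! (Suc i mod length xs))) \<and>
     (\<forall>i<length xs. \<forall>j<length xs. E (xs ! i) (xs ! j) \<longrightarrow>
        j = Suc i mod length xs \<or> i = Suc j mod length xs)"

definition clique :: "('b \<Rightarrow> 'b \<Rightarrow> bool) \<Rightarrow> 'b set \<Rightarrow> bool" where
  "clique E K \<longleftrightarrow> (\<forall>a\<in>K. \<forall>a'\<in>K. a \<noteq> a' \<longrightarrow> E a a')"

text \<open>Cliques are taken to be non-empty: otherwise the hypergraph without vertices (and hence
  without hyperedges) would not be acyclic, and no hypergraph would be \<open>N\<close>-acyclic.\<close>

definition acyclic_hypergraph :: "'b set \<Rightarrow> 'b set set \<Rightarrow> bool" where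
  "acyclic_hypergraph A U \<longleftrightarrow>
     \<not> (\<exists>xs. set xs \<subseteq> A \<and> chordless_cycle (gaifman U) xs \<and> length xs > 3) \<and>
     (\<forall>K. K \<subseteq> A \<and> K \<noteq> {} \<and> clique (gaifman U) K \<longrightarrow> (\<exists>u\<in>U. K \<subseteq> u))"

definition induced_hyperedges :: "'b set set \<Rightarrow> 'b set \<Rightarrow> 'b set set" where
  "induced_hyperedges U V = {u \<inter> V | u. u \<in> U \<and> u \<inter> V \<noteq> {}}"

definition N_acyclic_hypergraph :: "nat \<Rightarrow> 'b set \<Rightarrow> 'b set set \<Rightarrow> bool" where
  "N_acyclic_hypergraph N A U \<longleftrightarrow>
     hypergraph A U \<and>
     (\<forall>V. V \<subseteq> A \<and> finite V \<and> card V \<le> N \<longrightarrow> acyclic_hypergraph V (induced_hyperedges U V))"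

end

theory Submission imports Defs "HOL-Combinatorics.Permutations" begin

text \<open>Copies of the given structure are glued along a finite group generated by involutions. The group
  is defined by recursion on the set of generators: two words are equal in it if they act alike on all
  sets of bounded size that are acted upon by the groups of all proper subsets of the generators.
  Amalgams of chains of cosets of proper subgroups are such sets, hence the group has no short cycles
  of cosets, and this makes the glued structure acyclic.

  Gluing is done twice. At first the copies are indexed by a frame, a permutation of the base set, and
  a group element; a generator matches two frames along the domain of a partial isomorphism. Since it
  makes sense only at these two frames, one needs a finer group, in which an element that is the value
  of composable words both over \<open>\<alpha>\<close> and over \<open>\<beta>\<close> is the value of a composable word over \<open>\<alpha> \<inter> \<beta>\<close>. The
  result is a symmetric solution. The second gluing uses its co-ordinate domains as frames and the pairs
  of overlapping domains as generators. Now all words may be admitted, and acyclicity follows. Symmetries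
  of the frames permute the generators, and therefore lift to the group and to the glued structure.\<close>

section \<open>Groups generated by involutions\<close>

text \<open>Condition (ii) asks for words over \<open>P\<close> with the right domain. So all
  elements common to two copies must be carried over by one walk, although each of them comes with a
  walk of its own. This needs an intersection property for words that can be applied letter by
  letter, and there lies the obstacle: if a composable word over \<open>\<alpha>\<close> equals one
  over \<open>\<beta>\<close>, the word over \<open>\<alpha> \<inter> \<beta>\<close> that a group
  without short cycles supplies need not be composable.

  Induction over the letter set works for a stronger claim: a factorization of a composable word
  into pieces over \<open>d1\<close>, \<open>d2\<close>, \<open>d3\<close> can be replaced by a
  composable one. The proof is geometric. Over the coarser group \<open>rel1\<close> one considers
  pairs of an observer and an observed point, up to composable movement of the observer. Equal
  elements of \<open>grel\<close> have to act alike on these pairs, which is why \<open>grel\<close>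
  is tested on sets of square size. Three pieces are what a detour through two observed points
  produces, and the argument uses that triangles and squares of cosets degenerate.\<close>

definition eset :: "'e set \<Rightarrow> 'x set \<Rightarrow> ('e \<Rightarrow> 'x \<Rightarrow> 'x) \<Rightarrow> bool" where
  "eset E X \<rho> \<longleftrightarrow> finite X \<and> (\<forall>e\<in>E. \<forall>x\<in>X. \<rho> e x \<in> X \<and> \<rho> e (\<rho> e x) = x)"

definition resp :: "('e list \<times> 'e list) set \<Rightarrow> ('e \<Rightarrow> 'x \<Rightarrow> 'x) \<Rightarrow> 'x \<Rightarrow> bool" where
  "resp R \<rho> x \<longleftrightarrow> (\<forall>(u, v)\<in>R. fold \<rho> u x = fold \<rho> v x)"

definition orbit :: "'e set \<Rightarrow> ('e \<Rightarrow> 'x \<Rightarrow> 'x) \<Rightarrow> 'x \<Rightarrow> 'x set" where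
  "orbit \<gamma> \<rho> x = (\<lambda>u. fold \<rho> u x) ` lists \<gamma>"

lemma rev_in_lists [simp]: "rev u \<in> lists A \<longleftrightarrow> u \<in> lists A"
  by (simp add: in_lists_conv_set)

lemma lists_subD: "u \<in> lists A \<Longrightarrow> A \<subseteq> B \<Longrightarrow> u \<in> lists B"
  using lists_mono by blast

lemma esetD: "eset E X \<rho> \<Longrightarrow> e \<in> E \<Longrightarrow> x \<in> X \<Longrightarrow> \<rho> e x \<in> X"
    "eset E X \<rho> \<Longrightarrow> e \<in> E \<Longrightarrow> x \<in> X \<Longrightarrow> \<rho> e (\<rho> e x) = x"
    "eset E X \<rho> \<Longrightarrow> finite X"
  by (auto simp: eset_def)

lemma eset_mono: "eset E X \<rho> \<Longrightarrow> F \<subseteq> E \<Longrightarrow> eset F X \<rho>"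
  by (auto simp: eset_def)

lemma eset_fold: "eset E X \<rho> \<Longrightarrow> u \<in> lists E \<Longrightarrow> x \<in> X \<Longrightarrow> fold \<rho> u x \<in> X"
  by (induction u arbitrary: x) (auto simp: eset_def)

lemma eset_fold_rev: "eset E X \<rho> \<Longrightarrow> u \<in> lists E \<Longrightarrow> x \<in> X \<Longrightarrow> fold \<rho> (rev u) (fold \<rho> u x) = x"
  by (induction u arbitrary: x) (auto simp: eset_def)

lemma orbit_refl: "x \<in> orbit \<gamma> \<rho> x"
  unfolding orbit_def by (rule image_eqI[of _ _ "[]"]) auto

lemma orbit_fold: "u \<in> lists \<gamma> \<Longrightarrow> fold \<rho> u x \<in> orbit \<gamma> \<rho> x"
  by (auto simp: orbit_def)

lemma orbit_mono: "\<gamma> \<subseteq> \<delta> \<Longrightarrow> orbit \<gamma> \<rho> x \<subseteq> orbit \<delta> \<rho> x"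
  unfolding orbit_def by (intro image_mono lists_mono)

lemma orbit_trans: "y \<in> orbit \<gamma> \<rho> x \<Longrightarrow> z \<in> orbit \<gamma> \<rho> y \<Longrightarrow> z \<in> orbit \<gamma> \<rho> x"
proof -
  assume "y \<in> orbit \<gamma> \<rho> x" "z \<in> orbit \<gamma> \<rho> y"
  then obtain u v where "u \<in> lists \<gamma>" "v \<in> lists \<gamma>" "z = fold \<rho> (u @ v) x" by (auto simp: orbit_def)
  then show ?thesis by (metis append_in_lists_conv orbit_fold)
qed

lemma orbit_sub: "eset E X \<rho> \<Longrightarrow> \<gamma> \<subseteq> E \<Longrightarrow> x \<in> X \<Longrightarrow> orbit \<gamma> \<rho> x \<subseteq> X"
  using eset_fold[OF eset_mono] by (fastforce simp: orbit_def)

lemma orbit_sym: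
  assumes "eset E X \<rho>" "\<gamma> \<subseteq> E" "x \<in> X" "y \<in> orbit \<gamma> \<rho> x" shows "x \<in> orbit \<gamma> \<rho> y"
proof -
  obtain u where u: "u \<in> lists \<gamma>" "y = fold \<rho> u x" using assms(4) by (auto simp: orbit_def)
  then have "x = fold \<rho> (rev u) y" using eset_fold_rev[OF eset_mono[OF assms(1,2)]] assms(3) by auto
  then show ?thesis using u(1) orbit_fold[of "rev u"] by (metis in_lists_conv_set set_rev)
qed

lemma orbit_eset: "eset E X \<rho> \<Longrightarrow> \<gamma> \<subseteq> E \<Longrightarrow> x \<in> X \<Longrightarrow> eset \<gamma> (orbit \<gamma> \<rho> x) \<rho>"
proof -
  assume a: "eset E X \<rho>" "\<gamma> \<subseteq> E" "x \<in> X"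
  have s: "orbit \<gamma> \<rho> x \<subseteq> X" using a by (rule orbit_sub)
  have "\<rho> e y \<in> orbit \<gamma> \<rho> x" if "e \<in> \<gamma>" "y \<in> orbit \<gamma> \<rho> x" for e y
    using that orbit_trans[of y \<gamma> \<rho> x] orbit_fold[of "[e]" \<gamma> \<rho> y] by auto
  moreover have "\<rho> e (\<rho> e y) = y" if "e \<in> \<gamma>" "y \<in> orbit \<gamma> \<rho> x" for e y
    using that s a by (intro esetD(2)[OF a(1)]) auto
  ultimately show ?thesis using a s finite_subset by (auto simp: eset_def)
qed

text \<open>Two words are identified if they act alike on all sets of size \<open>m\<close> that respect the relations
  \<open>r \<gamma>\<close> for the proper subsets \<open>\<gamma>\<close> of the generators.\<close>

definition step :: "nat \<Rightarrow> ('e set \<Rightarrow> ('e list \<times> 'e list) set) \<Rightarrow> 'e set \<Rightarrow> ('e list \<times> 'e list) set" where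
  "step m r E = {(u, v). u \<in> lists E \<and> v \<in> lists E \<and>
     (\<forall>\<rho> :: 'e \<Rightarrow> nat \<Rightarrow> nat. eset E {..<m} \<rho> \<and> (\<forall>\<gamma>. \<gamma> \<subset> E \<longrightarrow> (\<forall>x<m. resp (r \<gamma>) \<rho> x)) \<longrightarrow>
        (\<forall>x<m. fold \<rho> u x = fold \<rho> v x))}"

lemma step_sub: "step m r E \<subseteq> lists E \<times> lists E"
  by (auto simp: step_def)

text \<open>Test sets live on \<open>nat\<close> because a definition cannot quantify over types. A
  set of at most \<open>m\<close> points is copied onto an initial segment of \<open>{..<m}\<close>;
  the remaining numbers are fixed by every letter, so they respect all relations.\<close>

lemma step_act:
  fixes \<rho> :: "'e \<Rightarrow> 'x \<Rightarrow> 'x"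
  assumes uv: "(u, v) \<in> step m r E" and X: "eset E X \<rho>" "card X \<le> m"
    and good: "\<And>\<gamma> x. \<gamma> \<subset> E \<Longrightarrow> x \<in> X \<Longrightarrow> resp (r \<gamma>) \<rho> x"
    and sub: "\<And>\<gamma>. \<gamma> \<subset> E \<Longrightarrow> r \<gamma> \<subseteq> lists \<gamma> \<times> lists \<gamma>" and x: "x \<in> X"
  shows "fold \<rho> u x = fold \<rho> v x"
proof -
  have fin: "finite X" using X by (auto simp: eset_def)
  obtain h where h: "bij_betw h X {..<card X}"
    using ex_bij_betw_finite_nat[OF fin] by (auto simp: atLeast0LessThan)
  define g where "g = inv_into X h"
  have hX: "h y < card X" "g (h y) = y" if "y \<in> X" for y
    using h that unfolding g_def by (auto simp: bij_betw_def)
  have gX: "g n \<in> X" "h (g n) = n" if "n < card X" for n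
    using h that unfolding g_def by (auto simp: bij_betw_def f_inv_into_f inv_into_into)
  define \<rho>' where "\<rho>' = (\<lambda>e n. if n < card X then h (\<rho> e (g n)) else n)"
  have f1: "fold \<rho>' w (h y) = h (fold \<rho> w y) \<and> fold \<rho> w y \<in> X" if "w \<in> lists E" "y \<in> X" for w y
    using that
  proof (induction w arbitrary: y rule: list.induct)
    case (Cons e w)
    have "\<rho> e y \<in> X" using Cons X by (auto simp: eset_def)
    moreover have "\<rho>' e (h y) = h (\<rho> e y)" using hX[OF Cons.prems(2)] by (simp add: \<rho>'_def)
    ultimately show ?case using Cons by auto
  qed auto
  have f2: "fold \<rho>' w n = n" if "\<not> n < card X" for w n
    using that by (induction w) (auto simp: \<rho>'_def)
  have e': "eset E {..<m} \<rho>'"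
    unfolding eset_def
  proof (intro conjI ballI)
    fix e n assume e: "e \<in> E" and n: "n \<in> {..<m}"
    show "\<rho>' e n \<in> {..<m}" "\<rho>' e (\<rho>' e n) = n"
      using n gX[of n] hX[of "\<rho> e (g n)"] esetD(1,2)[OF X(1) e, of "g n"] X(2)
      by (auto simp: \<rho>'_def)
  qed simp
  have r': "resp (r \<gamma>) \<rho>' n" if "\<gamma> \<subset> E" "n < m" for \<gamma> n
  proof (cases "n < card X")
    case True
    have "fold \<rho>' a n = fold \<rho>' b n" if ab: "(a, b) \<in> r \<gamma>" for a b
    proof -
      have "a \<in> lists E" "b \<in> lists E" using sub[OF \<open>\<gamma> \<subset> E\<close>] ab \<open>\<gamma> \<subset> E\<close> by auto
      then show ?thesis
        using f1[of a "g n"] f1[of b "g n"] gX[OF True] good[OF \<open>\<gamma> \<subset> E\<close>, of "g n"] ab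
        by (auto simp: resp_def)
    qed
    then show ?thesis by (auto simp: resp_def)
  qed (simp add: resp_def f2)
  have "h x < m" using hX(1)[OF x] X(2) by simp
  then have "fold \<rho>' u (h x) = fold \<rho>' v (h x)"
    using uv e' r' unfolding step_def by auto
  moreover have "u \<in> lists E" "v \<in> lists E" using uv by (auto simp: step_def)
  ultimately have "h (fold \<rho> u x) = h (fold \<rho> v x)" "fold \<rho> u x \<in> X" "fold \<rho> v x \<in> X"
    using f1[of u x] f1[of v x] x by auto
  then show ?thesis by (metis hX(2))
qed

lemma step_antimono:
  fixes r :: "'e set \<Rightarrow> ('e list \<times> 'e list) set"
  assumes "n \<le> m" and "\<And>\<gamma>. \<gamma> \<subset> E \<Longrightarrow> r \<gamma> \<subseteq> lists \<gamma> \<times> lists \<gamma>"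
  shows "step m r E \<subseteq> step n r E"
proof
  fix p assume p: "p \<in> step m r E"
  obtain u v where uv: "p = (u, v)" by force
  have "u \<in> lists E" "v \<in> lists E" using p uv by (auto simp: step_def)
  moreover have "fold \<rho> u x = fold \<rho> v x"
    if "eset E {..<n} \<rho>" "\<forall>\<gamma>. \<gamma> \<subset> E \<longrightarrow> (\<forall>x<n. resp (r \<gamma>) \<rho> x)" "x < n" for \<rho> :: "'e \<Rightarrow> nat \<Rightarrow> nat" and x
    using step_act[of u v m r E "{..<n}" \<rho> x] p uv that assms by auto
  ultimately show "p \<in> step n r E" using uv by (auto simp: step_def)
qed

lemma step_cong: "(\<And>\<gamma>. \<gamma> \<subset> E \<Longrightarrow> r \<gamma> = s \<gamma>) \<Longrightarrow> step m r E = step m s E"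
  unfolding step_def by auto

lemma step_proper: "\<gamma> \<subset> E \<Longrightarrow> r \<gamma> \<subseteq> lists \<gamma> \<times> lists \<gamma> \<Longrightarrow> r \<gamma> \<subseteq> step m r E"
proof -
  assume a: "\<gamma> \<subset> E" "r \<gamma> \<subseteq> lists \<gamma> \<times> lists \<gamma>"
  have l: "lists \<gamma> \<subseteq> lists E" using a by (intro lists_mono) auto
  show ?thesis
  proof
    fix p assume "p \<in> r \<gamma>"
    then obtain u v where p: "p = (u, v)" "(u, v) \<in> r \<gamma>" by (cases p) auto
    then have "u \<in> lists E" "v \<in> lists E" using a(2) l by blast+
    moreover have "fold \<rho> u x = fold \<rho> v x"
      if "\<forall>\<gamma>. \<gamma> \<subset> E \<longrightarrow> (\<forall>x<m. resp (r \<gamma>) \<rho> x)" "x < m" for \<rho> :: "'a \<Rightarrow> nat \<Rightarrow> nat" and x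
    proof -
      have "resp (r \<gamma>) \<rho> x" using that a(1) by blast
      then show ?thesis using p(2) unfolding resp_def by (drule_tac bspec) auto
    qed
    ultimately show "p \<in> step m r E" using p(1) by (simp add: step_def)
  qed
qed

text \<open>Congruences on words in which every letter is an involution, that is, groups presented by
  involutive generators.\<close>

locale word_group =
  fixes E :: "'e set" and R :: "('e list \<times> 'e list) set"
  assumes sub: "R \<subseteq> lists E \<times> lists E"
    and refl: "u \<in> lists E \<Longrightarrow> (u, u) \<in> R"
    and sym: "(u, v) \<in> R \<Longrightarrow> (v, u) \<in> R"
    and trans: "(u, v) \<in> R \<Longrightarrow> (v, w) \<in> R \<Longrightarrow> (u, w) \<in> R"
    and cong: "(u, v) \<in> R \<Longrightarrow> a \<in> lists E \<Longrightarrow> b \<in> lists E \<Longrightarrow> (a @ u @ b, a @ v @ b) \<in> R"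
    and invol: "e \<in> E \<Longrightarrow> ([e, e], []) \<in> R"
begin

lemma dom: "(u, v) \<in> R \<Longrightarrow> u \<in> lists E" "(u, v) \<in> R \<Longrightarrow> v \<in> lists E"
  using sub by auto

lemma congL: "(u, v) \<in> R \<Longrightarrow> a \<in> lists E \<Longrightarrow> (a @ u, a @ v) \<in> R"
  using cong[of u v a "[]"] by simp

lemma congR: "(u, v) \<in> R \<Longrightarrow> a \<in> lists E \<Longrightarrow> (u @ a, v @ a) \<in> R"
  using cong[of u v "[]" a] by simp

lemma rev_right: "u \<in> lists E \<Longrightarrow> (u @ rev u, []) \<in> R"
proof (induction u)
  case (Cons e u)
  then have "([e] @ (u @ rev u) @ [e], [e] @ [] @ [e]) \<in> R" by (intro cong) auto
  then show ?case using invol[of e] Cons by (auto intro: trans)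
qed (simp add: refl)

lemma rev_left: "u \<in> lists E \<Longrightarrow> (rev u @ u, []) \<in> R"
  using rev_right[of "rev u"] by simp

lemma moveL: "a \<in> lists E \<Longrightarrow> u \<in> lists E \<Longrightarrow> (a @ u, v) \<in> R \<longleftrightarrow> (u, rev a @ v) \<in> R"
proof
  assume a: "a \<in> lists E" "u \<in> lists E" "(a @ u, v) \<in> R"
  then have "(rev a @ a @ u, rev a @ v) \<in> R" by (intro congL) auto
  moreover have "((rev a @ a) @ u, [] @ u) \<in> R" using a by (intro congR rev_left) auto
  ultimately show "(u, rev a @ v) \<in> R" by (metis append.assoc append_Nil sym trans)
next
  assume a: "a \<in> lists E" "u \<in> lists E" "(u, rev a @ v) \<in> R"
  then have "(a @ u, a @ rev a @ v) \<in> R" by (intro congL) auto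
  moreover have "((a @ rev a) @ v, [] @ v) \<in> R" using a dom(2)[OF a(3)] by (intro congR rev_right) auto
  ultimately show "(a @ u, v) \<in> R" by (metis append.assoc append_Nil trans)
qed

lemma moveR: "a \<in> lists E \<Longrightarrow> u \<in> lists E \<Longrightarrow> (u @ a, v) \<in> R \<longleftrightarrow> (u, v @ rev a) \<in> R"
proof
  assume a: "a \<in> lists E" "u \<in> lists E" "(u @ a, v) \<in> R"
  then have "((u @ a) @ rev a, v @ rev a) \<in> R" by (intro congR) auto
  moreover have "(u @ (a @ rev a), u @ []) \<in> R" using a by (intro congL rev_right) auto
  ultimately show "(u, v @ rev a) \<in> R" by (metis append.assoc append_Nil2 sym trans)
next
  assume a: "a \<in> lists E" "u \<in> lists E" "(u, v @ rev a) \<in> R"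
  then have "(u @ a, (v @ rev a) @ a) \<in> R" by (intro congR) auto
  moreover have "(v @ (rev a @ a), v @ []) \<in> R" using a dom(2)[OF a(3)] by (intro congL rev_left) auto
  ultimately show "(u @ a, v) \<in> R" by (metis append.assoc append_Nil2 trans)
qed

lemma cancelL: "a \<in> lists E \<Longrightarrow> u \<in> lists E \<Longrightarrow> v \<in> lists E \<Longrightarrow> (a @ u, a @ v) \<in> R \<longleftrightarrow> (u, v) \<in> R"
proof -
  assume a: "a \<in> lists E" "u \<in> lists E" "v \<in> lists E"
  have "(u, v) \<in> R" if "(a @ u, a @ v) \<in> R"
  proof -
    have "(u, rev a @ a @ v) \<in> R" using that a moveL by auto
    moreover have "((rev a @ a) @ v, [] @ v) \<in> R" using a by (intro congR rev_left) auto
    ultimately show ?thesis by (metis append.assoc append_Nil trans)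
  qed
  then show ?thesis using a congL by blast
qed

lemma equiv: "equiv (lists E) R"
proof (intro equivI refl_onI symI transI)
  show "R \<subseteq> lists E \<times> lists E" by (rule sub)
qed (use refl sym trans in blast)+

end

lemma step_word_group: "word_group E (step m r E)"
proof
  show "step m r E \<subseteq> lists E \<times> lists E" by (rule step_sub)
  show "(u, u) \<in> step m r E" if "u \<in> lists E" for u using that by (auto simp: step_def)
  show "(v, u) \<in> step m r E" if "(u, v) \<in> step m r E" for u v using that by (auto simp: step_def)
  show "(u, w) \<in> step m r E" if "(u, v) \<in> step m r E" "(v, w) \<in> step m r E" for u v w
    using that by (auto simp: step_def)
  show "(a @ u @ b, a @ v @ b) \<in> step m r E" if h: "(u, v) \<in> step m r E" "a \<in> lists E" "b \<in> lists E" for u v a b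
  proof -
    have "fold \<rho> u (fold \<rho> a x) = fold \<rho> v (fold \<rho> a x)"
      if "eset E {..<m} \<rho>" "\<forall>\<gamma>. \<gamma> \<subset> E \<longrightarrow> (\<forall>x<m. resp (r \<gamma>) \<rho> x)" "x < m" for \<rho> :: "'a \<Rightarrow> nat \<Rightarrow> nat" and x
      using h(1) that eset_fold[OF that(1) h(2), of x] by (auto simp: step_def)
    then show ?thesis using h by (auto simp: step_def)
  qed
  show "([e, e], []) \<in> step m r E" if "e \<in> E" for e using that by (auto simp: step_def eset_def)
qed

lemma finite_image_factor:
  assumes "finite (f ` A)" "\<And>x y. x \<in> A \<Longrightarrow> y \<in> A \<Longrightarrow> f x = f y \<Longrightarrow> g x = g y"
  shows "finite (g ` A)"
proof -
  have "g ` A \<subseteq> (\<lambda>z. g (inv_into A f z)) ` (f ` A)"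
  proof
    fix z assume "z \<in> g ` A"
    then obtain x where x: "x \<in> A" "z = g x" by auto
    have "g (inv_into A f (f x)) = g x"
      by (rule assms(2)) (use x in \<open>auto simp: inv_into_into f_inv_into_f\<close>)
    then show "z \<in> (\<lambda>z. g (inv_into A f z)) ` (f ` A)" using x by (metis imageI)
  qed
  then show ?thesis using assms(1) finite_surj by blast
qed

lemma finite_classes:
  assumes "finite E" shows "finite (lists E // step m r E)"
proof -
  \<comment> \<open>Infinitely many functions \<open>\<rho>\<close> restrict to the same action, so
    only the graph on \<open>E\<close> and \<open>{..<m}\<close> is kept. The table \<open>F\<close>
    of values then determines a word up to \<open>step\<close>, and there are finitely many
    tables.\<close>
  define T where "T = (\<lambda>\<rho>::'a \<Rightarrow> nat \<Rightarrow> nat. {(e, x, \<rho> e x) |e x. e \<in> E \<and> x < m})"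
  define G where "G = {\<rho>. eset E {..<m} \<rho> \<and> (\<forall>\<gamma>. \<gamma> \<subset> E \<longrightarrow> (\<forall>x<m. resp (r \<gamma>) \<rho> x))}"
  define F where "F = (\<lambda>u. {(T \<rho>, x, fold \<rho> u x) |\<rho> x. \<rho> \<in> G \<and> x < m})"
  have T: "fold \<rho> u x = fold \<rho>' u x"
    if "T \<rho> = T \<rho>'" "\<rho> \<in> G" "u \<in> lists E" "x < m" for \<rho> \<rho>' u x
    using that(3,4)
  proof (induction u arbitrary: x rule: list.induct)
    case (Cons e u)
    have "(e, x, \<rho> e x) \<in> T \<rho>" using Cons.prems unfolding T_def by auto
    then have "(e, x, \<rho> e x) \<in> T \<rho>'" using that(1) by simp
    then have "\<rho> e x = \<rho>' e x" unfolding T_def by blast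
    moreover have "\<rho> e x < m" using that(2) Cons by (auto simp: G_def eset_def)
    ultimately show ?case using Cons by auto
  qed simp
  have sub: "F ` lists E \<subseteq> Pow (Pow (E \<times> {..<m} \<times> {..<m}) \<times> {..<m} \<times> {..<m})"
  proof (rule image_subsetI)
    fix u assume u: "u \<in> lists E"
    show "F u \<in> Pow (Pow (E \<times> {..<m} \<times> {..<m}) \<times> {..<m} \<times> {..<m})"
    proof (rule PowI, rule subsetI)
      fix p assume "p \<in> F u"
      then obtain \<rho> x where p: "p = (T \<rho>, x, fold \<rho> u x)" "\<rho> \<in> G" "x < m" by (auto simp: F_def)
      have e: "eset E {..<m} \<rho>" using p by (auto simp: G_def)
      have "fold \<rho> u x < m" using eset_fold[OF e u, of x] p by auto
      moreover have "T \<rho> \<subseteq> E \<times> {..<m} \<times> {..<m}" using esetD(1)[OF e] by (auto simp: T_def)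
      ultimately show "p \<in> Pow (E \<times> {..<m} \<times> {..<m}) \<times> {..<m} \<times> {..<m}" using p by auto
    qed
  qed
  have "finite (F ` lists E)" by (rule finite_subset[OF sub]) (use assms in auto)
  then have "finite ((\<lambda>u. step m r E `` {u}) ` lists E)"
  proof (rule finite_image_factor)
    fix u v assume uv: "u \<in> lists E" "v \<in> lists E" "F u = F v"
    have "(u, v) \<in> step m r E"
      unfolding step_def
    proof (rule CollectI, rule case_prodI)
      show "u \<in> lists E \<and> v \<in> lists E \<and> (\<forall>\<rho>::'a \<Rightarrow> nat \<Rightarrow> nat. eset E {..<m} \<rho> \<and> (\<forall>\<gamma>. \<gamma> \<subset> E \<longrightarrow> (\<forall>x<m. resp (r \<gamma>) \<rho> x)) \<longrightarrow>
        (\<forall>x<m. fold \<rho> u x = fold \<rho> v x))"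
      proof (intro conjI allI impI)
        fix \<rho> :: "'a \<Rightarrow> nat \<Rightarrow> nat" and x
        assume h: "eset E {..<m} \<rho> \<and> (\<forall>\<gamma>. \<gamma> \<subset> E \<longrightarrow> (\<forall>x<m. resp (r \<gamma>) \<rho> x))" "x < m"
        then have "\<rho> \<in> G" unfolding G_def by simp
        then have "(T \<rho>, x, fold \<rho> u x) \<in> F u" unfolding F_def using h(2) by blast
        then have "(T \<rho>, x, fold \<rho> u x) \<in> F v" using uv(3) by simp
        then obtain \<rho>' where "T \<rho> = T \<rho>'" "fold \<rho> u x = fold \<rho>' v x" "\<rho>' \<in> G" by (auto simp: F_def)
        then show "fold \<rho> u x = fold \<rho> v x" using T[of \<rho> \<rho>' v x] \<open>\<rho> \<in> G\<close> h(2) uv(2) by simp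
      qed (use uv in auto)
    qed
    then show "step m r E `` {u} = step m r E `` {v}"
      using equiv_class_eq[OF word_group.equiv[OF step_word_group]] by blast
  qed
  then show ?thesis by (simp add: quotient_def UNION_singleton_eq_range)
qed

text \<open>The test sets for \<open>rel1\<close> have room for an amalgam of \<open>M\<close> cosets of proper subgroups. Those for
  \<open>grel\<close> also have room for the pairs of points of a set on which \<open>rel1\<close> acts with at most \<open>M\<close> free
  orbits.\<close>

definition nclasses :: "'e set \<Rightarrow> ('e list \<times> 'e list) set \<Rightarrow> nat" where
  "nclasses E R = card (lists E // R)"

definition size1 :: "nat \<Rightarrow> ('e set \<Rightarrow> ('e list \<times> 'e list) set) \<Rightarrow> 'e set \<Rightarrow> nat" where
  "size1 M r E = M * (1 + (\<Sum>\<gamma>\<in>{\<gamma>. \<gamma> \<subset> E}. nclasses \<gamma> (r \<gamma>)))"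

definition rel1 :: "nat \<Rightarrow> ('e set \<Rightarrow> ('e list \<times> 'e list) set) \<Rightarrow> 'e set \<Rightarrow> ('e list \<times> 'e list) set" where
  "rel1 M r E = step (size1 M r E) r E"

definition size2 :: "nat \<Rightarrow> ('e set \<Rightarrow> ('e list \<times> 'e list) set) \<Rightarrow> 'e set \<Rightarrow> nat" where
  "size2 M r E = size1 M r E + (M * nclasses E (rel1 M r E))\<^sup>2"

lemma size1_cong: "(\<And>\<gamma>. \<gamma> \<subset> E \<Longrightarrow> r \<gamma> = s \<gamma>) \<Longrightarrow> size1 M r E = size1 M s E"
  unfolding size1_def by (auto intro!: sum.cong arg_cong[where f="\<lambda>x. M * x"])

lemma rel1_cong: "(\<And>\<gamma>. \<gamma> \<subset> E \<Longrightarrow> r \<gamma> = s \<gamma>) \<Longrightarrow> rel1 M r E = rel1 M s E"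
  unfolding rel1_def by (simp add: size1_cong[of E r s M] step_cong[of E r s])

lemma size2_cong: "(\<And>\<gamma>. \<gamma> \<subset> E \<Longrightarrow> r \<gamma> = s \<gamma>) \<Longrightarrow> size2 M r E = size2 M s E"
  unfolding size2_def by (simp add: size1_cong[of E r s M] rel1_cong[of E r s M])

text \<open>The intended recursion descends to proper subsets, which is not structural; the number
  \<open>n\<close> is fuel that decreases instead. For finite \<open>E\<close>, fuel above
  \<open>card E\<close> does not influence the result.\<close>

primrec grel_upto :: "nat \<Rightarrow> nat \<Rightarrow> 'e set \<Rightarrow> ('e list \<times> 'e list) set" where
  "grel_upto M 0 E = {}"
| "grel_upto M (Suc n) E = step (size2 M (grel_upto M n) E) (grel_upto M n) E"

definition grel :: "nat \<Rightarrow> 'e set \<Rightarrow> ('e list \<times> 'e list) set" where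
  "grel M E = grel_upto M (Suc (card E)) E"

lemma grel_upto_stable: "finite E \<Longrightarrow> card E < n \<Longrightarrow> grel_upto M n E = grel M E"
proof (induction n arbitrary: E rule: less_induct)
  case (less n)
  obtain k where k: "n = Suc k" using less by (cases n) auto
  have "grel_upto M k \<gamma> = grel_upto M (card E) \<gamma>" if "\<gamma> \<subset> E" for \<gamma>
  proof -
    have c: "card \<gamma> < card E" "finite \<gamma>" using that less(2) psubset_card_mono finite_subset by blast+
    have "grel_upto M k \<gamma> = grel M \<gamma>" using less c k by auto
    moreover have "grel_upto M (card E) \<gamma> = grel M \<gamma>" using less c k by auto
    ultimately show ?thesis by simp
  qed
  then show ?case
    unfolding grel_def k grel_upto.simps
    by (simp add: size2_cong[of E "grel_upto M k" "grel_upto M (card E)" M]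
        step_cong[of E "grel_upto M k" "grel_upto M (card E)"])
qed

lemma grel_unfold: "finite E \<Longrightarrow> grel M E = step (size2 M (grel M) E) (grel M) E"
proof -
  assume E: "finite E"
  have "grel_upto M (card E) \<gamma> = grel M \<gamma>" if "\<gamma> \<subset> E" for \<gamma>
    using that E psubset_card_mono[OF E] finite_subset[of \<gamma> E] by (intro grel_upto_stable) auto
  then show ?thesis
    unfolding grel_def[of M E] grel_upto.simps
    by (simp add: size2_cong[of E "grel_upto M (card E)" "grel M" M]
        step_cong[of E "grel_upto M (card E)" "grel M"])
qed

lemma grel_sub: "grel M E \<subseteq> lists E \<times> lists E"
  unfolding grel_def grel_upto.simps by (rule step_sub)

lemma grel_word_group: "word_group E (grel M E)"
  unfolding grel_def grel_upto.simps by (rule step_word_group)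

lemma rel1_word_group: "word_group E (rel1 M r E)"
  unfolding rel1_def by (rule step_word_group)

lemma finite_grel: "finite E \<Longrightarrow> finite (lists E // grel M E)"
  unfolding grel_def grel_upto.simps by (rule finite_classes)

lemma finite_rel1: "finite E \<Longrightarrow> finite (lists E // rel1 M r E)"
  unfolding rel1_def by (rule finite_classes)

lemma grel_rel1: "finite E \<Longrightarrow> grel M E \<subseteq> rel1 M (grel M) E"
  unfolding rel1_def grel_unfold[of E]
  by (rule step_antimono) (auto simp: size2_def grel_sub)

lemma grel_proper_rel1: "\<gamma> \<subset> E \<Longrightarrow> grel M \<gamma> \<subseteq> rel1 M (grel M) E"
  unfolding rel1_def by (rule step_proper) (auto simp: grel_sub)

lemma grel_mono: "finite E \<Longrightarrow> \<gamma> \<subseteq> E \<Longrightarrow> grel M \<gamma> \<subseteq> grel M E"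
  using step_proper[of \<gamma> E "grel M", OF _ grel_sub] grel_unfold[of E M] by (cases "\<gamma> = E") auto

text \<open>Prefixing both words with the path from \<open>y\<close> back to \<open>x\<close> shifts
  the base point, and a congruence is invariant under this. So respect is a property of whole
  orbits.\<close>

lemma resp_orbit:
  assumes "eset E X \<rho>" "\<gamma> \<subseteq> E" "x \<in> X" "y \<in> orbit \<gamma> \<rho> x" "resp (grel M \<gamma>) \<rho> y"
  shows "resp (grel M \<gamma>) \<rho> x"
proof -
  interpret word_group \<gamma> "grel M \<gamma>" by (rule grel_word_group)
  obtain t where t: "t \<in> lists \<gamma>" "y = fold \<rho> t x" using assms(4) by (auto simp: orbit_def)
  have x: "x = fold \<rho> (rev t) y" using t eset_fold_rev[OF eset_mono[OF assms(1,2)]] assms(3) by auto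
  have "fold \<rho> u x = fold \<rho> v x" if "(u, v) \<in> grel M \<gamma>" for u v
  proof -
    have "(rev t @ u, rev t @ v) \<in> grel M \<gamma>" using that t by (intro congL) auto
    then have "fold \<rho> (rev t @ u) y = fold \<rho> (rev t @ v) y" using assms(5) by (auto simp: resp_def)
    then show ?thesis using x by simp
  qed
  then show ?thesis by (auto simp: resp_def)
qed

text \<open>It suffices to look at the large orbits: by induction on \<open>\<gamma>\<close>, a small \<open>\<gamma>\<close>-orbit is itself
  one of the test sets that define \<open>grel M \<gamma>\<close>.\<close>

lemma size_principle:
  assumes E: "finite E" and X: "eset E X \<rho>"
    and large: "\<And>\<gamma> x. \<gamma> \<subset> E \<Longrightarrow> x \<in> X \<Longrightarrow>
        (\<exists>y\<in>orbit \<gamma> \<rho> x. resp (grel M \<gamma>) \<rho> y) \<or> card (orbit \<gamma> \<rho> x) \<le> size1 M (grel M) \<gamma>"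
  shows "\<gamma> \<subset> E \<Longrightarrow> x \<in> X \<Longrightarrow> resp (grel M \<gamma>) \<rho> x"
proof (induction "card \<gamma>" arbitrary: \<gamma> x rule: less_induct)
  case less
  have f\<gamma>: "finite \<gamma>" using less E finite_subset by blast
  consider y where "y \<in> orbit \<gamma> \<rho> x" "resp (grel M \<gamma>) \<rho> y" | "card (orbit \<gamma> \<rho> x) \<le> size1 M (grel M) \<gamma>"
    using large[OF less(2,3)] by blast
  then show ?case
  proof cases
    case 1 then show ?thesis using resp_orbit[OF X] less by blast
  next
    case 2
    have o: "eset \<gamma> (orbit \<gamma> \<rho> x) \<rho>" using orbit_eset[OF X] less by auto
    have "fold \<rho> u x = fold \<rho> v x" if uv: "(u, v) \<in> grel M \<gamma>" for u v
    proof (rule step_act[OF _ o])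
      show "(u, v) \<in> step (size1 M (grel M) \<gamma>) (grel M) \<gamma>"
        using grel_rel1[OF f\<gamma>, of M] uv by (auto simp: rel1_def)
      show "resp (grel M \<delta>) \<rho> y" if d: "\<delta> \<subset> \<gamma>" "y \<in> orbit \<gamma> \<rho> x" for \<delta> y
        using less(1)[of \<delta> y] psubset_card_mono[OF f\<gamma> d(1)] d(1) less(2) orbit_sub[OF X _ less(3), of \<gamma>] d(2) by blast
    qed (rule 2 grel_sub orbit_refl)+
    then show ?thesis by (auto simp: resp_def)
  qed
qed

section \<open>Coset graphs\<close>

lemma (in word_group) card_image_classes:
  assumes "finite (lists E // R)" "\<And>u v. (u, v) \<in> R \<Longrightarrow> f u = f v"
  shows "finite (f ` lists E) \<and> card (f ` lists E) \<le> nclasses E R"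
proof -
  have "f ` lists E \<subseteq> (\<lambda>C. f (SOME u. u \<in> C)) ` (lists E // R)"
  proof
    fix y assume "y \<in> f ` lists E"
    then obtain u where u: "u \<in> lists E" "y = f u" by auto
    have "u \<in> R `` {u}" using refl[OF u(1)] by auto
    then have "(SOME v. v \<in> R `` {u}) \<in> R `` {u}" by (rule someI)
    then have "f u = f (SOME v. v \<in> R `` {u})" using assms(2) by auto
    moreover have "R `` {u} \<in> lists E // R" using u(1) by (rule quotientI)
    ultimately show "y \<in> (\<lambda>C. f (SOME u. u \<in> C)) ` (lists E // R)" using u(2) by blast
  qed
  then show ?thesis
    unfolding nclasses_def using assms(1) surj_card_le finite_surj by metis
qed

lemma size1_ge_sum:
  assumes "n \<le> M" shows "n * (\<Sum>\<gamma>\<in>{\<gamma>. \<gamma> \<subset> E}. nclasses \<gamma> (r \<gamma>)) \<le> size1 M r E"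
  unfolding size1_def using assms by (intro mult_mono) auto

text \<open>The summand 1 in \<open>size1\<close> is there for this bound: a position set of at most
  \<open>M\<close> points is a test set even if there are no proper subsets to contribute to the
  sum.\<close>

lemma size1_ge: "n \<le> M \<Longrightarrow> n \<le> size1 M r E"
  unfolding size1_def by (simp add: le_trans)

lemma nclasses_le_sum:
  assumes "finite E" "\<gamma> \<subset> E" shows "nclasses \<gamma> (r \<gamma>) \<le> (\<Sum>\<gamma>\<in>{\<gamma>. \<gamma> \<subset> E}. nclasses \<gamma> (r \<gamma>))"
proof -
  have "finite {\<gamma>. \<gamma> \<subset> E}" by (rule finite_subset[of _ "Pow E"]) (use assms in auto)
  then show ?thesis using assms(2) member_le_sum[of \<gamma> "{\<gamma>. \<gamma> \<subset> E}" "\<lambda>\<gamma>. nclasses \<gamma> (r \<gamma>)"] by auto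
qed

lemma rel1_act:
  fixes \<rho> :: "'e \<Rightarrow> 'x \<Rightarrow> 'x"
  assumes "finite E" "eset E X \<rho>" "card X \<le> size1 M (grel M) E"
    and "\<And>\<gamma> x. \<gamma> \<subset> E \<Longrightarrow> x \<in> X \<Longrightarrow>
        (\<exists>y\<in>orbit \<gamma> \<rho> x. resp (grel M \<gamma>) \<rho> y) \<or> card (orbit \<gamma> \<rho> x) \<le> size1 M (grel M) \<gamma>"
    and "(u, v) \<in> rel1 M (grel M) E" "x \<in> X"
  shows "fold \<rho> u x = fold \<rho> v x"
  by (rule step_act[OF assms(5)[unfolded rel1_def] assms(2,3) size_principle[OF assms(1,2,4)]
        grel_sub assms(6)])

lemma grel_act:
  fixes \<rho> :: "'e \<Rightarrow> 'x \<Rightarrow> 'x"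
  assumes "finite E" "eset E X \<rho>" "card X \<le> size2 M (grel M) E"
    and "\<And>\<gamma> x. \<gamma> \<subset> E \<Longrightarrow> x \<in> X \<Longrightarrow>
        (\<exists>y\<in>orbit \<gamma> \<rho> x. resp (grel M \<gamma>) \<rho> y) \<or> card (orbit \<gamma> \<rho> x) \<le> size1 M (grel M) \<gamma>"
    and "(u, v) \<in> grel M E" "x \<in> X"
  shows "fold \<rho> u x = fold \<rho> v x"
  by (rule step_act[OF assms(5)[unfolded grel_unfold[OF assms(1)]] assms(2,3)
        size_principle[OF assms(1,2,4)] grel_sub assms(6)])

text \<open>A set covered by images of coset graphs. A letter acts at a point through any chart that
  contains the letter, and trivially if there is none.\<close>

locale coset_atlas =
  fixes M :: nat and J :: "'j set" and al :: "'j \<Rightarrow> 'e set" and ch :: "'j \<Rightarrow> 'e list \<Rightarrow> 'x"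
  assumes fin_J: "finite J" and fin_al: "j \<in> J \<Longrightarrow> finite (al j)"
    and ch_cong: "j \<in> J \<Longrightarrow> (u, v) \<in> grel M (al j) \<Longrightarrow> ch j u = ch j v"
    and cons: "j \<in> J \<Longrightarrow> k \<in> J \<Longrightarrow> u \<in> lists (al j) \<Longrightarrow> v \<in> lists (al k) \<Longrightarrow> ch j u = ch k v \<Longrightarrow>
      e \<in> al j \<Longrightarrow> e \<in> al k \<Longrightarrow> ch j (u @ [e]) = ch k (v @ [e])"
begin

definition moves :: "'e \<Rightarrow> 'x \<Rightarrow> 'x \<Rightarrow> bool" where
  "moves e p q \<longleftrightarrow> (\<exists>j\<in>J. \<exists>u\<in>lists (al j). e \<in> al j \<and> p = ch j u \<and> q = ch j (u @ [e]))"

definition act :: "'e \<Rightarrow> 'x \<Rightarrow> 'x" where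
  "act e p = (if \<exists>q. moves e p q then SOME q. moves e p q else p)"

definition pts :: "'x set" where "pts = (\<Union>j\<in>J. ch j ` lists (al j))"

lemma moves_unique: "moves e p q \<Longrightarrow> moves e p q' \<Longrightarrow> q = q'"
  unfolding moves_def using cons by metis

lemma moves_act: "moves e p q \<Longrightarrow> act e p = q"
  unfolding act_def using moves_unique by (auto intro: someI2)

lemma act_ch: "j \<in> J \<Longrightarrow> u \<in> lists (al j) \<Longrightarrow> e \<in> al j \<Longrightarrow> act e (ch j u) = ch j (u @ [e])"
  by (rule moves_act) (auto simp: moves_def)

lemma act_cases:
  obtains "act e p = p" | j u where "j \<in> J" "u \<in> lists (al j)" "e \<in> al j" "p = ch j u" "act e p = ch j (u @ [e])"
proof (cases "\<exists>q. moves e p q")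
  case True
  then obtain q where "moves e p q" by auto
  then show ?thesis using that(2) moves_act[of e p q] by (auto simp: moves_def)
qed (use that(1) in \<open>auto simp: act_def\<close>)

lemma ch_pts: "j \<in> J \<Longrightarrow> u \<in> lists (al j) \<Longrightarrow> ch j u \<in> pts"
  by (auto simp: pts_def)

lemma card_chart:
  assumes "j \<in> J"
  shows "finite (ch j ` lists (al j)) \<and> card (ch j ` lists (al j)) \<le> nclasses (al j) (grel M (al j))"
  by (rule word_group.card_image_classes[OF grel_word_group])
    (use assms fin_al finite_grel ch_cong in auto)

lemma act_invol: "act e (act e p) = p"
proof (cases rule: act_cases[of e p])
  case (2 j u)
  interpret word_group "al j" "grel M (al j)" by (rule grel_word_group)
  have "act e (act e p) = ch j ((u @ [e]) @ [e])" using 2 act_ch[of j "u @ [e]" e] by simp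
  also have "(u @ [e, e], u @ []) \<in> grel M (al j)" by (intro congL invol) (use 2 in auto)
  then have "ch j ((u @ [e]) @ [e]) = ch j u" using ch_cong 2(1) by simp
  finally show ?thesis using 2 by simp
qed simp

lemma act_pts: "p \<in> pts \<Longrightarrow> act e p \<in> pts"
  by (cases rule: act_cases[of e p]) (auto intro!: ch_pts)

lemma eset_pts: "eset E pts act"
  unfolding eset_def using act_invol act_pts fin_J card_chart by (auto simp: pts_def)

lemma fold_ch: "j \<in> J \<Longrightarrow> u \<in> lists (al j) \<Longrightarrow> v \<in> lists (al j) \<Longrightarrow> fold act v (ch j u) = ch j (u @ v)"
proof (induction v arbitrary: u rule: list.induct)
  case (Cons e v)
  then show ?case using act_ch[of j u e] Cons.IH[of "u @ [e]"] by auto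
qed simp

text \<open>The chart is an image of the whole coset graph over \<open>al j\<close>, whose
  congruence contains \<open>grel M \<gamma>\<close>.\<close>

lemma resp_ch:
  assumes "j \<in> J" "u \<in> lists (al j)" "\<gamma> \<subseteq> al j"
  shows "resp (grel M \<gamma>) act (ch j u)"
proof -
  interpret word_group "al j" "grel M (al j)" by (rule grel_word_group)
  have "fold act v (ch j u) = fold act v' (ch j u)" if v: "(v, v') \<in> grel M \<gamma>" for v v'
  proof -
    have v': "(v, v') \<in> grel M (al j)" using grel_mono[OF fin_al[OF assms(1)] assms(3)] v by auto
    then have "ch j (u @ v) = ch j (u @ v')" using assms by (intro ch_cong congL)
    then show ?thesis using fold_ch[OF assms(1,2)] dom[OF v'] by simp
  qed
  then show ?thesis by (auto simp: resp_def)
qed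

end

section \<open>Deletion of letters and intersections of generated subgroups\<close>

lemma (in word_group) class_eq: "u \<in> lists E \<Longrightarrow> v \<in> lists E \<Longrightarrow> R `` {u} = R `` {v} \<longleftrightarrow> (u, v) \<in> R"
  using equiv eq_equiv_class_iff by metis

lemma filter_lists: "u \<in> lists \<gamma> \<Longrightarrow> filter (\<lambda>e. e \<in> \<gamma>) u = u"
  by (simp add: in_lists_conv_set)

lemma filter_lists_Int: "u \<in> lists \<beta> \<Longrightarrow> filter (\<lambda>e. e \<in> \<alpha>) u \<in> lists (\<alpha> \<inter> \<beta>)"
  by (auto simp: in_lists_conv_set)

text \<open>Let \<open>E\<close> act on the coset graph of \<open>\<gamma>\<close> with the other
  letters fixing every point, and read off the action at the unit. This graph is a legitimate test
  set: an orbit under \<open>\<delta>\<close> not inside \<open>\<gamma>\<close> moves only by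
  \<open>\<delta> \<inter> \<gamma>\<close>, so it is as small as a coset over a proper subset of
  \<open>\<delta>\<close>. Hence deletion of letters is a homomorphism, a retraction onto the group
  of \<open>\<gamma>\<close>.\<close>

lemma rel1_filter:
  assumes E: "finite E" and M: "0 < M" and g: "\<gamma> \<subset> E" and uv: "(u, v) \<in> rel1 M (grel M) E"
  shows "(filter (\<lambda>e. e \<in> \<gamma>) u, filter (\<lambda>e. e \<in> \<gamma>) v) \<in> grel M \<gamma>"
proof -
  interpret W: word_group \<gamma> "grel M \<gamma>" by (rule grel_word_group)
  have f\<gamma>: "finite \<gamma>" using g E finite_subset by blast
  define cl where "cl = (\<lambda>_::unit. \<lambda>u. grel M \<gamma> `` {u})"
  interpret A: coset_atlas M "{()}" "\<lambda>_. \<gamma>" cl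
  proof
    show c: "cl j u = cl j v" if "(u, v) \<in> grel M \<gamma>" for j u v
      using that W.class_eq W.dom[OF that] by (simp add: cl_def)
    show "cl j (u @ [e]) = cl k (v @ [e])"
      if "u \<in> lists \<gamma>" "v \<in> lists \<gamma>" "cl j u = cl k v" "e \<in> \<gamma>" for j k u v e
    proof -
      have "(u, v) \<in> grel M \<gamma>" using that(1-3) W.class_eq by (simp add: cl_def)
      then have "(u @ [e], v @ [e]) \<in> grel M \<gamma>" using that(4) by (intro W.congR) auto
      then show ?thesis using c[of _ _ j] by (simp add: cl_def)
    qed
  qed (use f\<gamma> in auto)
  have fc: "fold A.act w (cl () x) = cl () (x @ filter (\<lambda>e. e \<in> \<gamma>) w)" if "x \<in> lists \<gamma>" for w x
    using that
  proof (induction w arbitrary: x rule: list.induct)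
    case (Cons e w)
    show ?case
    proof (cases "e \<in> \<gamma>")
      case True
      then show ?thesis using Cons.IH[of "x @ [e]"] Cons.prems A.act_ch[of "()" x e] by auto
    next
      case False
      then have "A.act e p = p" for p by (cases rule: A.act_cases[of e p]) auto
      then show ?thesis using Cons False by simp
    qed
  qed simp
  have p: "A.pts = cl () ` lists \<gamma>" by (simp add: A.pts_def)
  have cp: "card A.pts \<le> size1 M (grel M) E"
  proof -
    have "card A.pts \<le> nclasses \<gamma> (grel M \<gamma>)" using A.card_chart[of "()"] p by simp
    also have "\<dots> \<le> 1 * (\<Sum>\<gamma>\<in>{\<gamma>. \<gamma> \<subset> E}. nclasses \<gamma> (grel M \<gamma>))" using nclasses_le_sum[OF E g] by simp
    also have "\<dots> \<le> size1 M (grel M) E" using M by (intro size1_ge_sum) auto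
    finally show ?thesis .
  qed
  have orb: "(\<exists>y\<in>orbit \<delta> A.act x. resp (grel M \<delta>) A.act y) \<or> card (orbit \<delta> A.act x) \<le> size1 M (grel M) \<delta>"
    if d: "\<delta> \<subset> E" "x \<in> A.pts" for \<delta> x
  proof (cases "\<delta> \<subseteq> \<gamma>")
    case True
    obtain w where "w \<in> lists \<gamma>" "x = cl () w" using d p by auto
    then have "resp (grel M \<delta>) A.act x" using A.resp_ch[of "()" w \<delta>] True by simp
    then show ?thesis using orbit_refl[of x] by metis
  next
    case False
    have f\<delta>: "finite \<delta>" using d E finite_subset by blast
    obtain w where w: "w \<in> lists \<gamma>" "x = cl () w" using d p by auto
    have "orbit \<delta> A.act x \<subseteq> (\<lambda>c. cl () (w @ c)) ` lists (\<delta> \<inter> \<gamma>)"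
    proof
      fix y assume "y \<in> orbit \<delta> A.act x"
      then obtain v where v: "v \<in> lists \<delta>" "y = fold A.act v x" unfolding orbit_def by blast
      have "y = cl () (w @ filter (\<lambda>e. e \<in> \<gamma>) v)" using v(2) w fc by simp
      then show "y \<in> (\<lambda>c. cl () (w @ c)) ` lists (\<delta> \<inter> \<gamma>)"
        using filter_lists_Int[OF v(1), of \<gamma>] unfolding Int_commute[of \<delta>] by (rule image_eqI)
    qed
    moreover have "finite ((\<lambda>c. cl () (w @ c)) ` lists (\<delta> \<inter> \<gamma>)) \<and>
        card ((\<lambda>c. cl () (w @ c)) ` lists (\<delta> \<inter> \<gamma>)) \<le> nclasses (\<delta> \<inter> \<gamma>) (grel M (\<delta> \<inter> \<gamma>))"
    proof (rule word_group.card_image_classes[OF grel_word_group])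
      show "finite (lists (\<delta> \<inter> \<gamma>) // grel M (\<delta> \<inter> \<gamma>))" using f\<gamma> by (intro finite_grel) auto
      fix a b assume "(a, b) \<in> grel M (\<delta> \<inter> \<gamma>)"
      then have "(a, b) \<in> grel M \<gamma>" using grel_mono[OF f\<gamma>, of "\<delta> \<inter> \<gamma>"] by auto
      then show "cl () (w @ a) = cl () (w @ b)" using w by (intro A.ch_cong W.congL) auto
    qed
    ultimately have "card (orbit \<delta> A.act x) \<le> nclasses (\<delta> \<inter> \<gamma>) (grel M (\<delta> \<inter> \<gamma>))"
      by (meson card_mono le_trans)
    also have "\<dots> \<le> 1 * (\<Sum>\<gamma>\<in>{\<gamma>. \<gamma> \<subset> \<delta>}. nclasses \<gamma> (grel M \<gamma>))"
      using nclasses_le_sum[OF f\<delta>, of "\<delta> \<inter> \<gamma>"] False by auto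
    also have "\<dots> \<le> size1 M (grel M) \<delta>" using M by (intro size1_ge_sum) auto
    finally show ?thesis by simp
  qed
  have "fold A.act u (cl () []) = fold A.act v (cl () [])"
    by (rule rel1_act[OF E A.eset_pts cp orb uv]) (auto intro: A.ch_pts)
  then have "cl () (filter (\<lambda>e. e \<in> \<gamma>) u) = cl () (filter (\<lambda>e. e \<in> \<gamma>) v)" by (simp add: fc)
  moreover have "filter (\<lambda>e. e \<in> \<gamma>) w \<in> lists \<gamma>" for w by auto
  ultimately show ?thesis using W.class_eq by (simp add: cl_def)
qed

context
  fixes E :: "'e set" and M :: nat
  assumes E: "finite E" and M: "0 < M"
begin

text \<open>Deletion leaves both words unchanged. So the group of \<open>\<gamma>\<close> embeds
  even into the coarser group of \<open>E\<close>.\<close>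

lemma rel1_restrict:
  assumes "\<gamma> \<subset> E" "u \<in> lists \<gamma>" "v \<in> lists \<gamma>" "(u, v) \<in> rel1 M (grel M) E"
  shows "(u, v) \<in> grel M \<gamma>"
  using rel1_filter[OF E M assms(1,4)] assms(2,3) by (simp add: filter_lists)

lemma grel_restrict:
  assumes "\<gamma> \<subseteq> E" "u \<in> lists \<gamma>" "v \<in> lists \<gamma>" "(u, v) \<in> grel M E"
  shows "(u, v) \<in> grel M \<gamma>"
  using rel1_restrict[of \<gamma> u v] assms grel_rel1[OF E, of M] by (cases "\<gamma> = E") auto

text \<open>The retraction onto \<open>\<alpha>\<close> fixes \<open>u\<close> and sends
  \<open>v\<close> to a word over \<open>\<alpha> \<inter> \<beta>\<close>, which therefore
  represents the same element.\<close>

lemma rel1_meet: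
  assumes "\<alpha> \<subseteq> E" "\<beta> \<subseteq> E" "u \<in> lists \<alpha>" "v \<in> lists \<beta>" "(u, v) \<in> rel1 M (grel M) E"
  shows "\<exists>d\<in>lists (\<alpha> \<inter> \<beta>). (u, d) \<in> rel1 M (grel M) E"
proof (cases "\<alpha> = E")
  case True
  then have "\<alpha> \<inter> \<beta> = \<beta>" using assms by auto
  then show ?thesis using assms by auto
next
  case False
  then have a: "\<alpha> \<subset> E" using assms by auto
  have "(u, filter (\<lambda>e. e \<in> \<alpha>) v) \<in> grel M \<alpha>"
    using rel1_filter[OF E M a assms(5)] assms(3) by (simp add: filter_lists)
  then show ?thesis using grel_proper_rel1[OF a, of M] filter_lists_Int[OF assms(4)] by blast
qed

lemma grel_meet:
  assumes "\<alpha> \<subseteq> E" "\<beta> \<subseteq> E" "u \<in> lists \<alpha>" "v \<in> lists \<beta>" "(u, v) \<in> grel M E"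
  shows "\<exists>d\<in>lists (\<alpha> \<inter> \<beta>). (u, d) \<in> grel M E"
proof (cases "\<alpha> = E")
  case True
  then have "\<alpha> \<inter> \<beta> = \<beta>" using assms by auto
  then show ?thesis using assms by auto
next
  case False
  then have a: "\<alpha> \<subset> E" using assms by auto
  have "(u, v) \<in> rel1 M (grel M) E" using grel_rel1[OF E, of M] assms(5) by auto
  then have "(u, filter (\<lambda>e. e \<in> \<alpha>) v) \<in> grel M \<alpha>"
    using rel1_filter[OF E M a, of u v] filter_lists[OF assms(3)] by simp
  then show ?thesis using grel_mono[OF E assms(1), of M] filter_lists_Int[OF assms(4)] by blast
qed

end

section \<open>Chains of cosets\<close>

text \<open>Being deterministic in both directions, the relation has paths as components; they climb
  one level per edge, so each level is met at most once.\<close>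

lemma zigzag:
  assumes sv: "\<And>a b c. (a, b) \<in> N \<Longrightarrow> (a, c) \<in> N \<Longrightarrow> b = c"
    and inj: "\<And>a b c. (a, c) \<in> N \<Longrightarrow> (b, c) \<in> N \<Longrightarrow> a = b"
    and lev: "\<And>a b. (a, b) \<in> N \<Longrightarrow> lev b = Suc (lev a)"
    and xy: "(x, y) \<in> (N \<union> N\<inverse>)\<^sup>*" "lev x = lev y"
  shows "x = y"
proof -
  have l: "lev a \<le> lev b \<and> (lev a = lev b \<longrightarrow> a = b)" if "(a, b) \<in> N\<^sup>*" for a b
    using that
  proof (induction rule: rtrancl_induct)
    case (step y z)
    then show ?case using lev[OF step(2)] by simp
  qed simp
  have "(x, y) \<in> N\<^sup>* \<or> (y, x) \<in> N\<^sup>*"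
    using xy(1)
  proof (induction rule: rtrancl_induct)
    case (step y z)
    consider "(y, z) \<in> N" | "(z, y) \<in> N" using step(2) by auto
    then show ?case
    proof cases
      case 1
      show ?thesis
      proof (cases "(x, y) \<in> N\<^sup>*")
        case False
        then have "(y, x) \<in> N\<^sup>*" using step(3) by auto
        then show ?thesis using 1 sv by (cases rule: converse_rtranclE) auto
      qed (use 1 in auto)
    next
      case 2
      show ?thesis
      proof (cases "(y, x) \<in> N\<^sup>*")
        case True
        then show ?thesis using 2 by (auto intro: converse_rtrancl_into_rtrancl)
      next
        case False
        then have "(x, y) \<in> N\<^sup>*" using step(3) by auto
        then show ?thesis using 2 inj by (cases rule: rtranclE) auto
      qed
    qed
  qed simp
  then show ?thesis using l xy(2) by fastforce
qed

text \<open>The amalgam of a chain of cosets, consecutive ones being glued along a coset of the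
  intersection of their letter sets. Points of the overlap are represented in the earlier coset.\<close>

locale coset_chain =
  fixes M :: nat and E :: "'e set" and n :: nat and al :: "nat \<Rightarrow> 'e set" and w :: "nat \<Rightarrow> 'e list"
  assumes fin_E: "finite E" and n_M: "0 < n" "n \<le> M"
    and al: "i < n \<Longrightarrow> al i \<subset> E" and w: "i < n \<Longrightarrow> w i \<in> lists (al i)"
    and nondeg: "0 < i \<Longrightarrow> Suc i < n \<Longrightarrow> a \<in> lists (al (i - 1) \<inter> al i) \<Longrightarrow>
      b \<in> lists (al i \<inter> al (Suc i)) \<Longrightarrow> (w i, a @ b) \<notin> grel M (al i)"
begin

abbreviation g :: "nat \<Rightarrow> ('e list \<times> 'e list) set" where "g i \<equiv> grel M (al i)"

abbreviation ov :: "nat \<Rightarrow> 'e set" where "ov i \<equiv> al i \<inter> al (Suc i)"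

text \<open>The unit of coset \<open>Suc i\<close> is glued to \<open>w i\<close>. So a point
  \<open>u\<close> of coset \<open>Suc i\<close> that equals the overlap word \<open>d\<close> also
  has the name \<open>w i @ d\<close> in coset \<open>i\<close>.\<close>

definition left :: "nat \<Rightarrow> 'e list \<Rightarrow> 'e list \<Rightarrow> bool" where
  "left i u d \<longleftrightarrow> d \<in> lists (ov i) \<and> (u, d) \<in> g (Suc i)"

primrec ch :: "nat \<Rightarrow> 'e list \<Rightarrow> nat \<times> 'e list set" where
  "ch 0 u = (0, g 0 `` {u})"
| "ch (Suc i) u = (if \<exists>d. left i u d then ch i (w i @ (SOME d. left i u d)) else (Suc i, g (Suc i) `` {u}))"

lemma M_pos: "0 < M" using n_M by auto

lemma fin_al: "i < n \<Longrightarrow> finite (al i)"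
  using al fin_E finite_subset by blast

lemma wg: "word_group (al i) (g i)" by (rule grel_word_group)

lemma ch_cong: "(u, v) \<in> g i \<Longrightarrow> ch i u = ch i v"
proof (cases i)
  case 0
  assume "(u, v) \<in> g i"
  then show ?thesis using 0 word_group.class_eq[OF wg[of i]] word_group.dom[OF wg[of i]] by simp
next
  case (Suc k)
  assume uv: "(u, v) \<in> g i"
  interpret word_group "al i" "g i" by (rule wg)
  have "left k u d \<longleftrightarrow> left k v d" for d
    using uv Suc trans[OF uv, of d] trans[OF sym[OF uv], of d] by (auto simp: left_def)
  then have "left k u = left k v" by blast
  moreover have "g i `` {u} = g i `` {v}" using class_eq[of u v] dom[OF uv] uv by simp
  ultimately show ?thesis using Suc by simp
qed

text \<open>Both groups induce the group of the overlap on its words. So it does not matter in which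
  of the two cosets the gluing is evaluated.\<close>

lemma ov_transfer:
  assumes "Suc i < n" "d \<in> lists (ov i)" "d' \<in> lists (ov i)"
  shows "(d, d') \<in> g (Suc i) \<longleftrightarrow> (d, d') \<in> g i"
proof -
  have "(d, d') \<in> g (Suc i) \<longleftrightarrow> (d, d') \<in> grel M (ov i)"
    using grel_restrict[OF fin_al M_pos, of "Suc i" "ov i"] grel_mono[OF fin_al, of "Suc i" "ov i"] assms by blast
  also have "\<dots> \<longleftrightarrow> (d, d') \<in> g i"
    using grel_restrict[OF fin_al M_pos, of i "ov i"] grel_mono[OF fin_al, of i "ov i"] assms Suc_lessD by blast
  finally show ?thesis .
qed

lemma w_ov: "i < n \<Longrightarrow> d \<in> lists (ov i) \<Longrightarrow> w i @ d \<in> lists (al i)"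
  using w[of i] by (auto simp: in_lists_conv_set)

lemma ch_left:
  assumes "Suc i < n" "left i u d" shows "ch (Suc i) u = ch i (w i @ d)"
proof -
  interpret S: word_group "al (Suc i)" "g (Suc i)" by (rule wg)
  interpret I: word_group "al i" "g i" by (rule wg)
  define d' where "d' = (SOME d. left i u d)"
  have d': "left i u d'" unfolding d'_def by (rule someI[of _ d]) (rule assms)
  have "(d', d) \<in> g (Suc i)" using d' assms(2) S.sym S.trans unfolding left_def by blast
  then have "(d', d) \<in> g i" using ov_transfer[OF assms(1)] d' assms(2) by (auto simp: left_def)
  then have "ch i (w i @ d') = ch i (w i @ d)" using w[of i] assms(1) by (intro ch_cong I.congL) auto
  then show ?thesis using assms(2) d'_def by auto
qed

text \<open>A point in both overlaps of coset \<open>i\<close> would split \<open>w i\<close> into a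
  piece over the left overlap and a piece over the right one, which \<open>nondeg\<close>
  forbids.\<close>

lemma not_left: "0 < i \<Longrightarrow> Suc i < n \<Longrightarrow> d \<in> lists (ov i) \<Longrightarrow> (u, w i @ d) \<in> g i \<Longrightarrow> \<not> left (i - 1) u d0"
proof
  assume a: "0 < i" "Suc i < n" "d \<in> lists (ov i)" "(u, w i @ d) \<in> g i" "left (i - 1) u d0"
  interpret I: word_group "al i" "g i" by (rule wg)
  have i: "Suc (i - 1) = i" using a by simp
  have d: "d \<in> lists (al i)" "w i \<in> lists (al i)" "rev d \<in> lists (ov i)"
    using a w[of i] by (auto simp: in_lists_conv_set)
  have "(w i @ d, d0) \<in> g i" using a(4,5) I.sym I.trans i unfolding left_def by metis
  then have "(w i, d0 @ rev d) \<in> g i" using I.moveR d by simp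
  then show False using nondeg[OF a(1,2) _ d(3), of d0] a(5) i unfolding left_def by simp
qed

text \<open>The recursion of \<open>ch\<close> descends at most once, since the left and the right
  overlap of a coset are disjoint. This is what keeps points of non-consecutive cosets apart in
  \<open>ch_eq\<close>.\<close>

lemma ch_home:
  assumes "i < n" "u \<in> lists (al i)"
  shows "(ch i u = (i, g i `` {u}) \<and> (\<forall>d. 0 < i \<longrightarrow> \<not> left (i - 1) u d)) \<or>
    (\<exists>d. 0 < i \<and> left (i - 1) u d \<and> ch i u = (i - 1, g (i - 1) `` {w (i - 1) @ d}))"
proof (cases i)
  case (Suc k)
  show ?thesis
  proof (cases "\<exists>d. left k u d")
    case True
    then obtain d where d: "left k u d" by auto
    have k: "Suc k < n" "k < n" using assms Suc by auto
    have d': "d \<in> lists (ov k)" using d by (simp add: left_def)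
    have wd: "w k @ d \<in> lists (al k)" using w_ov[OF k(2) d'] .
    have "ch k (w k @ d) = (k, g k `` {w k @ d})"
    proof (cases k)
      case (Suc l)
      have "\<not> left (k - 1) (w k @ d) d0" for d0
        using not_left[of k d "w k @ d" d0] Suc k d' word_group.refl[OF wg wd] by auto
      then show ?thesis using Suc by simp
    qed simp
    then show ?thesis using ch_left[OF k(1) d] d Suc by auto
  qed (use Suc in auto)
qed simp

declare ch.simps(2) [simp del]

lemma ch_eq:
  assumes ij: "i \<le> j" "j < n" and u: "u \<in> lists (al i)" and v: "v \<in> lists (al j)" and eq: "ch i u = ch j v"
  shows "(i = j \<and> (u, v) \<in> g i) \<or> (j = Suc i \<and> (\<exists>d. left i v d \<and> (u, w i @ d) \<in> g i))"
proof -
  have in': "i < n" using ij by simp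
  interpret I: word_group "al i" "g i" by (rule wg)
  note hi = ch_home[OF in' u] and hj = ch_home[OF ij(2) v]
  consider "i = j" "ch i u = (i, g i `` {u})" "ch j v = (i, g i `` {v})"
    | d d' where "i = j" "0 < i" "left (i - 1) u d" "left (i - 1) v d'"
        "g (i - 1) `` {w (i - 1) @ d} = g (i - 1) `` {w (i - 1) @ d'}"
    | d where "j = Suc i" "left i v d" "g i `` {u} = g i `` {w i @ d}"
  proof (cases "ch i u = (i, g i `` {u}) \<and> (\<forall>d. 0 < i \<longrightarrow> \<not> left (i - 1) u d)")
    case True
    note T = this
    show ?thesis
    proof (cases "ch j v = (j, g j `` {v}) \<and> (\<forall>d. 0 < j \<longrightarrow> \<not> left (j - 1) v d)")
      case True
      then have "i = j" using T eq by simp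
      then show ?thesis using that(1) T True by simp
    next
      case False
      then obtain d where d: "0 < j" "left (j - 1) v d" "ch j v = (j - 1, g (j - 1) `` {w (j - 1) @ d})"
        using hj by metis
      then have "j - 1 = i" using T eq by simp
      then have ji: "j = Suc i" using d(1) by linarith
      then have "ch j v = (i, g i `` {w i @ d})" using d(3) by simp
      moreover have "ch j v = (i, g i `` {u})" using T eq by simp
      ultimately have "g i `` {u} = g i `` {w i @ d}" by simp
      then show ?thesis using that(3)[of d] d(2) ji by simp
    qed
  next
    case False
    then obtain d where d: "0 < i" "left (i - 1) u d" "ch i u = (i - 1, g (i - 1) `` {w (i - 1) @ d})"
      using hi by metis
    have "fst (ch j v) = i - 1" using d(3) eq by simp
    then have "\<not> ch j v = (j, g j `` {v})" using d(1) ij(1) by auto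
    then obtain d' where d': "0 < j" "left (j - 1) v d'" "ch j v = (j - 1, g (j - 1) `` {w (j - 1) @ d'})"
      using hj by metis
    have "i - 1 = j - 1" using d(3) d'(3) eq by simp
    then have "i = j" using d(1) d'(1) by linarith
    then show ?thesis using that(2)[of d d'] d d' eq by simp
  qed
  then show ?thesis
  proof cases
    case 1
    then show ?thesis using eq I.class_eq u v by auto
  next
    case 2
    interpret K: word_group "al (i - 1)" "g (i - 1)" by (rule wg)
    have i: "Suc (i - 1) = i" "i - 1 < n" using 2 in' by auto
    have d: "d \<in> lists (ov (i - 1))" "d' \<in> lists (ov (i - 1))" "(u, d) \<in> g i" "(v, d') \<in> g i"
      using 2 i by (auto simp: left_def)
    have dl: "d \<in> lists (al (i - 1))" "d' \<in> lists (al (i - 1))" "w (i - 1) \<in> lists (al (i - 1))"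
      using d(1,2) w[OF i(2)] by (auto simp: in_lists_conv_set)
    have "(w (i - 1) @ d, w (i - 1) @ d') \<in> g (i - 1)"
      using K.class_eq[OF w_ov[OF i(2) d(1)] w_ov[OF i(2) d(2)]] 2(5) by (rule iffD1)
    then have "(d, d') \<in> g (i - 1)" using K.cancelL dl by simp
    then have "(d, d') \<in> g i" using ov_transfer[of "i - 1" d d'] i in' d(1,2) by simp
    then have "(u, d') \<in> g i" by (rule I.trans[OF d(3)])
    then have "(u, v) \<in> g i" by (rule I.trans[OF _ I.sym[OF d(4)]])
    then show ?thesis using 2(1) by simp
  next
    case 3
    have "d \<in> lists (ov i)" using 3 by (simp add: left_def)
    then have "(u, w i @ d) \<in> g i" using 3(3) I.class_eq[OF u w_ov[OF in']] by simp
    then show ?thesis using 3 by blast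
  qed
qed

lemma ch_step:
  assumes "i < n" "j < n" "u \<in> lists (al i)" "v \<in> lists (al j)" "ch i u = ch j v" "e \<in> al i" "e \<in> al j"
  shows "ch i (u @ [e]) = ch j (v @ [e])"
proof -
  have main: "ch i (u @ [e]) = ch j (v @ [e])"
    if ij: "i \<le> j" "i < n" "j < n" and u: "u \<in> lists (al i)" "v \<in> lists (al j)"
      and eq: "ch i u = ch j v" and e: "e \<in> al i" "e \<in> al j" for i j u v
    using ch_eq[OF ij(1,3) u eq]
  proof (elim disjE conjE exE)
    assume "i = j" "(u, v) \<in> g i"
    then show ?thesis using word_group.congR[OF wg, of u v i "[e]"] e by (auto intro: ch_cong)
  next
    fix d assume d: "j = Suc i" "left i v d" "(u, w i @ d) \<in> g i"
    have "(u @ [e], (w i @ d) @ [e]) \<in> g i" using d e by (intro word_group.congR[OF wg]) auto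
    then have "ch i (u @ [e]) = ch i (w i @ d @ [e])" by (simp add: ch_cong)
    moreover have "left i (v @ [e]) (d @ [e])"
      using d(1,2) e word_group.congR[OF wg, of v d "Suc i" "[e]"] unfolding left_def by auto
    ultimately show ?thesis using ch_left[of i "v @ [e]" "d @ [e]"] ij d(1) by simp
  qed
  show ?thesis
  proof (cases "i \<le> j")
    case True then show ?thesis using main[of i j u v] assms by simp
  next
    case False then show ?thesis using main[of j i v u] assms by simp
  qed
qed

sublocale A: coset_atlas M "{..<n}" al ch
proof
  show "finite {..<n}" by simp
  show "finite (al j)" if "j \<in> {..<n}" for j using that fin_al by simp
  show "ch j u = ch j v" if "(u, v) \<in> g j" for j u v using that by (rule ch_cong)
  show "ch j (u @ [e]) = ch k (v @ [e])"
    if "j \<in> {..<n}" "k \<in> {..<n}" "u \<in> lists (al j)" "v \<in> lists (al k)" "ch j u = ch k v" "e \<in> al j" "e \<in> al k"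
    for j k u v e using ch_step[of j k u v e] that by simp
qed

lemma card_pts: "card A.pts \<le> size1 M (grel M) E"
proof -
  have "card A.pts \<le> (\<Sum>j\<in>{..<n}. card (ch j ` lists (al j)))"
    unfolding A.pts_def by (rule card_UN_le) simp
  also have "\<dots> \<le> (\<Sum>j\<in>{..<n}. \<Sum>\<gamma>\<in>{\<gamma>. \<gamma> \<subset> E}. nclasses \<gamma> (grel M \<gamma>))"
  proof (rule sum_mono)
    fix j assume "j \<in> {..<n}"
    then show "card (ch j ` lists (al j)) \<le> (\<Sum>\<gamma>\<in>{\<gamma>. \<gamma> \<subset> E}. nclasses \<gamma> (grel M \<gamma>))"
      using A.card_chart[of j] nclasses_le_sum[OF fin_E al, of j "grel M"] by simp
  qed
  also have "\<dots> = n * (\<Sum>\<gamma>\<in>{\<gamma>. \<gamma> \<subset> E}. nclasses \<gamma> (grel M \<gamma>))" by simp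
  also have "\<dots> \<le> size1 M (grel M) E" using n_M by (intro size1_ge_sum)
  finally show ?thesis .
qed

text \<open>The piece of a \<open>\<gamma>\<close>-orbit inside chart \<open>j\<close> through
  \<open>u\<close>, as a set of points. The tag \<open>j\<close> is the level for
  \<open>zigzag\<close>.\<close>

definition key :: "'e set \<Rightarrow> nat \<Rightarrow> 'e list \<Rightarrow> nat \<times> (nat \<times> 'e list set) set" where
  "key \<gamma> j u = (j, (\<lambda>c. ch j (u @ c)) ` lists (\<gamma> \<inter> al j))"

definition link :: "'e set \<Rightarrow> ((nat \<times> (nat \<times> 'e list set) set) \<times> (nat \<times> (nat \<times> 'e list set) set)) set" where
  "link \<gamma> = {(key \<gamma> j u, key \<gamma> (Suc j) v) |j u v. Suc j < n \<and> u \<in> lists (al j) \<and> v \<in> lists (al (Suc j)) \<and>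
     ch j u = ch (Suc j) v}"

lemma key_eq:
  assumes "j < n" "u \<in> lists (al j)" "c \<in> lists (\<gamma> \<inter> al j)" "(v, u @ c) \<in> g j"
  shows "key \<gamma> j v = key \<gamma> j u"
proof -
  interpret word_group "al j" "g j" by (rule wg)
  have c: "c \<in> lists (al j)" using assms(3) by auto
  have ch_v: "ch j (v @ d) = ch j (u @ c @ d)" if "d \<in> lists (\<gamma> \<inter> al j)" for d
  proof -
    have "(v @ d, (u @ c) @ d) \<in> g j" using assms(4) that by (intro congR) auto
    then show ?thesis using ch_cong by simp
  qed
  have ch_u: "ch j (u @ d) = ch j (v @ rev c @ d)" if "d \<in> lists (\<gamma> \<inter> al j)" for d
  proof -
    have "(u, v @ rev c) \<in> g j" using assms(2,4) c moveR sym trans by blast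
    then have "(u @ d, (v @ rev c) @ d) \<in> g j" using that by (intro congR) auto
    then show ?thesis using ch_cong by simp
  qed
  have "(\<lambda>d. ch j (v @ d)) ` lists (\<gamma> \<inter> al j) = (\<lambda>d. ch j (u @ d)) ` lists (\<gamma> \<inter> al j)"
  proof (intro subset_antisym image_subsetI)
    fix d assume d: "d \<in> lists (\<gamma> \<inter> al j)"
    show "ch j (v @ d) \<in> (\<lambda>d. ch j (u @ d)) ` lists (\<gamma> \<inter> al j)"
      by (rule image_eqI[where x = "c @ d"]) (use ch_v[OF d] d assms(3) in auto)
    show "ch j (u @ d) \<in> (\<lambda>d. ch j (v @ d)) ` lists (\<gamma> \<inter> al j)"
      by (rule image_eqI[where x = "rev c @ d"]) (use ch_u[OF d] d assms(3) in \<open>auto simp: in_lists_conv_set\<close>)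
  qed
  then show ?thesis by (simp add: key_def)
qed

lemma key_eqD:
  assumes "j < n" "u \<in> lists (al j)" "v \<in> lists (al j)" "key \<gamma> j v = key \<gamma> j u"
  obtains c where "c \<in> lists (\<gamma> \<inter> al j)" "(v, u @ c) \<in> g j"
proof -
  have "ch j (v @ []) \<in> snd (key \<gamma> j v)"
    unfolding key_def snd_conv by (rule image_eqI[where x = "[]"]) auto
  then have "ch j v \<in> snd (key \<gamma> j u)" using assms(4) by simp
  then obtain c where c: "c \<in> lists (\<gamma> \<inter> al j)" "ch j v = ch j (u @ c)" by (auto simp: key_def)
  then have "(v, u @ c) \<in> g j" using ch_eq[of j j v "u @ c"] assms(1-3) by auto
  then show ?thesis using c that by blast
qed

text \<open>By the intersection property, overlap points that differ by letters of
  \<open>\<gamma>\<close> in one coset differ by letters of \<open>\<gamma>\<close> inside the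
  overlap; such a word is then valid in both cosets.\<close>

lemma ov_meet:
  assumes "Suc j < n" "i = j \<or> i = Suc j" "d \<in> lists (ov j)" "d' \<in> lists (ov j)" "c \<in> lists (\<gamma> \<inter> al i)"
    "(d', d @ c) \<in> g i"
  shows "\<exists>x\<in>lists (\<gamma> \<inter> ov j). (d', d @ x) \<in> g j \<and> (d', d @ x) \<in> g (Suc j)"
proof -
  interpret word_group "al i" "g i" by (rule wg)
  have i: "i < n" "ov j \<subseteq> al i" using assms by auto
  have dl: "d \<in> lists (al i)" "c \<in> lists (al i)" using assms(3,5) i lists_mono by blast+
  have "(rev d @ d', c) \<in> g i"
    using assms(6) dl moveL[of d c d'] sym by blast
  moreover have "rev d @ d' \<in> lists (ov j)" using assms(3,4) by simp
  ultimately obtain x where x: "x \<in> lists (ov j \<inter> (\<gamma> \<inter> al i))" "(rev d @ d', x) \<in> g i"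
    using grel_meet[OF fin_al[OF i(1)] M_pos i(2), of "\<gamma> \<inter> al i" "rev d @ d'" c] assms(5) by blast
  have xo: "x \<in> lists (ov j)" "x \<in> lists (\<gamma> \<inter> ov j)" "x \<in> lists (al i)" using x(1) by (auto simp: in_lists_conv_set)
  have "(x, rev d @ d') \<in> g i" using x(2) by (rule sym)
  then have "(d', d @ x) \<in> g i" using moveL[of d x d'] dl(1) xo(3) sym by blast
  moreover have "d @ x \<in> lists (ov j)" using assms(3) xo(1) by simp
  ultimately show ?thesis using ov_transfer[OF assms(1) assms(4), of "d @ x"] assms(2) xo(2) by blast
qed

lemma link_single:
  assumes "Suc j < n" "u \<in> lists (al j)" "v \<in> lists (al (Suc j))" "ch j u = ch (Suc j) v"
    and "u' \<in> lists (al j)" "v' \<in> lists (al (Suc j))" "ch j u' = ch (Suc j) v'"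
  shows "key \<gamma> j u = key \<gamma> j u' \<longleftrightarrow> key \<gamma> (Suc j) v = key \<gamma> (Suc j) v'"
proof -
  have jn: "j < n" using assms(1) by simp
  interpret I: word_group "al j" "g j" by (rule wg)
  interpret S: word_group "al (Suc j)" "g (Suc j)" by (rule wg)
  obtain d where d: "left j v d" "(u, w j @ d) \<in> g j" using ch_eq[of j "Suc j" u v] assms by auto
  obtain d' where d': "left j v' d'" "(u', w j @ d') \<in> g j" using ch_eq[of j "Suc j" u' v'] assms by auto
  have dl: "d \<in> lists (ov j)" "d' \<in> lists (ov j)" "(v, d) \<in> g (Suc j)" "(v', d') \<in> g (Suc j)"
    using d(1) d'(1) by (auto simp: left_def)
  have wl: "w j \<in> lists (al j)" "d \<in> lists (al j)" "d' \<in> lists (al j)" using w[OF jn] dl by auto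
  show ?thesis
  proof
    assume "key \<gamma> j u = key \<gamma> j u'"
    then obtain c where c: "c \<in> lists (\<gamma> \<inter> al j)" "(u', u @ c) \<in> g j"
      using key_eqD[OF jn assms(2,5)] by metis
    have cl: "c \<in> lists (al j)" using c(1) by auto
    have "(w j @ d', w j @ (d @ c)) \<in> g j"
      using I.trans[OF I.sym[OF d'(2)] I.trans[OF c(2) I.congR[OF d(2) cl]]] by simp
    then have "(d', d @ c) \<in> g j" using I.cancelL[OF wl(1,3), of "d @ c"] wl(2) cl by simp
    then obtain x where x: "x \<in> lists (\<gamma> \<inter> ov j)" "(d', d @ x) \<in> g (Suc j)"
      using ov_meet[OF assms(1) _ dl(1,2) c(1)] by blast
    have xl: "x \<in> lists (\<gamma> \<inter> al (Suc j))" "x \<in> lists (al (Suc j))" using x(1) by (auto simp: in_lists_conv_set)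
    have "(v', v @ x) \<in> g (Suc j)"
      using S.trans[OF dl(4) S.trans[OF x(2) S.congR[OF S.sym[OF dl(3)] xl(2)]]] .
    then show "key \<gamma> (Suc j) v = key \<gamma> (Suc j) v'" using key_eq[OF assms(1,3) xl(1)] by simp
  next
    assume "key \<gamma> (Suc j) v = key \<gamma> (Suc j) v'"
    then obtain c where c: "c \<in> lists (\<gamma> \<inter> al (Suc j))" "(v', v @ c) \<in> g (Suc j)"
      using key_eqD[OF assms(1,3,6)] by metis
    have cl: "c \<in> lists (al (Suc j))" using c(1) by auto
    have "(d', d @ c) \<in> g (Suc j)"
      using S.trans[OF S.sym[OF dl(4)] S.trans[OF c(2) S.congR[OF dl(3) cl]]] by simp
    then obtain x where x: "x \<in> lists (\<gamma> \<inter> ov j)" "(d', d @ x) \<in> g j"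
      using ov_meet[OF assms(1) _ dl(1,2) c(1)] by blast
    have xl: "x \<in> lists (\<gamma> \<inter> al j)" "x \<in> lists (al j)" using x(1) by (auto simp: in_lists_conv_set)
    have "(w j @ d', w j @ (d @ x)) \<in> g j" using I.congL[OF x(2) wl(1)] .
    then have "(u', (w j @ d) @ x) \<in> g j" using I.trans[OF d'(2)] by simp
    then have "(u', u @ x) \<in> g j" using I.trans[OF _ I.congR[OF I.sym[OF d(2)] xl(2)]] by blast
    then show "key \<gamma> j u = key \<gamma> j u'" using key_eq[OF jn assms(2) xl(1)] by simp
  qed
qed

text \<open>By \<open>link_single\<close> a piece has at most one neighbour on either side, so
  \<open>zigzag\<close> applies. Consequently an orbit traverses each chart in a single
  piece.\<close>

lemma link_level:
  assumes "(x, y) \<in> (link \<gamma> \<union> (link \<gamma>)\<inverse>)\<^sup>*" "fst x = fst y" shows "x = y"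
proof (rule zigzag[OF _ _ _ assms])
  show "fst b = Suc (fst a)" if "(a, b) \<in> link \<gamma>" for a b
    using that by (auto simp: link_def key_def)
next
  fix a b c assume "(a, b) \<in> link \<gamma>" "(a, c) \<in> link \<gamma>"
  then obtain j u v j' u' v' where 1: "a = key \<gamma> j u" "b = key \<gamma> (Suc j) v" "Suc j < n" "u \<in> lists (al j)"
      "v \<in> lists (al (Suc j))" "ch j u = ch (Suc j) v"
    and 2: "a = key \<gamma> j' u'" "c = key \<gamma> (Suc j') v'" "Suc j' < n" "u' \<in> lists (al j')"
      "v' \<in> lists (al (Suc j'))" "ch j' u' = ch (Suc j') v'" unfolding link_def by blast
  have j: "j' = j" using 1(1) 2(1) by (simp add: key_def)
  show "b = c" using link_single[OF 1(3-6), of u' v' \<gamma>] 1(1,2) 2 unfolding j by simp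
next
  fix a b c assume "(a, c) \<in> link \<gamma>" "(b, c) \<in> link \<gamma>"
  then obtain j u v j' u' v' where 1: "a = key \<gamma> j u" "c = key \<gamma> (Suc j) v" "Suc j < n" "u \<in> lists (al j)"
      "v \<in> lists (al (Suc j))" "ch j u = ch (Suc j) v"
    and 2: "b = key \<gamma> j' u'" "c = key \<gamma> (Suc j') v'" "Suc j' < n" "u' \<in> lists (al j')"
      "v' \<in> lists (al (Suc j'))" "ch j' u' = ch (Suc j') v'" unfolding link_def by blast
  have j: "j' = j" using 1(2) 2(2) by (simp add: key_def)
  show "a = b" using link_single[OF 1(3-6), of u' v' \<gamma>] 1(1,2) 2 unfolding j by simp
qed

lemma same_point_linked:
  assumes "i < n" "j < n" "u \<in> lists (al i)" "v \<in> lists (al j)" "ch i u = ch j v"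
  shows "(key \<gamma> i u, key \<gamma> j v) \<in> (link \<gamma> \<union> (link \<gamma>)\<inverse>)\<^sup>*"
proof -
  have main: "key \<gamma> i u = key \<gamma> j v \<or> (key \<gamma> i u, key \<gamma> j v) \<in> link \<gamma>"
    if ij: "i \<le> j" "i < n" "j < n" and u: "u \<in> lists (al i)" "v \<in> lists (al j)"
      and eq: "ch i u = ch j v" for i j u v
    using ch_eq[OF ij(1,3) u eq]
  proof (elim disjE conjE exE)
    assume h: "i = j" "(u, v) \<in> g i"
    then show ?thesis using key_eq[of i v "[]" \<gamma> u] ij u by auto
  next
    fix d assume j: "j = Suc i"
    then have "(key \<gamma> i u, key \<gamma> j v) \<in> link \<gamma>"
      unfolding link_def using ij(3) u eq by (intro CollectI exI[of _ i] exI[of _ u] exI[of _ v]) simp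
    then show ?thesis ..
  qed
  consider "i \<le> j" | "j \<le> i" by linarith
  then show ?thesis
  proof cases
    case 1 then show ?thesis using main[of i j u v] assms by auto
  next
    case 2 then show ?thesis using main[of j i v u] assms by auto
  qed
qed

lemma orbit_linked:
  assumes "i < n" "u \<in> lists (al i)" "c \<in> lists \<gamma>"
  shows "\<exists>j v. j < n \<and> v \<in> lists (al j) \<and> fold A.act c (ch i u) = ch j v \<and>
    (key \<gamma> i u, key \<gamma> j v) \<in> (link \<gamma> \<union> (link \<gamma>)\<inverse>)\<^sup>*"
  using assms(3)
proof (induction c rule: rev_induct)
  case Nil
  show ?case by (rule exI[of _ i], rule exI[of _ u]) (use assms in simp)
next
  case (snoc e c)
  then obtain j v where jv: "j < n" "v \<in> lists (al j)" "fold A.act c (ch i u) = ch j v"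
    "(key \<gamma> i u, key \<gamma> j v) \<in> (link \<gamma> \<union> (link \<gamma>)\<inverse>)\<^sup>*" by auto
  have e: "e \<in> \<gamma>" using snoc.prems by simp
  show ?case
  proof (cases rule: A.act_cases[of e "ch j v"])
    case 1
    then show ?thesis using jv by auto
  next
    case (2 k x)
    then have kn: "k < n" by simp
    have "(key \<gamma> j v, key \<gamma> k x) \<in> (link \<gamma> \<union> (link \<gamma>)\<inverse>)\<^sup>*"
      using same_point_linked[OF jv(1) kn jv(2) 2(2,4)] .
    moreover have "key \<gamma> k (x @ [e]) = key \<gamma> k x"
      using key_eq[OF kn 2(2), of "[e]" \<gamma> "x @ [e]"] e 2(2,3) word_group.refl[OF wg] by simp
    ultimately have "(key \<gamma> i u, key \<gamma> k (x @ [e])) \<in> (link \<gamma> \<union> (link \<gamma>)\<inverse>)\<^sup>*"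
      using jv(4) by simp
    moreover have "x @ [e] \<in> lists (al k)" using 2 by simp
    moreover have "fold A.act (c @ [e]) (ch i u) = ch k (x @ [e])" using jv(3) 2(5) by simp
    ultimately show ?thesis using kn by blast
  qed
qed

text \<open>Either the orbit reaches a chart that contains all its letters, where respect is
  inherited, or it consists of at most \<open>n\<close> pieces, each a coset over a proper subset of
  \<open>\<gamma>\<close>. This count is the origin of the factor \<open>M\<close> in
  \<open>size1\<close>.\<close>

lemma orbit_large:
  assumes "\<gamma> \<subset> E" "p \<in> A.pts"
  shows "(\<exists>q\<in>orbit \<gamma> A.act p. resp (grel M \<gamma>) A.act q) \<or> card (orbit \<gamma> A.act p) \<le> size1 M (grel M) \<gamma>"
proof (cases "\<exists>j<n. \<exists>v\<in>lists (al j). ch j v \<in> orbit \<gamma> A.act p \<and> \<gamma> \<subseteq> al j")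
  case True
  then obtain j v where "j < n" "v \<in> lists (al j)" "ch j v \<in> orbit \<gamma> A.act p" "\<gamma> \<subseteq> al j" by blast
  then show ?thesis using A.resp_ch[of j v \<gamma>] by auto
next
  case False
  have f\<gamma>: "finite \<gamma>" using assms(1) fin_E finite_subset by blast
  obtain i u where iu: "i < n" "u \<in> lists (al i)" "p = ch i u" using assms(2) by (auto simp: A.pts_def)
  define S where "S = (\<Sum>\<delta>\<in>{\<delta>. \<delta> \<subset> \<gamma>}. nclasses \<delta> (grel M \<delta>))"
  define C where "C = (link \<gamma> \<union> (link \<gamma>)\<inverse>)\<^sup>*"
  define B where "B = (\<lambda>j. \<Union>{snd (key \<gamma> j v) |v. v \<in> lists (al j) \<and> (key \<gamma> i u, key \<gamma> j v) \<in> C})"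
  define Z where "Z = {j. j < n \<and> \<not> \<gamma> \<subseteq> al j}"
  have fz: "finite Z" "card Z \<le> n"
    using card_mono[of "{..<n}" Z] by (auto simp: Z_def)
  have B: "finite (B j) \<and> card (B j) \<le> S" if j: "j \<in> Z" for j
  proof (cases "\<exists>v. v \<in> lists (al j) \<and> (key \<gamma> i u, key \<gamma> j v) \<in> C")
    case True
    then obtain v where v: "v \<in> lists (al j)" "(key \<gamma> i u, key \<gamma> j v) \<in> C" by blast
    have uniq: "key \<gamma> j v' = key \<gamma> j v" if "(key \<gamma> i u, key \<gamma> j v') \<in> C" for v'
    proof -
      have "sym C" unfolding C_def by (intro sym_rtrancl) (auto simp: sym_def)
      then have "(key \<gamma> j v', key \<gamma> j v) \<in> C"
        using v(2) that unfolding C_def by (meson rtrancl_trans symD)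
      then show ?thesis using link_level[of "key \<gamma> j v'" "key \<gamma> j v" \<gamma>]
        unfolding C_def by (simp add: key_def)
    qed
    have "{snd (key \<gamma> j v) |v. v \<in> lists (al j) \<and> (key \<gamma> i u, key \<gamma> j v) \<in> C} = {snd (key \<gamma> j v)}"
    proof (intro subset_antisym subsetI)
      fix x assume "x \<in> {snd (key \<gamma> j v) |v. v \<in> lists (al j) \<and> (key \<gamma> i u, key \<gamma> j v) \<in> C}"
      then obtain v' where "x = snd (key \<gamma> j v')" "(key \<gamma> i u, key \<gamma> j v') \<in> C" by blast
      then show "x \<in> {snd (key \<gamma> j v)}" using uniq[of v'] by simp
    next
      fix x assume "x \<in> {snd (key \<gamma> j v)}"
      then show "x \<in> {snd (key \<gamma> j v) |v. v \<in> lists (al j) \<and> (key \<gamma> i u, key \<gamma> j v) \<in> C}" using v by blast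
    qed
    then have "B j = snd (key \<gamma> j v)" unfolding B_def by simp
    then have Bj: "B j = (\<lambda>c. ch j (v @ c)) ` lists (\<gamma> \<inter> al j)" by (simp add: key_def)
    have "finite (B j) \<and> card (B j) \<le> nclasses (\<gamma> \<inter> al j) (grel M (\<gamma> \<inter> al j))"
      unfolding Bj
    proof (rule word_group.card_image_classes[OF grel_word_group])
      show "finite (lists (\<gamma> \<inter> al j) // grel M (\<gamma> \<inter> al j))" using f\<gamma> by (intro finite_grel) auto
      fix a b assume "(a, b) \<in> grel M (\<gamma> \<inter> al j)"
      then have "(a, b) \<in> g j" using grel_mono[OF fin_al, of j "\<gamma> \<inter> al j"] j by (auto simp: Z_def)
      then show "ch j (v @ a) = ch j (v @ b)" using v by (intro ch_cong word_group.congL[OF wg])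
    qed
    moreover have "\<gamma> \<inter> al j \<subset> \<gamma>" using j by (auto simp: Z_def)
    ultimately show ?thesis using nclasses_le_sum[OF f\<gamma>, of "\<gamma> \<inter> al j" "grel M"] unfolding S_def by linarith
  next
    case False
    then have "B j = {}" unfolding B_def by blast
    then show ?thesis by simp
  qed
  have "orbit \<gamma> A.act p \<subseteq> (\<Union>j\<in>Z. B j)"
  proof
    fix q assume q: "q \<in> orbit \<gamma> A.act p"
    then obtain c where c: "c \<in> lists \<gamma>" "q = fold A.act c p" by (auto simp: orbit_def)
    then obtain j v where jv: "j < n" "v \<in> lists (al j)" "q = ch j v" "(key \<gamma> i u, key \<gamma> j v) \<in> C"
      using orbit_linked[OF iu(1,2) c(1)] iu(3) unfolding C_def by blast
    have "ch j (v @ []) \<in> snd (key \<gamma> j v)"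
      unfolding key_def snd_conv by (rule image_eqI[where x = "[]"]) auto
    then have "q \<in> B j" unfolding B_def using jv by auto
    moreover have "j \<in> Z" using False jv q unfolding Z_def by blast
    ultimately show "q \<in> (\<Union>j\<in>Z. B j)" by blast
  qed
  moreover have "finite (\<Union>j\<in>Z. B j)" using fz B by auto
  ultimately have "card (orbit \<gamma> A.act p) \<le> card (\<Union>j\<in>Z. B j)" by (rule card_mono[rotated])
  also have "\<dots> \<le> (\<Sum>j\<in>Z. card (B j))" by (rule card_UN_le[OF fz(1)])
  also have "\<dots> \<le> card Z * S" using sum_bounded_above[of Z "\<lambda>j. card (B j)" S] B by simp
  also have "\<dots> \<le> n * S" using fz(2) by simp
  also have "\<dots> \<le> size1 M (grel M) \<gamma>" unfolding S_def using n_M by (intro size1_ge_sum)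
  finally show ?thesis by simp
qed

lemma fold_chain: "k < n \<Longrightarrow> fold A.act (concat (map w [0..<k])) (ch 0 []) = ch k []"
proof (induction k)
  case (Suc k)
  have "left k [] []" unfolding left_def using word_group.refl[OF wg] by auto
  then have "ch (Suc k) [] = ch k (w k)" using ch_left[of k "[]" "[]"] Suc.prems by simp
  moreover have "fold A.act (w k) (ch k []) = ch k (w k)"
    using A.fold_ch[of k "[]" "w k"] w[of k] Suc.prems by simp
  ultimately show ?case using Suc by simp
qed simp

text \<open>In the amalgam, which is a test set for \<open>rel1\<close>, the word leads from the
  unit of the first coset to a point of the last one. For \<open>n \<ge> 3\<close> the indices
  \<open>0\<close> and \<open>n - 1\<close> are not consecutive, so the two points differ.\<close>

lemma not_closed:
  assumes "3 \<le> n" shows "(concat (map w [0..<n]), []) \<notin> rel1 M (grel M) E"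
proof
  assume a: "(concat (map w [0..<n]), []) \<in> rel1 M (grel M) E"
  define l where "l = n - 1"
  have l: "n = Suc l" "l < n" "2 \<le> l" using assms by (auto simp: l_def)
  have "fold A.act (concat (map w [0..<n])) (ch 0 []) = fold A.act [] (ch 0 [])"
    by (rule rel1_act[OF fin_E A.eset_pts card_pts orbit_large a]) (use A.ch_pts[of 0 "[]"] l in auto)
  moreover have "fold A.act (concat (map w [0..<n])) (ch 0 []) = ch l (w l)"
    using fold_chain[OF l(2)] A.fold_ch[of l "[]" "w l"] w[OF l(2)] l by simp
  ultimately have "ch 0 [] = ch l (w l)" by simp
  then show False using ch_eq[of 0 l "[]" "w l"] l w[OF l(2)] by auto
qed

end

text \<open>The amalgam is an open chain and needs nondegeneracy at interior indices only; therefore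
  the degenerate index can always be found in the interior.\<close>

lemma rel1_acyclic:
  assumes E: "finite E" and n: "3 \<le> n" "n \<le> M" and al: "\<And>i. i < n \<Longrightarrow> al i \<subseteq> E"
    and w: "\<And>i. i < n \<Longrightarrow> w i \<in> lists (al i)"
    and closed: "(concat (map w [0..<n]), []) \<in> rel1 M (grel M) E"
  obtains i a b where "0 < i" "Suc i < n" "a \<in> lists (al (i - 1) \<inter> al i)" "b \<in> lists (al i \<inter> al (Suc i))"
    "(w i, a @ b) \<in> rel1 M (grel M) E"
proof -
  interpret R: word_group E "rel1 M (grel M) E" by (rule rel1_word_group)
  have wE: "w i \<in> lists E" if "i < n" for i using w[OF that] al[OF that] by (rule lists_subD)
  show ?thesis
  proof (cases "\<forall>i<n. al i \<subset> E")
    case True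
    have "\<not> coset_chain M E n al w" using coset_chain.not_closed[OF _ n(1)] closed by blast
    then obtain i a b where i: "0 < i" "Suc i < n" "a \<in> lists (al (i - 1) \<inter> al i)"
        "b \<in> lists (al i \<inter> al (Suc i))" "(w i, a @ b) \<in> grel M (al i)"
      unfolding coset_chain_def using E n True w by auto
    moreover have "(w i, a @ b) \<in> rel1 M (grel M) E"
      using grel_proper_rel1[of "al i" E M] True i by auto
    ultimately show ?thesis using that by blast
  next
    case False
    then obtain i where i: "i < n" "al i = E" using al by blast
    \<comment> \<open>A coset over all of \<open>E\<close> contains its neighbours, and an interior
      neighbour is degenerate at once. Only the middle of a triangle has no interior neighbour;
      there the closing equation splits \<open>w 1\<close>.\<close>
    consider "i = 0" | "2 \<le> i" | "i = 1" "4 \<le> n" | "i = 1" "n = 3" using n(1) by linarith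
    then show ?thesis
    proof cases
      case 1
      have "al 0 \<inter> al 1 = al 1" using 1 i al[of 1] n by auto
      then show ?thesis using that[of 1 "w 1" "[]"] n w[of 1] R.refl[OF wE[of 1]] by auto
    next
      case 2
      have "i - 1 < n" using i by simp
      then have "al (i - 1) \<inter> al i = al (i - 1)" using i(2) al[of "i - 1"] by blast
      then show ?thesis using that[of "i - 1" "[]" "w (i - 1)"] 2 i w[of "i - 1"] R.refl[OF wE[of "i - 1"]] by auto
    next
      case 3
      have "al 1 \<inter> al 2 = al 2" using 3 i al[of 2] by auto
      then show ?thesis using that[of 2 "w 2" "[]"] 3 w[of 2] R.refl[OF wE[of 2]] by (auto simp: numeral_2_eq_2)
    next
      case 4
      have "[0..<n] = [0, 1, 2]" using 4 by (simp add: upt_rec)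
      then have c: "(w 0 @ w 1 @ w 2, []) \<in> rel1 M (grel M) E" using closed by simp
      have "(w 1 @ w 2, rev (w 0)) \<in> rel1 M (grel M) E" using c R.moveL[of "w 0" "w 1 @ w 2" "[]"] wE 4 by simp
      then have "(w 1, rev (w 0) @ rev (w 2)) \<in> rel1 M (grel M) E" using R.moveR[of "w 2" "w 1"] wE 4 by simp
      moreover have "al 0 \<inter> al 1 = al 0" "al 1 \<inter> al 2 = al 2" using 4 i al[of 0] al[of 2] by auto
      ultimately show ?thesis
        using that[of 1 "rev (w 0)" "rev (w 2)"] 4 w[of 0] w[of 2] by (simp add: numeral_2_eq_2)
    qed
  qed
qed

section \<open>Composable walks\<close>

fun cwalk :: "('e \<Rightarrow> 'x \<Rightarrow> bool) \<Rightarrow> ('e \<Rightarrow> 'x \<Rightarrow> 'x) \<Rightarrow> 'x \<Rightarrow> 'e list \<Rightarrow> bool" where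
  "cwalk inc \<rho> x [] = True"
| "cwalk inc \<rho> x (e # u) = (inc e x \<and> cwalk inc \<rho> (\<rho> e x) u)"

lemma cwalk_append: "cwalk inc \<rho> x (u @ v) \<longleftrightarrow> cwalk inc \<rho> x u \<and> cwalk inc \<rho> (fold \<rho> u x) v"
  by (induction u arbitrary: x) auto

text \<open>Letters act on all points of \<open>H\<close>, but \<open>inc e x\<close> marks those points at which
  the letter may be used in a composable walk.\<close>

locale inc_eset =
  fixes E :: "'e set" and H :: "'h set" and \<rho> :: "'e \<Rightarrow> 'h \<Rightarrow> 'h" and inc :: "'e \<Rightarrow> 'h \<Rightarrow> bool"
  assumes fin_E: "finite E" and es: "eset E H \<rho>"
    and inc_sym: "e \<in> E \<Longrightarrow> x \<in> H \<Longrightarrow> inc e x \<Longrightarrow> inc e (\<rho> e x)"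
begin

definition adj :: "'e set \<Rightarrow> 'h \<Rightarrow> 'h \<Rightarrow> bool" where
  "adj \<gamma> x y \<longleftrightarrow> x \<in> H \<and> \<gamma> \<subseteq> E \<and> y \<in> orbit \<gamma> \<rho> x"

definition lk :: "'e set \<Rightarrow> 'h \<Rightarrow> 'h \<Rightarrow> bool" where
  "lk \<gamma> x y \<longleftrightarrow> x \<in> H \<and> \<gamma> \<subseteq> E \<and> (\<exists>u\<in>lists \<gamma>. cwalk inc \<rho> x u \<and> y = fold \<rho> u x)"

lemma adj_in: "adj \<gamma> x y \<Longrightarrow> x \<in> H \<and> y \<in> H \<and> \<gamma> \<subseteq> E"
proof -
  assume "adj \<gamma> x y"
  then have a: "x \<in> H" "\<gamma> \<subseteq> E" "y \<in> orbit \<gamma> \<rho> x" by (simp_all add: adj_def)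
  then show ?thesis using subsetD[OF orbit_sub[OF es a(2,1)] a(3)] by simp
qed

lemma adj_refl: "x \<in> H \<Longrightarrow> \<gamma> \<subseteq> E \<Longrightarrow> adj \<gamma> x x"
  by (simp add: adj_def orbit_refl)

lemma adj_sym: "adj \<gamma> x y \<Longrightarrow> adj \<gamma> y x"
proof -
  assume a: "adj \<gamma> x y"
  have "x \<in> orbit \<gamma> \<rho> y" by (rule orbit_sym[OF es]) (use a in \<open>simp_all add: adj_def\<close>)
  then show ?thesis using adj_in[OF a] by (simp add: adj_def)
qed

lemma adj_trans: "adj \<gamma> x y \<Longrightarrow> adj \<gamma> y z \<Longrightarrow> adj \<gamma> x z"
  unfolding adj_def using orbit_trans by metis

lemma adj_mono: "adj \<gamma> x y \<Longrightarrow> \<gamma> \<subseteq> \<delta> \<Longrightarrow> \<delta> \<subseteq> E \<Longrightarrow> adj \<delta> x y"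
  using orbit_mono[of \<gamma> \<delta> \<rho> x] by (auto simp: adj_def)

lemma adj_empty: "adj {} x y \<Longrightarrow> x = y"
  by (auto simp: adj_def orbit_def)

lemma adj_fold: "x \<in> H \<Longrightarrow> \<gamma> \<subseteq> E \<Longrightarrow> u \<in> lists \<gamma> \<Longrightarrow> adj \<gamma> x (fold \<rho> u x)"
  by (simp add: adj_def orbit_fold)

lemma adj_word: "adj \<gamma> x y \<Longrightarrow> \<exists>u\<in>lists \<gamma>. y = fold \<rho> u x"
  by (auto simp: adj_def orbit_def)

lemma lk_adj: "lk \<gamma> x y \<Longrightarrow> adj \<gamma> x y"
  unfolding lk_def adj_def by (metis orbit_fold)

lemma lk_in: "lk \<gamma> x y \<Longrightarrow> x \<in> H \<and> y \<in> H \<and> \<gamma> \<subseteq> E"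
  using lk_adj adj_in by blast

lemma lk_refl: "x \<in> H \<Longrightarrow> \<gamma> \<subseteq> E \<Longrightarrow> lk \<gamma> x x"
  unfolding lk_def by (intro conjI bexI[of _ "[]"]) auto

lemma cwalk_rev: "x \<in> H \<Longrightarrow> u \<in> lists E \<Longrightarrow> cwalk inc \<rho> x u \<Longrightarrow> cwalk inc \<rho> (fold \<rho> u x) (rev u)"
proof (induction u arbitrary: x rule: list.induct)
  case (Cons e u)
  have e: "e \<in> E" "u \<in> lists E" "\<rho> e x \<in> H" "\<rho> e (\<rho> e x) = x"
    using Cons.prems esetD(1,2)[OF es, of e x] by auto
  have "inc e (\<rho> e x)" using Cons.prems e(1) by (intro inc_sym) auto
  moreover have "fold \<rho> (rev u) (fold \<rho> u (\<rho> e x)) = \<rho> e x"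
    using eset_fold_rev[OF es e(2,3)] .
  ultimately show ?case using Cons.IH[OF e(3,2)] Cons.prems by (simp add: cwalk_append)
qed simp

lemma lk_sym: "lk \<gamma> x y \<Longrightarrow> lk \<gamma> y x"
proof -
  assume a: "lk \<gamma> x y"
  then obtain u where u: "x \<in> H" "\<gamma> \<subseteq> E" "u \<in> lists \<gamma>" "cwalk inc \<rho> x u" "y = fold \<rho> u x"
    by (auto simp: lk_def)
  have uE: "u \<in> lists E" using u(3,2) by (rule lists_subD)
  have "cwalk inc \<rho> y (rev u)" "x = fold \<rho> (rev u) y" "y \<in> H"
    using cwalk_rev[OF u(1) uE u(4)] eset_fold_rev[OF es uE u(1)] eset_fold[OF es uE u(1)] u(5) by auto
  moreover have "rev u \<in> lists \<gamma>" using u(3) by simp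
  ultimately show ?thesis using u(2) unfolding lk_def by blast
qed

lemma lk_trans: "lk \<gamma> x y \<Longrightarrow> lk \<gamma> y z \<Longrightarrow> lk \<gamma> x z"
proof -
  assume a: "lk \<gamma> x y" "lk \<gamma> y z"
  then obtain u v where u: "x \<in> H" "\<gamma> \<subseteq> E" "u \<in> lists \<gamma>" "cwalk inc \<rho> x u" "y = fold \<rho> u x"
    and v: "v \<in> lists \<gamma>" "cwalk inc \<rho> y v" "z = fold \<rho> v y" by (auto simp: lk_def)
  then have "cwalk inc \<rho> x (u @ v)" "z = fold \<rho> (u @ v) x" "u @ v \<in> lists \<gamma>" by (auto simp: cwalk_append)
  then show ?thesis using u(1,2) unfolding lk_def by blast
qed

lemma lk_mono: "lk \<gamma> x y \<Longrightarrow> \<gamma> \<subseteq> \<delta> \<Longrightarrow> \<delta> \<subseteq> E \<Longrightarrow> lk \<delta> x y"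
  using lists_mono[of \<gamma> \<delta>] by (auto simp: lk_def)

lemma lk_empty: "lk {} x y \<Longrightarrow> x = y"
  using lk_adj adj_empty by blast

text \<open>The support of \<open>h\<close> seen from \<open>x\<close>. Without any connection the
  intersection is \<open>UNIV\<close>, which is not a proper subset of \<open>E\<close>; so
  \<open>near\<close> includes that \<open>x\<close> and \<open>h\<close> are connected.\<close>

definition S :: "'h \<Rightarrow> 'h \<Rightarrow> 'e set" where "S x h = \<Inter>{\<gamma>. adj \<gamma> x h}"

lemma S_le: "adj \<gamma> x h \<Longrightarrow> S x h \<subseteq> \<gamma>"
  by (auto simp: S_def)

end

text \<open>One step of the induction on the letter set \<open>E\<close>: \<open>H\<close> is a good approximation,
  in which composable walks can be decomposed as long as they avoid some letter.\<close>

locale chamber_system = inc_eset +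
  fixes M :: nat
  assumes M: "0 < M"
    and respH: "\<gamma> \<subset> E \<Longrightarrow> x \<in> H \<Longrightarrow> resp (grel M \<gamma>) \<rho> x"
    and meet: "adj \<alpha> x y \<Longrightarrow> adj \<beta> x y \<Longrightarrow> adj (\<alpha> \<inter> \<beta>) x y"
    and tri: "adj \<alpha> x y \<Longrightarrow> adj \<beta> y z \<Longrightarrow> adj \<gamma> z x \<Longrightarrow> \<exists>m. adj \<alpha> y m \<and> adj \<beta> y m \<and> adj \<gamma> z m"
    and quad: "adj \<alpha> x1 x2 \<Longrightarrow> adj \<beta> x2 x3 \<Longrightarrow> adj \<gamma> x3 x4 \<Longrightarrow> adj \<delta> x4 x1 \<Longrightarrow>
      (\<exists>m. adj \<alpha> x2 m \<and> adj \<gamma> x3 m) \<or> (\<exists>m. adj \<beta> x3 m \<and> adj \<delta> x4 m)"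
    and ex4: "\<mu> \<subset> E \<Longrightarrow> lk \<mu> x y \<Longrightarrow> adj d1 x a \<Longrightarrow> adj d2 a b \<Longrightarrow> adj d3 b y \<Longrightarrow> d1 \<subseteq> \<mu> \<Longrightarrow> d2 \<subseteq> \<mu> \<Longrightarrow> d3 \<subseteq> \<mu> \<Longrightarrow>
      \<exists>k1 k2. lk d1 x k1 \<and> lk d2 k1 k2 \<and> lk d3 k2 y"
begin

text \<open>A connecting letter set of least size lies in every other one, since \<open>meet\<close>
  would otherwise give a smaller one.\<close>

lemma S_adj: assumes "adj \<gamma> x h" shows "adj (S x h) x h"
proof -
  define F where "F = {\<gamma>. adj \<gamma> x h}"
  obtain \<gamma>0 where g: "\<gamma>0 \<in> F" "\<And>\<delta>. \<delta> \<in> F \<Longrightarrow> card \<gamma>0 \<le> card \<delta>"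
    using ex_has_least_nat[of "\<lambda>\<delta>. \<delta> \<in> F" \<gamma> card] assms by (auto simp: F_def)
  have "\<gamma>0 \<subseteq> \<delta>" if "\<delta> \<in> F" for \<delta>
  proof -
    have "\<gamma>0 \<inter> \<delta> \<in> F" using meet g(1) that by (auto simp: F_def)
    then have "card \<gamma>0 \<le> card (\<gamma>0 \<inter> \<delta>)" by (rule g(2))
    moreover have "finite \<gamma>0" using g(1) adj_in[of \<gamma>0 x h] fin_E finite_subset[of \<gamma>0 E] by (simp add: F_def)
    ultimately have "\<gamma>0 \<inter> \<delta> = \<gamma>0" by (intro card_subset_eq) (auto intro: le_antisym card_mono)
    then show ?thesis by blast
  qed
  then have "S x h = \<gamma>0" using g(1) unfolding S_def F_def by blast
  then show ?thesis using g(1) by (simp add: F_def)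
qed

definition near :: "'b \<Rightarrow> 'b \<Rightarrow> bool" where "near x h \<longleftrightarrow> S x h \<subset> E"

lemma near_adj: "near x h \<Longrightarrow> adj (S x h) x h"
proof -
  assume "near x h"
  then have "\<exists>\<gamma>. adj \<gamma> x h" unfolding near_def S_def by auto
  then show ?thesis using S_adj by blast
qed

lemma adj_near: "adj \<gamma> x h \<Longrightarrow> \<gamma> \<subset> E \<Longrightarrow> near x h"
  using S_le[of \<gamma> x h] by (auto simp: near_def)

lemma near_in: "near x h \<Longrightarrow> x \<in> H \<and> h \<in> H"
  using near_adj adj_in by blast

text \<open>The point \<open>st x h\<close> is the point \<open>h\<close> as it is seen from \<open>x\<close>, where \<open>x\<close> may be moved by composable
  walks in the support \<open>S x h\<close>. Letters act on these points as long as the support stays proper.\<close>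

definition below :: "'b \<Rightarrow> 'b \<Rightarrow> 'b \<Rightarrow> bool" where
  "below h x y \<longleftrightarrow> near x h \<and> lk (S x h) x y"

lemma belowD:
  assumes "below h x y"
  shows "near x h" "near y h" "S y h \<subseteq> S x h" "lk (S x h) x y"
proof -
  show n: "near x h" "lk (S x h) x y" using assms by (auto simp: below_def)
  have "adj (S x h) y h" using n near_adj lk_adj adj_sym adj_trans by blast
  then show "S y h \<subseteq> S x h" "near y h" using S_le adj_near n(1) unfolding near_def by blast+
qed

definition eqv :: "'b \<Rightarrow> 'b \<Rightarrow> 'b \<Rightarrow> bool" where
  "eqv h x y \<longleftrightarrow> (\<exists>u. below h x u \<and> below h y u)"

text \<open>The detour from \<open>x\<close> through \<open>h\<close> to \<open>y\<close> uses only
  the two supports. By \<open>ex4\<close>, with an empty middle piece, it can be made composable,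
  and then its turning point is a place to which both observers can move.\<close>

lemma lk_eqv:
  assumes "\<mu> \<subset> E" "lk \<mu> x y" "adj \<mu> x h" shows "eqv h x y"
proof -
  have y: "adj \<mu> y h" using assms lk_adj adj_sym adj_trans by blast
  have n: "near x h" "near y h" using assms y adj_near by auto
  have h: "h \<in> H" using n near_in by blast
  obtain k1 k2 where k: "lk (S x h) x k1" "lk {} k1 k2" "lk (S y h) k2 y"
    using ex4[OF assms(1,2) near_adj[OF n(1)] adj_refl[OF h, of "{}"] adj_sym[OF near_adj[OF n(2)]]]
      S_le[OF y] S_le[OF assms(3)] by blast
  then have "lk (S y h) y k1" using lk_empty lk_sym by blast
  then show ?thesis using k(1) n unfolding eqv_def below_def by blast
qed

lemma eqv_near: "eqv h x y \<Longrightarrow> near x h" "eqv h x y \<Longrightarrow> near y h"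
  unfolding eqv_def using belowD(1) by blast+

lemma eqv_refl: "near x h \<Longrightarrow> eqv h x x"
  using lk_eqv[of "S x h" x x h] near_adj lk_refl near_in unfolding near_def by (meson psubset_imp_subset)

lemma eqv_sym: "eqv h x y \<Longrightarrow> eqv h y x"
  unfolding eqv_def by blast

lemma below_trans: "below h x y \<Longrightarrow> below h y z \<Longrightarrow> below h x z"
proof -
  assume a: "below h x y" "below h y z"
  have "S x h \<subseteq> E" using belowD(1)[OF a(1)] by (auto simp: near_def)
  then have "lk (S x h) y z" by (rule lk_mono[OF belowD(4)[OF a(2)] belowD(3)[OF a(1)]])
  then have "lk (S x h) x z" using belowD(4)[OF a(1)] lk_trans by blast
  then show ?thesis using belowD(1)[OF a(1)] by (simp add: below_def)
qed

lemma below_eqv: "below h x y \<Longrightarrow> eqv h x y"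
  unfolding eqv_def using belowD(2) eqv_refl lk_refl below_def near_in near_def
  by (metis psubset_imp_subset)

text \<open>Confluence: two places below \<open>y\<close> are linked within the support of
  \<open>y\<close>, so \<open>lk_eqv\<close> joins them again.\<close>

lemma eqv_trans: assumes "eqv h x y" "eqv h y z" shows "eqv h x z"
proof -
  obtain u v where u: "below h x u" "below h y u" and v: "below h y v" "below h z v"
    using assms by (auto simp: eqv_def)
  have "lk (S y h) u v" using belowD(4)[OF u(2)] belowD(4)[OF v(1)] lk_sym lk_trans by blast
  moreover have "adj (S y h) u h"
    using near_adj[OF belowD(1)[OF u(2)]] lk_adj[OF belowD(4)[OF u(2)]] adj_sym adj_trans by blast
  moreover have "S y h \<subset> E" using belowD(1)[OF u(2)] by (simp add: near_def)
  ultimately have "eqv h u v" by (intro lk_eqv[of "S y h"])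
  then obtain k where "below h u k" "below h v k" by (auto simp: eqv_def)
  then show ?thesis using below_trans[OF u(1)] below_trans[OF v(2)] unfolding eqv_def by blast
qed

definition st :: "'b \<Rightarrow> 'b \<Rightarrow> 'b \<times> 'b set" where "st x h = (h, {y. eqv h x y})"

lemma fst_st [simp]: "fst (st x h) = h" by (simp add: st_def)

lemma st_eq: "near x h \<Longrightarrow> st x h = st y k \<longleftrightarrow> h = k \<and> eqv h x y"
proof
  assume a: "near x h" "st x h = st y k"
  then have "x \<in> {z. eqv k y z}" using eqv_refl[OF a(1)] by (auto simp: st_def)
  then show "h = k \<and> eqv h x y" using a eqv_sym by (auto simp: st_def)
next
  assume a: "near x h" "h = k \<and> eqv h x y"
  then have "eqv h x z \<longleftrightarrow> eqv h y z" for z by (metis eqv_sym eqv_trans)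
  then show "st x h = st y k" using a by (simp add: st_def)
qed

text \<open>The support grows to at most \<open>insert e (S z h)\<close>, and \<open>lk_eqv\<close>
  only asks that this set be proper. This is the consistency condition for gluing the
  charts.\<close>

lemma eqv_step:
  assumes "eqv h x y" "insert e (S x h) \<subset> E" "insert e (S y h) \<subset> E"
  shows "eqv (\<rho> e h) x y"
proof -
  obtain u where u: "below h x u" "below h y u" using assms(1) by (auto simp: eqv_def)
  have h: "h \<in> H" using near_in eqv_near assms(1) by blast
  have step: "eqv (\<rho> e h) z u" if z: "below h z u" "insert e (S z h) \<subset> E" for z
  proof (rule lk_eqv[OF z(2)])
    have sub: "insert e (S z h) \<subseteq> E" using z(2) by blast
    show "lk (insert e (S z h)) z u"
      by (rule lk_mono[OF belowD(4)[OF z(1)] subset_insertI sub])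
    have "adj (insert e (S z h)) z h"
      by (rule adj_mono[OF near_adj[OF belowD(1)[OF z(1)]] subset_insertI sub])
    moreover have "adj (insert e (S z h)) h (fold \<rho> [e] h)" using h sub by (intro adj_fold) auto
    ultimately show "adj (insert e (S z h)) z (\<rho> e h)" using adj_trans by simp
  qed
  show ?thesis using eqv_trans[OF step[OF u(1) assms(2)] eqv_sym[OF step[OF u(2) assms(3)]]] .
qed

text \<open>A chart \<open>(x, \<gamma>)\<close> is the coset graph of a proper letter set as it is
  seen by the fixed observer \<open>x\<close>.\<close>

definition charts :: "('b \<times> 'a set) set" where "charts = H \<times> {\<gamma>. \<gamma> \<subset> E}"

definition ch :: "'b \<times> 'a set \<Rightarrow> 'a list \<Rightarrow> 'b \<times> 'b set" where "ch j u = st (fst j) (fold \<rho> u (fst j))"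

lemma chart_near: "x \<in> H \<Longrightarrow> \<gamma> \<subset> E \<Longrightarrow> u \<in> lists \<gamma> \<Longrightarrow> near x (fold \<rho> u x) \<and> S x (fold \<rho> u x) \<subseteq> \<gamma>"
  using adj_fold[of x \<gamma> u] adj_near S_le by blast

sublocale A: coset_atlas M charts snd ch
proof
  have "finite {\<gamma>. \<gamma> \<subset> E}" by (rule finite_subset[of _ "Pow E"]) (use fin_E in auto)
  then show "finite charts" using es by (auto simp: charts_def eset_def)
  show "finite (snd j)" if "j \<in> charts" for j
    using that fin_E finite_subset unfolding charts_def by fastforce
  show "ch j u = ch j v" if "j \<in> charts" "(u, v) \<in> grel M (snd j)" for j u v
    using respH[of "snd j" "fst j"] that unfolding charts_def ch_def resp_def by fastforce
next
  fix j k u v e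
  assume a: "j \<in> charts" "k \<in> charts" "u \<in> lists (snd j)" "v \<in> lists (snd k)" "ch j u = ch k v"
    "e \<in> snd j" "e \<in> snd k"
  define h where "h = fold \<rho> u (fst j)"
  have jk: "fst j \<in> H" "snd j \<subset> E" "fst k \<in> H" "snd k \<subset> E" using a(1,2) by (simp_all add: charts_def mem_Times_iff)
  have j: "near (fst j) h" "S (fst j) h \<subseteq> snd j" "snd j \<subset> E"
    using chart_near[OF jk(1,2) a(3)] jk(2) by (simp_all add: h_def)
  have k: "near (fst k) (fold \<rho> v (fst k))" "S (fst k) (fold \<rho> v (fst k)) \<subseteq> snd k" "snd k \<subset> E"
    using chart_near[OF jk(3,4) a(4)] jk(4) by simp_all
  have "st (fst j) h = st (fst k) (fold \<rho> v (fst k))" using a(5) by (simp add: ch_def h_def)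
  then have "h = fold \<rho> v (fst k) \<and> eqv h (fst j) (fst k)" by (rule iffD1[OF st_eq[OF j(1)]])
  then have hk: "fold \<rho> v (fst k) = h" "eqv h (fst j) (fst k)" by (metis, metis)
  have ins: "insert e (S (fst j) h) \<subset> E" "insert e (S (fst k) h) \<subset> E"
    using j k a(6,7) hk(1) by auto
  have e: "eqv (\<rho> e h) (fst j) (fst k)" using eqv_step[OF hk(2) ins] .
  then have "st (fst j) (\<rho> e h) = st (fst k) (\<rho> e h)" using st_eq[OF eqv_near(1)[OF e]] by simp
  then show "ch j (u @ [e]) = ch k (v @ [e])" by (simp add: ch_def hk(1) flip: h_def)
qed

lemma st_pts: "near x h \<Longrightarrow> st x h \<in> A.pts"
proof -
  assume n: "near x h"
  obtain u where u: "u \<in> lists (S x h)" "h = fold \<rho> u x" using near_adj[OF n] adj_word by blast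
  then have "st x h = ch (x, S x h) u" by (simp add: ch_def)
  moreover have "(x, S x h) \<in> charts" using n near_in by (auto simp: charts_def near_def)
  ultimately show ?thesis using A.ch_pts[of "(x, S x h)" u] u by simp
qed

lemma pts_st: "p \<in> A.pts \<Longrightarrow> \<exists>x h. near x h \<and> p = st x h"
proof -
  assume "p \<in> A.pts"
  then obtain j u where j: "j \<in> charts" "u \<in> lists (snd j)" "p = ch j u" unfolding A.pts_def by blast
  then have "near (fst j) (fold \<rho> u (fst j))" using chart_near[of "fst j" "snd j" u]
    by (simp add: charts_def mem_Times_iff)
  then show ?thesis using j(3) unfolding ch_def by blast
qed

text \<open>A point is given by an observer and an observed point, whence the square in
  \<open>size2\<close>.\<close>

lemma card_pts: "card A.pts \<le> (card H)\<^sup>2"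
proof -
  have "A.pts \<subseteq> (\<lambda>(x, h). st x h) ` (H \<times> H)" using pts_st near_in by fastforce
  moreover have "finite (H \<times> H)" using es by (auto simp: eset_def)
  ultimately have "card A.pts \<le> card (H \<times> H)" by (meson card_image_le card_mono finite_imageI le_trans)
  then show ?thesis by (simp add: power2_eq_square card_cartesian_product)
qed

lemma act_walk:
  assumes "near x h" "S x h \<union> \<gamma> \<subset> E" "u \<in> lists \<gamma>"
  shows "fold A.act u (st x h) = st x (fold \<rho> u h)" "near x (fold \<rho> u h)"
proof -
  obtain v where v: "v \<in> lists (S x h)" "h = fold \<rho> v x" using near_adj[OF assms(1)] adj_word by blast
  have j: "(x, S x h \<union> \<gamma>) \<in> charts" using assms near_in by (auto simp: charts_def)
  have l: "v \<in> lists (S x h \<union> \<gamma>)" "u \<in> lists (S x h \<union> \<gamma>)" using v(1) assms(3) by (auto simp: in_lists_conv_set)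
  show "fold A.act u (st x h) = st x (fold \<rho> u h)"
    using A.fold_ch[OF j, of v u] l v(2) by (simp add: ch_def)
  have "v @ u \<in> lists (S x h \<union> \<gamma>)" using l by simp
  then show "near x (fold \<rho> u h)" using chart_near[OF _ assms(2), of x "v @ u"] near_in[OF assms(1)] v(2) by simp
qed

lemma act_st:
  assumes "near x h" "insert e (S x h) \<subset> E"
  shows "A.act e (st x h) = st x (\<rho> e h)" "near x (\<rho> e h)"
  using act_walk[of x h "{e}" "[e]"] assms by auto

text \<open>A letter may act although the support at \<open>x\<close> leaves no room for it: an
  equivalent observer \<open>y\<close> whose support does is enough. To control this freedom is the
  purpose of \<open>core\<close>.\<close>

lemma act_st_cases:
  assumes "near x h"
  obtains "A.act e (st x h) = st x h"
  | y where "eqv h x y" "insert e (S y h) \<subset> E" "A.act e (st x h) = st y (\<rho> e h)"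
proof (cases rule: A.act_cases[of e "st x h"])
  case (2 j u)
  have eq: "st x h = st (fst j) (fold \<rho> u (fst j))" using 2(4) by (simp add: ch_def)
  then have h: "h = fold \<rho> u (fst j)" "eqv h x (fst j)" using st_eq[OF assms] by auto
  have c: "S (fst j) h \<subseteq> snd j" "snd j \<subset> E"
    using chart_near[of "fst j" "snd j" u] 2(1,2) h(1) by (simp_all add: charts_def mem_Times_iff)
  then have "insert e (S (fst j) h) \<subset> E" using 2(3) by auto
  then show ?thesis using that(2)[of "fst j"] h 2(5) by (simp add: ch_def)
qed (use that in blast)

section \<open>Minimal observers and the control of orbits\<close>

definition core :: "'b \<Rightarrow> 'b \<Rightarrow> bool" where
  "core h y \<longleftrightarrow> near y h \<and> (\<forall>z. eqv h y z \<longrightarrow> S y h \<subseteq> S z h)"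

lemma near_finite: "near x h \<Longrightarrow> finite (S x h)"
  using fin_E finite_subset by (auto simp: near_def)

text \<open>Take a place below \<open>x\<close> whose support has least size. Any equivalent
  observer shares a lower place with it, and there the support cannot have shrunk, so it is
  contained in the support of that observer.\<close>

lemma core_exists: assumes "near x h" shows "\<exists>y. below h x y \<and> core h y"
proof -
  obtain y where y: "eqv h x y" "\<And>z. eqv h x z \<Longrightarrow> card (S y h) \<le> card (S z h)"
    using ex_has_least_nat[of "eqv h x" x "\<lambda>z. card (S z h)"] eqv_refl[OF assms] by auto
  obtain u where u: "below h x u" "below h y u" using y(1) by (auto simp: eqv_def)
  have min: "S u h \<subseteq> S z h" if z: "eqv h u z" for z
  proof -
    obtain k where k: "below h u k" "below h z k" using z by (auto simp: eqv_def)
    have "eqv h x k" using below_trans[OF u(1) k(1)] below_eqv by blast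
    then have "card (S y h) \<le> card (S k h)" by (rule y(2))
    moreover have sub: "S k h \<subseteq> S u h" "S u h \<subseteq> S y h" using belowD(3) k(1) u(2) by auto
    moreover have f: "finite (S u h)" "finite (S y h)" using near_finite belowD(1) k(1) u(2) by auto
    moreover have "card (S u h) \<le> card (S y h)" using sub f by (intro card_mono)
    ultimately have "S k h = S u h" by (intro card_seteq) auto
    then show ?thesis using belowD(3)[OF k(2)] by simp
  qed
  then show ?thesis using u(1) belowD(2)[OF u(1)] by (auto simp: core_def)
qed

definition small :: "'a set \<Rightarrow> ('b \<times> 'b set) set \<Rightarrow> 'b \<Rightarrow> 'b \<Rightarrow> bool" where
  "small \<gamma> Q h y \<longleftrightarrow> near y h \<and> st y h \<in> Q \<and> (\<forall>z k. near z k \<and> st z k \<in> Q \<longrightarrow> card (S y h) \<le> card (S z k))"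

lemma small_exists:
  assumes "near x h" "st x h \<in> Q" shows "\<exists>y k. small \<gamma> Q k y"
proof -
  obtain p where p: "near (fst p) (snd p) \<and> st (fst p) (snd p) \<in> Q"
    "\<And>q. near (fst q) (snd q) \<and> st (fst q) (snd q) \<in> Q \<Longrightarrow> card (S (fst p) (snd p)) \<le> card (S (fst q) (snd q))"
    using ex_has_least_nat[of "\<lambda>p. near (fst p) (snd p) \<and> st (fst p) (snd p) \<in> Q" "(x, h)" "\<lambda>p. card (S (fst p) (snd p))"]
      assms by auto
  then show ?thesis unfolding small_def by (metis fst_conv snd_conv)
qed

text \<open>A point of a \<open>\<gamma>\<close>-orbit that minimizes the distance (in the sense of supports) to the base
  points controls the whole orbit.\<close>

context
  fixes \<gamma> Q h0 y0
  assumes g: "\<gamma> \<subset> E" and Q: "Q = orbit \<gamma> A.act (st y0 h0)" and sm: "small \<gamma> Q h0 y0"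
begin

abbreviation (input) "\<tau> \<equiv> S y0 h0"

lemma gE: "\<gamma> \<subseteq> E" using g by blast

lemma sm_near: "near y0 h0" and sm_min: "near z k \<Longrightarrow> st z k \<in> Q \<Longrightarrow> card \<tau> \<le> card (S z k)"
  using sm by (auto simp: small_def)

lemma tau: "\<tau> \<subset> E" "adj \<tau> y0 h0" "finite \<tau>" "h0 \<in> H" "y0 \<in> H"
  using sm_near near_adj near_finite near_in by (auto simp: near_def)

lemma tE: "\<tau> \<subseteq> E" using tau(1) by blast

lemma min_eq: "near z k \<Longrightarrow> st z k \<in> Q \<Longrightarrow> S z k \<subseteq> \<tau> \<Longrightarrow> S z k = \<tau>"
  using sm_min tau(3) by (intro card_seteq) auto

text \<open>The way from \<open>h0\<close> to \<open>m\<close> can be taken within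
  \<open>\<gamma> \<inter> \<tau>\<close>. Then the support never leaves the proper set
  \<open>\<tau>\<close>, and the action follows this way.\<close>

lemma Q_mem:
  assumes "adj \<tau> y0 m" "adj \<gamma> h0 m"
  shows "st y0 m \<in> Q" "near y0 m" "S y0 m = \<tau>"
proof -
  have "adj \<tau> h0 m" using adj_trans[OF adj_sym[OF tau(2)] assms(1)] .
  then have "adj (\<gamma> \<inter> \<tau>) h0 m" using meet[OF assms(2)] by simp
  then obtain u where u: "u \<in> lists (\<gamma> \<inter> \<tau>)" "m = fold \<rho> u h0" using adj_word by blast
  have "S y0 h0 \<union> (\<gamma> \<inter> \<tau>) = \<tau>" by blast
  then have w: "fold A.act u (st y0 h0) = st y0 m" "near y0 m"
    using act_walk[OF sm_near, of "\<gamma> \<inter> \<tau>" u] u tau(1) by simp_all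
  have "u \<in> lists \<gamma>" using u(1) by (rule lists_subD) simp
  then show "st y0 m \<in> Q" "near y0 m" using w orbit_fold[of u \<gamma> A.act "st y0 h0"] Q by simp_all
  then show "S y0 m = \<tau>" using min_eq S_le[OF assms(1)] by blast
qed

text \<open>The triangle on \<open>y0\<close>, \<open>h0\<close>, \<open>h'\<close> yields a point
  \<open>m\<close> in the orbit of \<open>h0\<close> that is reached from \<open>y0\<close> within
  the support of \<open>h'\<close>; by minimality its own support is all of \<open>\<tau>\<close>.
  So \<open>h0\<close> is a gate through which \<open>y0\<close> sees the orbit.\<close>

lemma gate:
  assumes h: "adj \<gamma> h0 h'" "adj \<beta> y0 h'" shows "\<tau> \<subseteq> S y0 h'"
proof -
  obtain m where m: "adj \<tau> h0 m" "adj \<gamma> h0 m" "adj (S y0 h') h' m"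
    using tri[OF tau(2) h(1) adj_sym[OF S_adj[OF h(2)]]] by blast
  have 1: "adj \<tau> y0 m" using adj_trans[OF tau(2) m(1)] .
  have "adj (S y0 h') y0 m" using adj_trans[OF S_adj[OF h(2)] m(3)] .
  then show ?thesis using S_le[of "S y0 h'" y0 m] Q_mem(3)[OF 1 m(2)] by simp
qed

lemma gate_union:
  assumes h: "adj \<gamma> h0 h'" shows "S y0 h' = \<tau> \<union> S h0 h'"
proof (rule subset_antisym)
  have sE: "\<tau> \<union> S h0 h' \<subseteq> E" using tE S_le[OF h] gE by blast
  have "adj (\<tau> \<union> S h0 h') y0 h0" "adj (\<tau> \<union> S h0 h') h0 h'"
    by (rule adj_mono[OF tau(2) _ sE], simp) (rule adj_mono[OF S_adj[OF h] _ sE], simp)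
  then have yh: "adj (\<tau> \<union> S h0 h') y0 h'" by (rule adj_trans)
  then show "S y0 h' \<subseteq> \<tau> \<union> S h0 h'" by (rule S_le)
  have t: "\<tau> \<subseteq> S y0 h'" using gate[OF h yh] .
  have bE: "S y0 h' \<subseteq> E" using S_le[OF yh] sE by blast
  have "adj (S y0 h') h0 h'" using adj_trans[OF adj_sym[OF adj_mono[OF tau(2) t bE]] S_adj[OF yh]] .
  then show "\<tau> \<union> S h0 h' \<subseteq> S y0 h'" using S_le t by blast
qed

text \<open>Let \<open>y\<close> be a minimal observer below \<open>y0\<close>, with support
  \<open>a\<close>. A composable detour gives a square on \<open>k1\<close>, \<open>h0\<close>,
  \<open>h'\<close>, \<open>k2\<close> with sides over \<open>\<tau>\<close>,
  \<open>\<gamma>\<close>, \<open>a\<close>, \<open>\<gamma>\<close>, which \<open>quad\<close>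
  cuts. One cut would put a point with empty support into \<open>Q\<close>. The other leads to a
  point of \<open>Q\<close> that both observers see alike; minimality of \<open>\<tau>\<close> gives
  \<open>\<tau> \<subseteq> a\<close>, and then \<open>y0\<close> itself reaches \<open>h'\<close>
  within \<open>a\<close>.\<close>

lemma core_step:
  assumes ne: "\<tau> \<noteq> {}" and h: "adj \<gamma> h0 h'" "near y0 h'" shows "core h' y0"
proof -
  define \<mu> where "\<mu> = S y0 h'"
  have mu: "\<mu> \<subset> E" using h(2) by (simp add: near_def \<mu>_def)
  then have muE: "\<mu> \<subseteq> E" by blast
  have mu_eq: "\<mu> = \<tau> \<union> S h0 h'" using gate_union[OF h(1)] by (simp add: \<mu>_def)
  obtain y where y: "below h' y0 y" "core h' y" using core_exists[OF h(2)] by blast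
  define a where "a = S y h'"
  have a: "a \<subseteq> \<mu>" "adj a y h'" "lk \<mu> y0 y" "near y h'"
    using belowD[OF y(1)] near_adj by (auto simp: a_def \<mu>_def)
  have "\<mu> \<subseteq> a"
  proof -
    have d2: "adj (S h0 h') h0 h'" using S_adj[OF h(1)] .
    obtain k1 k2 where k: "lk \<tau> y0 k1" "lk (S h0 h') k1 k2" "lk a k2 y"
      using ex4[OF mu a(3) tau(2) d2 adj_sym[OF a(2)]] mu_eq a(1) by blast
    have sg: "S h0 h' \<subseteq> \<gamma>" using S_le[OF h(1)] .
    have k12: "adj \<gamma> k2 k1" using adj_sym[OF adj_mono[OF lk_adj[OF k(2)] sg gE]] .
    have k1h: "adj \<tau> k1 h0" using adj_trans[OF adj_sym[OF lk_adj[OF k(1)]] tau(2)] .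
    have hk2: "adj a h' k2" using adj_trans[OF adj_sym[OF a(2)] adj_sym[OF lk_adj[OF k(3)]]] .
    \<comment> \<open>Here \<open>k1\<close> would lie in the \<open>\<gamma>\<close>-orbit of
      \<open>h0\<close>. As \<open>y0\<close> can move to \<open>k1\<close> by a composable walk,
      the observed point \<open>k1\<close> could be seen from itself, with empty support.\<close>
    have "\<not> (\<exists>m. adj \<gamma> h' m \<and> adj \<gamma> k2 m)"
    proof
      assume "\<exists>m. adj \<gamma> h' m \<and> adj \<gamma> k2 m"
      then obtain m where "adj \<gamma> h' m" "adj \<gamma> k2 m" by blast
      then have hk1: "adj \<gamma> h0 k1" using h(1) k12 adj_sym adj_trans by metis
      have 1: "st y0 k1 \<in> Q" "near y0 k1" "S y0 k1 = \<tau>" using Q_mem[OF lk_adj[OF k(1)] hk1] .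
      have "below k1 y0 k1" using 1 k(1) by (simp add: below_def)
      then have "st y0 k1 = st k1 k1" "near k1 k1" using st_eq[OF 1(2)] below_eqv belowD(2) by simp_all
      then have "card \<tau> \<le> card (S k1 k1)" using sm_min 1(1) by simp
      moreover have "S k1 k1 = {}" using S_le[of "{}" k1 k1] adj_refl[of k1 "{}"] lk_in[OF k(1)] by simp
      ultimately show False using ne tau(3) by simp
    qed
    then obtain m where m: "adj \<tau> h0 m" "adj a h' m" using quad[OF k1h h(1) hk2 k12] by blast
    obtain m' where m': "adj \<tau> h0 m'" "adj \<gamma> h0 m'" "adj a h' m'"
      using tri[OF adj_sym[OF m(1)] h(1) m(2)] by blast
    have t': "adj \<tau> y0 m'" using adj_trans[OF tau(2) m'(1)] .
    have q: "st y0 m' \<in> Q" "near y0 m'" "S y0 m' = \<tau>" using Q_mem[OF t' m'(2)] .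
    have ym: "S y m' \<subseteq> a" using S_le[OF adj_trans[OF a(2) m'(3)]] .
    have "adj \<mu> y0 m'" by (rule adj_mono[OF t' _ muE]) (simp add: mu_eq)
    then obtain z where z: "below m' y0 z" "below m' y z"
      using lk_eqv[OF mu a(3)] by (auto simp: eqv_def)
    have zz: "near z m'" "S z m' \<subseteq> \<tau>" "S z m' \<subseteq> a"
      using belowD[OF z(1)] belowD[OF z(2)] q(3) ym by auto
    have "st z m' = st y0 m'" using st_eq[OF q(2), of z m'] below_eqv[OF z(1)] by simp
    then have ta: "\<tau> \<subseteq> a" using min_eq[of z m'] zz q(1) by simp
    have aE: "a \<subseteq> E" using a(1) muE by blast
    have "lk \<tau> y0 z" using belowD(4)[OF z(1)] q(3) by simp
    then have "adj a y0 z" using adj_mono[OF lk_adj ta aE] by blast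
    moreover have "adj a z y" using adj_mono[OF adj_sym[OF lk_adj[OF belowD(4)[OF z(2)]]] ym aE] .
    ultimately have "adj a y0 h'" using a(2) adj_trans by blast
    then show ?thesis using S_le by (simp add: \<mu>_def)
  qed
  then have "S y0 h' = S y h'" using a(1) by (simp add: a_def \<mu>_def)
  moreover have "eqv h' y z" if "eqv h' y0 z" for z
    using eqv_trans[OF eqv_sym[OF below_eqv[OF y(1)]] that] .
  ultimately show ?thesis using y(2) h(2) by (auto simp: core_def)
qed

text \<open>Whenever a letter acts through an equivalent observer, it acts through \<open>y0\<close>
  as well, whose support is least. So the whole orbit is described by this single observer.\<close>

lemma Q_core:
  assumes ne: "\<tau> \<noteq> {}" and q: "q \<in> Q"
  shows "q = st y0 (fst q) \<and> near y0 (fst q) \<and> core (fst q) y0 \<and> adj \<gamma> h0 (fst q)"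
proof -
  have main: "\<exists>h. fold A.act u (st y0 h0) = st y0 h \<and> near y0 h \<and> adj \<gamma> h0 h" if "u \<in> lists \<gamma>" for u
    using that
  proof (induction u rule: rev_induct)
    case Nil
    then show ?case using sm_near adj_refl[OF tau(4) gE] by auto
  next
    case (snoc e u)
    then obtain h where h: "fold A.act u (st y0 h0) = st y0 h" "near y0 h" "adj \<gamma> h0 h" by auto
    have c: "core h y0" using core_step[OF ne h(3,2)] .
    have e: "e \<in> \<gamma>" using snoc.prems by simp
    show ?case
    proof (cases rule: act_st_cases[OF h(2), of e])
      case 1
      then show ?thesis using h by auto
    next
      case (2 y)
      have "S y0 h \<subseteq> S y h" using c 2(1) by (simp add: core_def)
      then have "insert e (S y0 h) \<subset> E" using 2(2) by blast
      then have "A.act e (st y0 h) = st y0 (\<rho> e h)" "near y0 (\<rho> e h)" using act_st[OF h(2)] by auto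
      moreover have "adj \<gamma> h (fold \<rho> [e] h)" using adj_in[OF h(3)] e by (intro adj_fold) auto
      then have "adj \<gamma> h0 (\<rho> e h)" using adj_trans[OF h(3)] by simp
      ultimately show ?thesis using h(1) by auto
    qed
  qed
  obtain u where "u \<in> lists \<gamma>" "q = fold A.act u (st y0 h0)" using q Q by (auto simp: orbit_def)
  then obtain h where "q = st y0 h" "near y0 h" "adj \<gamma> h0 h" using main by blast
  then show ?thesis using core_step[OF ne] by simp
qed

lemma Q_base:
  assumes e: "\<tau> = {}" and q: "q \<in> Q" shows "y0 = h0 \<and> q = st h0 (fst q) \<and> adj \<gamma> h0 (fst q)"
proof -
  have y: "y0 = h0" using adj_empty tau(2) e by simp
  obtain u where u: "u \<in> lists \<gamma>" "q = fold A.act u (st y0 h0)" using q Q by (auto simp: orbit_def)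
  have "q = st h0 (fold \<rho> u h0)" using act_walk(1)[OF sm_near, of \<gamma> u] e g u y by simp
  then show ?thesis using y adj_fold[OF tau(4) gE u(1)] by simp
qed

end

lemma orbit_control:
  assumes "near x h" "\<gamma> \<subset> E"
  obtains h0 y0 where "orbit \<gamma> A.act (st x h) = orbit \<gamma> A.act (st y0 h0)" "small \<gamma> (orbit \<gamma> A.act (st y0 h0)) h0 y0"
proof -
  have "st x h \<in> orbit \<gamma> A.act (st x h)" by (rule orbit_refl)
  then obtain y0 h0 where s: "small \<gamma> (orbit \<gamma> A.act (st x h)) h0 y0" using small_exists assms(1) by blast
  have gE: "\<gamma> \<subseteq> E" using assms(2) by blast
  have 1: "st y0 h0 \<in> orbit \<gamma> A.act (st x h)" using s by (simp add: small_def)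
  have 2: "st x h \<in> orbit \<gamma> A.act (st y0 h0)" using orbit_sym[OF A.eset_pts gE st_pts[OF assms(1)] 1] .
  have "orbit \<gamma> A.act (st x h) = orbit \<gamma> A.act (st y0 h0)"
    using orbit_trans[OF 1] orbit_trans[OF 2] by blast
  then show ?thesis using that s by simp
qed

text \<open>If \<open>S y0 h0 \<union> \<gamma>\<close> is proper, one chart contains the orbit.
  Otherwise no point of it needs all of \<open>\<gamma>\<close> from \<open>h0\<close>, because its
  support, which is \<open>S y0 h0\<close> joined with the letters needed, has to stay proper. Then
  the orbit is covered by one coset for each proper subset of \<open>\<gamma>\<close>.\<close>

lemma orbit_large:
  assumes g: "\<gamma> \<subset> E" and p: "p \<in> A.pts"
  shows "(\<exists>q\<in>orbit \<gamma> A.act p. resp (grel M \<gamma>) A.act q) \<or> card (orbit \<gamma> A.act p) \<le> size1 M (grel M) \<gamma>"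
proof -
  have f\<gamma>: "finite \<gamma>" using g fin_E finite_subset by blast
  obtain x h where x: "near x h" "p = st x h" using pts_st[OF p] by blast
  obtain h0 y0 where c: "orbit \<gamma> A.act p = orbit \<gamma> A.act (st y0 h0)" "small \<gamma> (orbit \<gamma> A.act (st y0 h0)) h0 y0"
    using orbit_control[OF x(1) g] x(2) by metis
  define Q where "Q = orbit \<gamma> A.act (st y0 h0)"
  have s: "small \<gamma> Q h0 y0" using c(2) by (simp add: Q_def)
  note t = tau[OF g Q_def s]
  show ?thesis
  proof (cases "S y0 h0 \<union> \<gamma> = E")
    case False
    then have j: "(y0, S y0 h0 \<union> \<gamma>) \<in> charts" using t g by (auto simp: charts_def)
    obtain u where u: "u \<in> lists (S y0 h0)" "h0 = fold \<rho> u y0" using adj_word[OF t(2)] by blast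
    have "u \<in> lists (S y0 h0 \<union> \<gamma>)" using u(1) by (rule lists_subD) simp
    then have "resp (grel M \<gamma>) A.act (st y0 h0)" using A.resp_ch[OF j, of u \<gamma>] u(2) by (simp add: ch_def)
    then show ?thesis using c(1) orbit_refl by metis
  next
    case True
    then have ne: "S y0 h0 \<noteq> {}" using g by auto
    define B where "B = (\<Union>\<delta>\<in>{\<delta>. \<delta> \<subset> \<gamma>}. (\<lambda>u. st y0 (fold \<rho> u h0)) ` lists \<delta>)"
    have fd: "finite {\<delta>. \<delta> \<subset> \<gamma>}" by (rule finite_subset[of _ "Pow \<gamma>"]) (use f\<gamma> in auto)
    have b: "finite ((\<lambda>u. st y0 (fold \<rho> u h0)) ` lists \<delta>) \<and>
        card ((\<lambda>u. st y0 (fold \<rho> u h0)) ` lists \<delta>) \<le> nclasses \<delta> (grel M \<delta>)" if d: "\<delta> \<subset> \<gamma>" for \<delta>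
    proof (rule word_group.card_image_classes[OF grel_word_group])
      show "finite (lists \<delta> // grel M \<delta>)" using f\<gamma> d finite_subset by (intro finite_grel) blast
      fix u v assume "(u, v) \<in> grel M \<delta>"
      then show "st y0 (fold \<rho> u h0) = st y0 (fold \<rho> v h0)"
        using respH[of \<delta> h0] d g t(4) unfolding resp_def by fastforce
    qed
    have "Q \<subseteq> B"
    proof
      fix q assume q: "q \<in> Q"
      note qc = Q_core[OF g Q_def s ne q]
      have "S y0 (fst q) = S y0 h0 \<union> S h0 (fst q)" using gate_union[OF g Q_def s] qc by blast
      then have "S h0 (fst q) \<noteq> \<gamma>" using qc True by (auto simp: near_def)
      then have d: "S h0 (fst q) \<subset> \<gamma>" using S_le qc by blast
      obtain u where u: "u \<in> lists (S h0 (fst q))" "fst q = fold \<rho> u h0" using adj_word S_adj qc by blast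
      have "q = st y0 (fold \<rho> u h0)" using qc u(2) by simp
      then show "q \<in> B" unfolding B_def using d u(1) by blast
    qed
    moreover have "finite B" unfolding B_def using fd b by blast
    ultimately have "card Q \<le> card B" by (rule card_mono[rotated])
    also have "\<dots> \<le> (\<Sum>\<delta>\<in>{\<delta>. \<delta> \<subset> \<gamma>}. card ((\<lambda>u. st y0 (fold \<rho> u h0)) ` lists \<delta>))"
      unfolding B_def by (rule card_UN_le[OF fd])
    also have "\<dots> \<le> 1 * (\<Sum>\<delta>\<in>{\<delta>. \<delta> \<subset> \<gamma>}. nclasses \<delta> (grel M \<delta>))"
      unfolding mult_1 by (rule sum_mono) (use b in blast)
    also have "\<dots> \<le> size1 M (grel M) \<gamma>" using M by (intro size1_ge_sum) auto
    finally show ?thesis using c(1) Q_def by simp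
  qed
qed

section \<open>Composable factorizations from the action on observed points\<close>

lemma grel_act_pts:
  assumes "(card H)\<^sup>2 \<le> size2 M (grel M) E" "(u, v) \<in> grel M E" "p \<in> A.pts"
  shows "fold A.act u p = fold A.act v p"
  by (rule grel_act[OF fin_E A.eset_pts _ orbit_large assms(2,3)]) (use card_pts assms(1) le_trans in blast)

text \<open>Along a composable letter the observer may follow the observed point. This needs the
  support \<open>{e}\<close> to be proper, hence the exclusion of one-letter sets.\<close>

lemma act_cwalk:
  assumes single: "\<And>e. e \<in> E \<Longrightarrow> {e} \<noteq> E"
  shows "x \<in> H \<Longrightarrow> w \<in> lists E \<Longrightarrow> cwalk inc \<rho> x w \<Longrightarrow> fold A.act w (st x x) = st (fold \<rho> w x) (fold \<rho> w x)"
proof (induction w arbitrary: x rule: list.induct)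
  case (Cons e w)
  have e: "e \<in> E" "{e} \<subset> E" "\<rho> e x \<in> H" "w \<in> lists E" using Cons.prems single esetD(1)[OF es] by auto
  have eE: "{e} \<subseteq> E" using e(1) by simp
  have n: "adj {e} x (\<rho> e x)" using adj_fold[OF Cons.prems(1) eE, of "[e]"] by simp
  have "lk {e} x (\<rho> e x)" unfolding lk_def using Cons.prems eE by (intro conjI bexI[of _ "[e]"]) auto
  then have q: "eqv (\<rho> e x) x (\<rho> e x)" using lk_eqv[OF e(2) _ n] by blast
  have s: "S x x = {}" using S_le[of "{}" x x] adj_refl[OF Cons.prems(1), of "{}"] by simp
  have nx: "near x x" using s e(1) by (auto simp: near_def)
  have "A.act e (st x x) = st x (\<rho> e x)" "near x (\<rho> e x)" using act_st[OF nx, of e] s e(2) by simp_all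
  then have "A.act e (st x x) = st (\<rho> e x) (\<rho> e x)" using st_eq q by simp
  then show ?case using Cons.IH[OF e(3,4)] Cons.prems by simp
qed simp

text \<open>The piece \<open>z1\<close> leads from \<open>st x x\<close> to \<open>st x a\<close>,
  the composable \<open>w\<close> leads to \<open>st y y\<close>, and \<open>z3\<close> read
  backwards leads from there to \<open>st y b\<close>. So \<open>st x a\<close> and
  \<open>st y b\<close> lie in one \<open>d2\<close>-orbit, whose control produces the composable
  pieces.\<close>

lemma decompose_geo:
  assumes single: "\<And>e. e \<in> E \<Longrightarrow> {e} \<noteq> E" and d: "d1 \<subset> E" "d2 \<subset> E" "d3 \<subset> E"
    and z: "z1 \<in> lists d1" "z2 \<in> lists d2" "z3 \<in> lists d3"
    and x: "x \<in> H" and w: "w \<in> lists E" "cwalk inc \<rho> x w"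
    and eqH: "fold \<rho> w x = fold \<rho> (z1 @ z2 @ z3) x"
    and eq: "fold A.act w (st x x) = fold A.act (z1 @ z2 @ z3) (st x x)"
    and y: "y = fold \<rho> w x" and a: "a = fold \<rho> z1 x" and b: "b = fold \<rho> z2 a"
  shows "(\<exists>y1 y2. lk d1 x y1 \<and> lk d2 y1 y2 \<and> lk d3 y2 y \<and> adj (d1 \<inter> d2) y1 a \<and> adj (d2 \<inter> d3) y2 b) \<or>
    (\<exists>y0 h0. lk d1 x y0 \<and> lk d3 y0 y \<and> adj (d1 \<inter> d3) y0 h0 \<and> adj (d1 \<inter> d2) h0 a \<and> adj (d2 \<inter> d3) h0 b)"
proof -
  have dE: "d1 \<subseteq> E" "d2 \<subseteq> E" "d3 \<subseteq> E" using d by auto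
  have zE: "z1 \<in> lists E" "z2 \<in> lists E" "z3 \<in> lists E"
    using lists_subD[OF z(1) dE(1)] lists_subD[OF z(2) dE(2)] lists_subD[OF z(3) dE(3)] .
  have yH: "y \<in> H" unfolding y using eset_fold[OF es w(1) x] .
  have aH: "a \<in> H" unfolding a using eset_fold[OF es zE(1) x] .
  have bH: "b \<in> H" unfolding b using eset_fold[OF es zE(2) aH] .
  have yb: "y = fold \<rho> z3 b" using eqH by (simp add: y a b)
  have by': "b = fold \<rho> (rev z3) y" unfolding yb using eset_fold_rev[OF es zE(3) bH] by simp
  have xa: "adj d1 x a" unfolding a using adj_fold[OF x dE(1) z(1)] .
  have ab: "adj d2 a b" unfolding b using adj_fold[OF aH dE(2) z(2)] .
  have by3: "adj d3 y b" using adj_sym[OF adj_fold[OF bH dE(3) z(3)]] yb by simp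
  have n: "near x a" "near y b" using adj_near[OF xa d(1)] adj_near[OF by3 d(3)] .
  have sv: "near v v" "S v v = {}" if "v \<in> H" for v
    using adj_near[OF adj_refl[OF that, of "{}"]] S_le[OF adj_refl[OF that, of "{}"]] d by auto
  have 1: "fold A.act z1 (st x x) = st x a"
    unfolding a using act_walk(1)[OF sv(1)[OF x], of d1 z1] sv(2)[OF x] d(1) z(1) by simp
  have r: "rev z3 \<in> lists d3" using z by simp
  have 3: "fold A.act (rev z3) (st y y) = st y b"
    using act_walk(1)[OF sv(1)[OF yH], of d3 "rev z3"] sv(2)[OF yH] d(3) r by' by simp
  have m: "fold A.act z2 (st x a) \<in> A.pts" using eset_fold[OF A.eset_pts zE(2) st_pts[OF n(1)]] .
  have wy: "fold A.act w (st x x) = st y y" unfolding y using act_cwalk[OF single x w] by simp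
  have "fold A.act z3 (fold A.act z2 (st x a)) = st y y" using eq wy 1 by simp
  then have 2: "fold A.act z2 (st x a) = st y b"
    using eset_fold_rev[OF A.eset_pts zE(3) m] 3 by simp
  obtain h0 y0 where o: "orbit d2 A.act (st x a) = orbit d2 A.act (st y0 h0)"
      and sm: "small d2 (orbit d2 A.act (st y0 h0)) h0 y0"
    using orbit_control[OF n(1) d(2)] by metis
  define Q where "Q = orbit d2 A.act (st y0 h0)"
  have s: "small d2 Q h0 y0" using sm by (simp add: Q_def)
  have q: "st x a \<in> Q" "st y b \<in> Q"
    using orbit_refl[of "st x a" d2 A.act] orbit_fold[OF z(2), of A.act "st x a"] 2 o by (simp_all add: Q_def)
  \<comment> \<open>With empty support, the orbit is seen from its own point \<open>h0\<close>, and
    \<open>x\<close> and \<open>y\<close> are joined to \<open>h0\<close> by composable walks.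
    Otherwise one minimal observer \<open>y0\<close> sees \<open>a\<close> within \<open>d1\<close>
    and \<open>b\<close> within \<open>d3\<close>, so the middle piece disappears.\<close>
  show ?thesis
  proof (cases "S y0 h0 = {}")
    case True
    have 4: "st x a = st h0 a" "adj d2 h0 a" "st y b = st h0 b" "adj d2 h0 b"
      using Q_base[OF d(2) Q_def s True q(1)] Q_base[OF d(2) Q_def s True q(2)] by simp_all
    have "eqv a x h0" "eqv b y h0"
      using iffD1[OF st_eq[OF n(1)] 4(1)] iffD1[OF st_eq[OF n(2)] 4(3)] by simp_all
    then obtain y1 y2 where yy: "below a x y1" "below a h0 y1" "below b y y2" "below b h0 y2"
      by (auto simp: eqv_def)
    have l1: "lk d1 x y1" using lk_mono[OF belowD(4)[OF yy(1)] S_le[OF xa] dE(1)] .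
    have l2: "lk d2 h0 y1" using lk_mono[OF belowD(4)[OF yy(2)] S_le[OF 4(2)] dE(2)] .
    have l3: "lk d3 y y2" using lk_mono[OF belowD(4)[OF yy(3)] S_le[OF by3] dE(3)] .
    have l4: "lk d2 h0 y2" using lk_mono[OF belowD(4)[OF yy(4)] S_le[OF 4(4)] dE(2)] .
    have "adj (d1 \<inter> d2) y1 a"
      using meet adj_trans[OF adj_sym[OF lk_adj[OF l1]] xa] adj_trans[OF adj_sym[OF lk_adj[OF l2]] 4(2)] by blast
    moreover have "adj (d2 \<inter> d3) y2 b"
      using meet adj_trans[OF adj_sym[OF lk_adj[OF l3]] by3] adj_trans[OF adj_sym[OF lk_adj[OF l4]] 4(4)] by blast
    ultimately show ?thesis using l1 lk_trans[OF lk_sym[OF l2] l4] lk_sym[OF l3] by blast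
  next
    case False
    have 4: "st x a = st y0 a" "core a y0" "adj d2 h0 a" "st y b = st y0 b" "core b y0" "adj d2 h0 b"
      using Q_core[OF d(2) Q_def s False q(1)] Q_core[OF d(2) Q_def s False q(2)] by simp_all
    have e: "eqv a x y0" "eqv b y y0"
      using iffD1[OF st_eq[OF n(1)] 4(1)] iffD1[OF st_eq[OF n(2)] 4(4)] by simp_all
    then obtain u v where uv: "below a x u" "below a y0 u" "below b y v" "below b y0 v"
      by (auto simp: eqv_def)
    have c: "S y0 a \<subseteq> d1" "S y0 b \<subseteq> d3"
      using 4(2,5) eqv_sym[OF e(1)] eqv_sym[OF e(2)] S_le[OF xa] S_le[OF by3] unfolding core_def by blast+
    have l1: "lk d1 x y0"
      using lk_trans[OF lk_mono[OF belowD(4)[OF uv(1)] S_le[OF xa] dE(1)]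
          lk_sym[OF lk_mono[OF belowD(4)[OF uv(2)] c(1) dE(1)]]] .
    have l3: "lk d3 y y0"
      using lk_trans[OF lk_mono[OF belowD(4)[OF uv(3)] S_le[OF by3] dE(3)]
          lk_sym[OF lk_mono[OF belowD(4)[OF uv(4)] c(2) dE(3)]]] .
    have t: "adj (S y0 h0) y0 h0" using tau(2)[OF d(2) Q_def s] .
    have tt: "S y0 h0 \<subseteq> d1" "S y0 h0 \<subseteq> d3"
      using gate_union[OF d(2) Q_def s 4(3)] gate_union[OF d(2) Q_def s 4(6)] c by auto
    have t1: "adj d1 y0 h0" using adj_mono[OF t tt(1) dE(1)] .
    have t3: "adj d3 y0 h0" using adj_mono[OF t tt(2) dE(3)] .
    have "adj d1 h0 a" using adj_trans[OF adj_sym[OF t1] adj_trans[OF adj_sym[OF lk_adj[OF l1]] xa]] .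
    then have 5: "adj (d1 \<inter> d2) h0 a" using meet 4(3) by blast
    have "adj d3 h0 b" using adj_trans[OF adj_sym[OF t3] adj_trans[OF adj_sym[OF lk_adj[OF l3]] by3]] .
    then have "adj (d2 \<inter> d3) h0 b" using meet 4(6) by blast
    then show ?thesis using l1 lk_sym[OF l3] meet[OF t1 t3] 5 by blast
  qed
qed

end

section \<open>Groups with positions\<close>

text \<open>Points of the index set are pairs of a position and a group element; positions are acted upon
  by the letters, and determine which letters are admissible in composable walks.\<close>

locale word_index = word_group E R for E :: "'e set" and R +
  fixes V :: "'v set" and pos :: "'e \<Rightarrow> 'v \<Rightarrow> 'v" and inc :: "'e \<Rightarrow> 'v \<Rightarrow> bool"
  assumes finE: "finite E" and fin_cl: "finite (lists E // R)" and es_pos: "eset E V pos"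
    and pos_R: "(u, v) \<in> R \<Longrightarrow> t \<in> V \<Longrightarrow> fold pos u t = fold pos v t"
    and inc_pos: "e \<in> E \<Longrightarrow> t \<in> V \<Longrightarrow> inc e t \<Longrightarrow> inc e (pos e t)"
begin

definition idx :: "('v \<times> 'e list set) set" where "idx = V \<times> (lists E // R)"

text \<open>Letters multiply on the right, which leaves left multiplication free for symmetries. The
  union over all representatives is a single class, by \<open>mv_at\<close>.\<close>

definition mv :: "'e \<Rightarrow> 'v \<times> 'e list set \<Rightarrow> 'v \<times> 'e list set" where
  "mv e p = (pos e (fst p), \<Union>w\<in>snd p. R `` {w @ [e]})"

abbreviation (input) inci :: "'e \<Rightarrow> 'v \<times> 'e list set \<Rightarrow> bool" where "inci \<equiv> \<lambda>e p. inc e (fst p)"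

lemma at_idx: "t \<in> V \<Longrightarrow> w \<in> lists E \<Longrightarrow> (t, R `` {w}) \<in> idx"
  by (simp add: idx_def quotientI)

lemma idx_at: "p \<in> idx \<Longrightarrow> \<exists>t w. t \<in> V \<and> w \<in> lists E \<and> p = (t, R `` {w})"
  unfolding idx_def by (auto elim!: quotientE)

lemma mv_at: assumes "w \<in> lists E" "e \<in> E" shows "mv e (t, R `` {w}) = (pos e t, R `` {w @ [e]})"
proof -
  have "R `` {v @ [e]} = R `` {w @ [e]}" if "v \<in> R `` {w}" for v
  proof -
    have "(w @ [e], v @ [e]) \<in> R" using that assms(2) by (intro congR) auto
    then show ?thesis using class_eq dom by blast
  qed
  moreover have "w \<in> R `` {w}" using refl[OF assms(1)] by simp
  ultimately have "(\<Union>v\<in>R `` {w}. R `` {v @ [e]}) = R `` {w @ [e]}" by blast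
  then show ?thesis by (simp add: mv_def)
qed

lemma eset_idx: "eset E idx mv"
  unfolding eset_def
proof (intro conjI ballI)
  show "finite idx" using fin_cl es_pos by (simp add: idx_def eset_def)
  fix e p assume e: "e \<in> E" and "p \<in> idx"
  then obtain t w where p: "t \<in> V" "w \<in> lists E" "p = (t, R `` {w})" using idx_at by blast
  have we: "w @ [e] \<in> lists E" using p(2) e by simp
  show "mv e p \<in> idx" using p mv_at[OF p(2) e] at_idx[OF esetD(1)[OF es_pos e p(1)] we] by simp
  have "(w @ [e, e], w @ []) \<in> R" using p(2) e by (intro congL invol)
  then have "R `` {(w @ [e]) @ [e]} = R `` {w}" using class_eq[of "w @ [e, e]" w] p(2) e by simp
  then show "mv e (mv e p) = p" using p mv_at[OF p(2) e] mv_at[OF we e] esetD(2)[OF es_pos e p(1)] by simp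
qed

sublocale I: inc_eset E idx mv inci
proof
  fix e p assume "e \<in> E" "p \<in> idx" "inc e (fst p)"
  then show "inc e (fst (mv e p))" using inc_pos[of e "fst p"] by (simp add: idx_def mv_def mem_Times_iff)
qed (rule finE eset_idx)+

lemma fst_fold: "fst (fold mv u p) = fold pos u (fst p)"
  by (induction u arbitrary: p) (auto simp: mv_def)

lemma fold_at: "u \<in> lists E \<Longrightarrow> w \<in> lists E \<Longrightarrow> fold mv u (t, R `` {w}) = (fold pos u t, R `` {w @ u})"
proof (induction u arbitrary: t w rule: list.induct)
  case (Cons e u)
  then show ?case using Cons.IH[of "w @ [e]" "pos e t"] mv_at[of w e t] by simp
qed simp

lemma cwalk_idx: "cwalk inci mv p u \<longleftrightarrow> cwalk inc pos (fst p) u"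
  by (induction u arbitrary: p) (auto simp: mv_def)

lemma fold_eq: assumes "p \<in> idx" "u \<in> lists E" "v \<in> lists E"
  shows "fold mv u p = fold mv v p \<longleftrightarrow> (u, v) \<in> R"
proof -
  obtain t w where p: "t \<in> V" "w \<in> lists E" "p = (t, R `` {w})" using idx_at[OF assms(1)] by blast
  have "R `` {w @ u} = R `` {w @ v} \<longleftrightarrow> (u, v) \<in> R"
    using class_eq[of "w @ u" "w @ v"] cancelL[of w u v] p(2) assms by simp
  then show ?thesis using p fold_at assms pos_R[of u v t] by auto
qed

lemma adj_idxE:
  assumes "I.adj \<gamma> x y" obtains u where "u \<in> lists \<gamma>" "u \<in> lists E" "y = fold mv u x" "x \<in> idx" "y \<in> idx" "\<gamma> \<subseteq> E"
proof -
  obtain u where u: "u \<in> lists \<gamma>" "y = fold mv u x" using I.adj_word[OF assms] by blast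
  moreover have "x \<in> idx \<and> y \<in> idx \<and> \<gamma> \<subseteq> E" using I.adj_in[OF assms] .
  ultimately show ?thesis using that[of u] lists_subD[of u \<gamma> E] by blast
qed

lemma lk_idxE:
  assumes "I.lk \<gamma> x y" obtains u where "u \<in> lists \<gamma>" "u \<in> lists E" "cwalk inc pos (fst x) u" "y = fold mv u x"
proof -
  obtain u where u: "\<gamma> \<subseteq> E" "u \<in> lists \<gamma>" "cwalk inci mv x u" "y = fold mv u x" using assms by (auto simp: I.lk_def)
  then show ?thesis using that[of u] lists_subD[of u \<gamma> E] cwalk_idx by blast
qed

lemma lk_idxI: "x \<in> idx \<Longrightarrow> \<gamma> \<subseteq> E \<Longrightarrow> u \<in> lists \<gamma> \<Longrightarrow> cwalk inc pos (fst x) u \<Longrightarrow> y = fold mv u x \<Longrightarrow> I.lk \<gamma> x y"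
  using cwalk_idx by (auto simp: I.lk_def)

lemma lk_mv: assumes "x \<in> idx" "\<gamma> \<subseteq> E" "e \<in> \<gamma>" "inc e (fst x)" shows "I.lk \<gamma> (mv e x) x"
proof -
  have "I.lk \<gamma> x (mv e x)" using assms lk_idxI[of x \<gamma> "[e]"] by simp
  then show ?thesis by (rule I.lk_sym)
qed

lemma class_cancel: assumes "w \<in> lists E" "v \<in> lists E" shows "R `` {(w @ rev v) @ v} = R `` {w}"
proof -
  have "((w @ rev v) @ v, w) \<in> R" using congL[OF rev_left[OF assms(2)] assms(1)] by simp
  then show ?thesis using class_eq dom by metis
qed

end

locale acyclic_index = word_index E R V pos inc for E :: "'e set" and R V pos inc +
  fixes N :: nat
  assumes meet_R: "\<alpha> \<subseteq> E \<Longrightarrow> \<beta> \<subseteq> E \<Longrightarrow> u \<in> lists \<alpha> \<Longrightarrow> v \<in> lists \<beta> \<Longrightarrow> (u, v) \<in> R \<Longrightarrow> \<exists>d\<in>lists (\<alpha> \<inter> \<beta>). (u, d) \<in> R"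
    and acyc_R: "3 \<le> n \<Longrightarrow> n \<le> N \<Longrightarrow> (\<And>i. i < n \<Longrightarrow> al i \<subseteq> E) \<Longrightarrow> (\<And>i. i < n \<Longrightarrow> w i \<in> lists (al i)) \<Longrightarrow>
      (concat (map w [0..<n]), []) \<in> R \<Longrightarrow>
      \<exists>i a b. 0 < i \<and> Suc i < n \<and> a \<in> lists (al (i - 1) \<inter> al i) \<and> b \<in> lists (al i \<inter> al (Suc i)) \<and> (w i, a @ b) \<in> R"
begin

lemma adj_meet: assumes "I.adj \<alpha> x y" "I.adj \<beta> x y" shows "I.adj (\<alpha> \<inter> \<beta>) x y"
proof -
  obtain u where u: "u \<in> lists \<alpha>" "u \<in> lists E" "y = fold mv u x" "x \<in> idx" "\<alpha> \<subseteq> E" using adj_idxE[OF assms(1)] by metis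
  obtain v where v: "v \<in> lists \<beta>" "v \<in> lists E" "y = fold mv v x" "\<beta> \<subseteq> E" using adj_idxE[OF assms(2)] by metis
  have "(u, v) \<in> R" using fold_eq[OF u(4,2) v(2)] u(3) v(3) by simp
  then obtain d where d: "d \<in> lists (\<alpha> \<inter> \<beta>)" "(u, d) \<in> R" using meet_R[OF u(5) v(4) u(1) v(1)] by blast
  have "y = fold mv d x" using fold_eq[OF u(4,2) dom(2)[OF d(2)]] d(2) u(3) by simp
  moreover have "\<alpha> \<inter> \<beta> \<subseteq> E" using u(5) by blast
  ultimately show ?thesis using I.adj_fold[OF u(4) _ d(1)] by simp
qed

text \<open>The words between consecutive points of a cycle have trivial product. Where one of them
  splits as \<open>a @ b\<close>, the point reached after \<open>a\<close> is the \<open>m\<close>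
  sought.\<close>

lemma adj_cycle:
  assumes n: "3 \<le> n" "n \<le> N" and adj: "\<And>i. i < n \<Longrightarrow> I.adj (al i) (x i) (x (Suc i))" and cl: "x n = x 0"
  obtains i m where "0 < i" "Suc i < n" "I.adj (al (i - 1)) (x i) m" "I.adj (al i) (x i) m" "I.adj (al (Suc i)) (x (Suc i)) m"
proof -
  have "\<forall>i. \<exists>u. i < n \<longrightarrow> u \<in> lists (al i) \<and> u \<in> lists E \<and> x (Suc i) = fold mv u (x i) \<and> x i \<in> idx \<and> al i \<subseteq> E"
    using adj_idxE[OF adj] by metis
  then obtain w where w: "\<And>i. i < n \<Longrightarrow> w i \<in> lists (al i)" "\<And>i. i < n \<Longrightarrow> w i \<in> lists E"
    "\<And>i. i < n \<Longrightarrow> x (Suc i) = fold mv (w i) (x i)" "\<And>i. i < n \<Longrightarrow> x i \<in> idx" "\<And>i. i < n \<Longrightarrow> al i \<subseteq> E" by metis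
  have c: "k \<le> n \<Longrightarrow> concat (map w [0..<k]) \<in> lists E \<and> fold mv (concat (map w [0..<k])) (x 0) = x k" for k
  proof (induction k)
    case (Suc k)
    then show ?case using w(2,3)[of k] by simp
  qed simp
  have x0: "x 0 \<in> idx" using w(4) n by simp
  have "(concat (map w [0..<n]), []) \<in> R"
    using fold_eq[OF x0, of "concat (map w [0..<n])" "[]"] c[of n] cl by simp
  then obtain i a b where i: "0 < i" "Suc i < n" "a \<in> lists (al (i - 1) \<inter> al i)" "b \<in> lists (al i \<inter> al (Suc i))"
    "(w i, a @ b) \<in> R" using acyc_R[OF n, of al w] w by blast
  have li: "i < n" "i - 1 < n" using i by auto
  have ab: "a \<in> lists (al (i - 1))" "a \<in> lists (al i)" "b \<in> lists (al (Suc i))" using i(3,4) by auto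
  have abE: "a \<in> lists E" "b \<in> lists E" using lists_subD[OF ab(2) w(5)[OF li(1)]] lists_subD[OF ab(3) w(5)[OF i(2)]] .
  define m where "m = fold mv a (x i)"
  have mi: "m \<in> idx" unfolding m_def using eset_fold[OF eset_idx abE(1) w(4)[OF li(1)]] .
  have "x (Suc i) = fold mv b m"
    using fold_eq[OF w(4)[OF li(1)] w(2)[OF li(1)], of "a @ b"] i(5) w(3)[OF li(1)] abE by (simp add: m_def)
  then have "I.adj (al (Suc i)) (x (Suc i)) m" using I.adj_sym[OF I.adj_fold[OF mi w(5)[OF i(2)] ab(3)]] by simp
  moreover have "I.adj (al (i - 1)) (x i) m" unfolding m_def using I.adj_fold[OF w(4)[OF li(1)] w(5)[OF li(2)] ab(1)] .
  moreover have "I.adj (al i) (x i) m" unfolding m_def using I.adj_fold[OF w(4)[OF li(1)] w(5)[OF li(1)] ab(2)] .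
  ultimately show ?thesis using that i(1,2) by blast
qed

lemma adj_triangle:
  assumes "3 \<le> N" "I.adj \<alpha> x y" "I.adj \<beta> y z" "I.adj \<gamma> z x" shows "\<exists>m. I.adj \<alpha> y m \<and> I.adj \<beta> y m \<and> I.adj \<gamma> z m"
proof -
  have a: "I.adj ([\<alpha>, \<beta>, \<gamma>] ! i) ([x, y, z, x] ! i) ([x, y, z, x] ! Suc i)" if "i < 3" for i
    using that assms by (auto simp: less_Suc_eq numeral_3_eq_3)
  obtain i m where i: "0 < i" "Suc i < 3" "I.adj ([\<alpha>, \<beta>, \<gamma>] ! (i - 1)) ([x, y, z, x] ! i) m"
      "I.adj ([\<alpha>, \<beta>, \<gamma>] ! i) ([x, y, z, x] ! i) m" "I.adj ([\<alpha>, \<beta>, \<gamma>] ! Suc i) ([x, y, z, x] ! Suc i) m"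
    by (rule adj_cycle[of 3 "\<lambda>i. [\<alpha>, \<beta>, \<gamma>] ! i" "\<lambda>i. [x, y, z, x] ! i"]) (use a assms(1) in auto)
  then have "i = 1" by simp
  then show ?thesis using i by (intro exI[of _ m]) simp
qed

lemma adj_square:
  assumes "4 \<le> N" "I.adj \<alpha> x1 x2" "I.adj \<beta> x2 x3" "I.adj \<gamma> x3 x4" "I.adj \<delta> x4 x1"
  shows "(\<exists>m. I.adj \<alpha> x2 m \<and> I.adj \<gamma> x3 m) \<or> (\<exists>m. I.adj \<beta> x3 m \<and> I.adj \<delta> x4 m)"
proof -
  have a: "I.adj ([\<alpha>, \<beta>, \<gamma>, \<delta>] ! i) ([x1, x2, x3, x4, x1] ! i) ([x1, x2, x3, x4, x1] ! Suc i)" if "i < 4" for i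
    using that assms by (auto simp: less_Suc_eq eval_nat_numeral)
  obtain i m where i: "0 < i" "Suc i < 4" "I.adj ([\<alpha>, \<beta>, \<gamma>, \<delta>] ! (i - 1)) ([x1, x2, x3, x4, x1] ! i) m"
      "I.adj ([\<alpha>, \<beta>, \<gamma>, \<delta>] ! i) ([x1, x2, x3, x4, x1] ! i) m"
      "I.adj ([\<alpha>, \<beta>, \<gamma>, \<delta>] ! Suc i) ([x1, x2, x3, x4, x1] ! Suc i) m"
    by (rule adj_cycle[of 4 "\<lambda>i. [\<alpha>, \<beta>, \<gamma>, \<delta>] ! i" "\<lambda>i. [x1, x2, x3, x4, x1] ! i"]) (use a assms(1) in auto)
  then consider "i = 1" | "i = 2" by linarith
  then show ?thesis
  proof cases
    case 1
    then have "I.adj \<alpha> x2 m" "I.adj \<gamma> x3 m" using i by simp_all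
    then show ?thesis by blast
  next
    case 2
    then have "I.adj \<beta> x3 m" "I.adj \<delta> x4 m" using i by (simp_all add: eval_nat_numeral)
    then show ?thesis by blast
  qed
qed

end

text \<open>By \<open>card V \<le> M\<close> the positions form a test set with small orbits, so a
  group element determines how a position moves.\<close>

lemma pos_rel1:
  assumes "finite E" "eset E V pos" "card V \<le> M" "(u, v) \<in> rel1 M (grel M) E" "t \<in> V"
  shows "fold pos u t = fold pos v t"
proof (rule rel1_act[OF assms(1,2) _ _ assms(4,5)])
  show "card V \<le> size1 M (grel M) E" using assms(3) by (rule size1_ge)
  fix \<gamma> x assume g: "\<gamma> \<subset> E" "x \<in> V"
  have "orbit \<gamma> pos x \<subseteq> V" using orbit_sub[OF assms(2)] g by blast
  then have "card (orbit \<gamma> pos x) \<le> card V" using assms(2) by (intro card_mono) (auto simp: eset_def)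
  then have "card (orbit \<gamma> pos x) \<le> M" using assms(3) by simp
  then have "card (orbit \<gamma> pos x) \<le> size1 M (grel M) \<gamma>" by (rule size1_ge)
  then show "(\<exists>y\<in>orbit \<gamma> pos x. resp (grel M \<gamma>) pos y) \<or> card (orbit \<gamma> pos x) \<le> size1 M (grel M) \<gamma>" ..
qed

text \<open>The bound 4 makes triangles and squares of cosets available; these are the cycles that
  \<open>chamber_system\<close> consumes.\<close>

locale position_system =
  fixes E :: "'e set" and V :: "'v set" and pos :: "'e \<Rightarrow> 'v \<Rightarrow> 'v" and inc :: "'e \<Rightarrow> 'v \<Rightarrow> bool" and M :: nat
  assumes finE: "finite E" and es_pos: "eset E V pos" and cardV: "card V \<le> M" and M4: "4 \<le> M"
    and inc_pos: "e \<in> E \<Longrightarrow> t \<in> V \<Longrightarrow> inc e t \<Longrightarrow> inc e (pos e t)"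
begin

lemma M0: "0 < M" using M4 by simp

sublocale A: acyclic_index E "rel1 M (grel M) E" V pos inc M
proof (intro acyclic_index.intro word_index.intro rel1_word_group word_index_axioms.intro acyclic_index_axioms.intro)
  show "finite E" "eset E V pos" by (rule finE es_pos)+
  show "finite (lists E // rel1 M (grel M) E)" by (rule finite_rel1[OF finE])
  show "fold pos u t = fold pos v t" if "(u, v) \<in> rel1 M (grel M) E" "t \<in> V" for u v t
    using pos_rel1[OF finE es_pos cardV that] .
  show "inc e (pos e t)" if "e \<in> E" "t \<in> V" "inc e t" for e t using that by (rule inc_pos)
  show "\<exists>d\<in>lists (\<alpha> \<inter> \<beta>). (u, d) \<in> rel1 M (grel M) E"
    if "\<alpha> \<subseteq> E" "\<beta> \<subseteq> E" "u \<in> lists \<alpha>" "v \<in> lists \<beta>" "(u, v) \<in> rel1 M (grel M) E" for \<alpha> \<beta> u v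
    using rel1_meet[OF finE M0 that] .
  show "\<exists>i a b. 0 < i \<and> Suc i < n \<and> a \<in> lists (al (i - 1) \<inter> al i) \<and> b \<in> lists (al i \<inter> al (Suc i)) \<and>
      (w i, a @ b) \<in> rel1 M (grel M) E"
    if "3 \<le> n" "n \<le> M" "\<And>i. i < n \<Longrightarrow> al i \<subseteq> E" "\<And>i. i < n \<Longrightarrow> w i \<in> lists (al i)"
      "(concat (map w [0..<n]), []) \<in> rel1 M (grel M) E" for n al w
    using rel1_acyclic[OF finE that] by metis
qed

sublocale G: word_index E "grel M E" V pos inc
proof (intro word_index.intro grel_word_group word_index_axioms.intro)
  show "finite (lists E // grel M E)" by (rule finite_grel[OF finE])
  show "fold pos u t = fold pos v t" if "(u, v) \<in> grel M E" "t \<in> V" for u v t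
    using pos_rel1[OF finE es_pos cardV _ that(2)] grel_rel1[OF finE, of M] that(1) by blast
  show "finite E" "eset E V pos" by (rule finE es_pos)+
  show "inc e (pos e t)" if "e \<in> E" "t \<in> V" "inc e t" for e t using that by (rule inc_pos)
qed

end

lemma position_system_mono: "position_system E V pos inc M \<Longrightarrow> \<mu> \<subseteq> E \<Longrightarrow> position_system \<mu> V pos inc M"
proof
  assume p: "position_system E V pos inc M" and s: "\<mu> \<subseteq> E"
  interpret position_system E V pos inc M by fact
  show "finite \<mu>" by (rule finite_subset[OF s finE])
  show "eset \<mu> V pos" by (rule eset_mono[OF es_pos s])
  show "card V \<le> M" "4 \<le> M" by (rule cardV M4)+
  show "inc e (pos e t)" if "e \<in> \<mu>" "t \<in> V" "inc e t" for e t using inc_pos[of e t] that s by blast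
qed

context position_system
begin

text \<open>On words over a proper subset, \<open>rel1\<close> and \<open>grel\<close> agree. This
  brings equations that are found in the coarse index back to \<open>grel M E\<close>.\<close>

lemma grel_A: "p \<in> A.idx \<Longrightarrow> \<gamma> \<subset> E \<Longrightarrow> u \<in> lists \<gamma> \<Longrightarrow> v \<in> lists \<gamma> \<Longrightarrow> fold A.mv u p = fold A.mv v p \<Longrightarrow>
    (u, v) \<in> grel M \<gamma> \<and> (u, v) \<in> grel M E"
proof -
  assume a: "p \<in> A.idx" "\<gamma> \<subset> E" "u \<in> lists \<gamma>" "v \<in> lists \<gamma>" "fold A.mv u p = fold A.mv v p"
  have gE: "\<gamma> \<subseteq> E" using a(2) by blast
  have "(u, v) \<in> rel1 M (grel M) E"
    using A.fold_eq[OF a(1)] lists_subD[OF a(3) gE] lists_subD[OF a(4) gE] a(5) by blast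
  then have "(u, v) \<in> grel M \<gamma>" by (rule rel1_restrict[OF finE M0 a(2-4)])
  then show ?thesis using grel_mono[OF finE gE, of M] by blast
qed

lemma decompose_step:
  assumes IH: "\<And>\<mu> t w z1 z2 z3 d1 d2 d3. \<mu> \<subset> E \<Longrightarrow> t \<in> V \<Longrightarrow> w \<in> lists \<mu> \<Longrightarrow> cwalk inc pos t w \<Longrightarrow>
      z1 \<in> lists d1 \<Longrightarrow> z2 \<in> lists d2 \<Longrightarrow> z3 \<in> lists d3 \<Longrightarrow> d1 \<subseteq> \<mu> \<Longrightarrow> d2 \<subseteq> \<mu> \<Longrightarrow> d3 \<subseteq> \<mu> \<Longrightarrow>
      (w, z1 @ z2 @ z3) \<in> grel M \<mu> \<Longrightarrow>
      \<exists>u1\<in>lists d1. \<exists>u2\<in>lists d2. \<exists>u3\<in>lists d3. cwalk inc pos t (u1 @ u2 @ u3) \<and> (w, u1 @ u2 @ u3) \<in> grel M \<mu>"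
    and single: "\<And>e. e \<in> E \<Longrightarrow> {e} \<noteq> E"
    and t: "t \<in> V" and w: "w \<in> lists E" "cwalk inc pos t w"
    and z: "z1 \<in> lists d1" "z2 \<in> lists d2" "z3 \<in> lists d3" and d: "d1 \<subset> E" "d2 \<subset> E" "d3 \<subset> E"
    and eq: "(w, z1 @ z2 @ z3) \<in> grel M E"
  shows "\<exists>u1\<in>lists d1. \<exists>u2\<in>lists d2. \<exists>u3\<in>lists d3. cwalk inc pos t (u1 @ u2 @ u3) \<and> (w, u1 @ u2 @ u3) \<in> grel M E"
proof -
  interpret C: chamber_system E A.idx A.mv "\<lambda>e p. inc e (fst p)" M
  proof
    show "0 < M" by (rule M0)
    show "resp (grel M \<gamma>) A.mv x" if "\<gamma> \<subset> E" "x \<in> A.idx" for \<gamma> x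
    proof -
      have "fold A.mv u x = fold A.mv v x" if "(u, v) \<in> grel M \<gamma>" for u v
      proof -
        have "(u, v) \<in> rel1 M (grel M) E" using grel_proper_rel1[OF \<open>\<gamma> \<subset> E\<close>, of M] that by blast
        then show ?thesis using A.fold_eq[OF \<open>x \<in> A.idx\<close>, of u v] A.dom by blast
      qed
      then show ?thesis by (auto simp: resp_def)
    qed
    show "A.I.adj (\<alpha> \<inter> \<beta>) x y" if "A.I.adj \<alpha> x y" "A.I.adj \<beta> x y" for \<alpha> \<beta> x y
      using that by (rule A.adj_meet)
    show "\<exists>m. A.I.adj \<alpha> y m \<and> A.I.adj \<beta> y m \<and> A.I.adj \<gamma> z m"
      if "A.I.adj \<alpha> x y" "A.I.adj \<beta> y z" "A.I.adj \<gamma> z x" for \<alpha> \<beta> \<gamma> x y z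
      using A.adj_triangle[OF _ that] M4 by simp
    show "(\<exists>m. A.I.adj \<alpha> x2 m \<and> A.I.adj \<gamma> x3 m) \<or> (\<exists>m. A.I.adj \<beta> x3 m \<and> A.I.adj \<delta> x4 m)"
      if "A.I.adj \<alpha> x1 x2" "A.I.adj \<beta> x2 x3" "A.I.adj \<gamma> x3 x4" "A.I.adj \<delta> x4 x1" for \<alpha> \<beta> \<gamma> \<delta> x1 x2 x3 x4
      using A.adj_square[OF M4 that] .
    show "\<exists>k1 k2. A.I.lk d1 x k1 \<and> A.I.lk d2 k1 k2 \<and> A.I.lk d3 k2 y"
      if h: "\<mu> \<subset> E" "A.I.lk \<mu> x y" "A.I.adj d1 x a" "A.I.adj d2 a b" "A.I.adj d3 b y" "d1 \<subseteq> \<mu>" "d2 \<subseteq> \<mu>" "d3 \<subseteq> \<mu>"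
      for \<mu> x y d1 d2 d3 a b
    proof -
      obtain u where u: "u \<in> lists \<mu>" "cwalk inc pos (fst x) u" "y = fold A.mv u x" using A.lk_idxE[OF h(2)] by metis
      have x: "x \<in> A.idx" using A.I.lk_in[OF h(2)] by blast
      obtain z1 where z1: "z1 \<in> lists d1" "a = fold A.mv z1 x" "d1 \<subseteq> E" using A.adj_idxE[OF h(3)] by metis
      obtain z2 where z2: "z2 \<in> lists d2" "b = fold A.mv z2 a" "d2 \<subseteq> E" using A.adj_idxE[OF h(4)] by metis
      obtain z3 where z3: "z3 \<in> lists d3" "y = fold A.mv z3 b" "d3 \<subseteq> E" using A.adj_idxE[OF h(5)] by metis
      have zm: "z1 @ z2 @ z3 \<in> lists \<mu>"
        using lists_subD[OF z1(1) h(6)] lists_subD[OF z2(1) h(7)] lists_subD[OF z3(1) h(8)] by simp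
      have "(u, z1 @ z2 @ z3) \<in> grel M \<mu>"
        using grel_A[OF x h(1) u(1) zm] u(3) z1(2) z2(2) z3(2) by simp
      moreover have "fst x \<in> V" using x by (auto simp: A.idx_def)
      ultimately obtain u1 u2 u3 where uu: "u1 \<in> lists d1" "u2 \<in> lists d2" "u3 \<in> lists d3"
          "cwalk inc pos (fst x) (u1 @ u2 @ u3)" "(u, u1 @ u2 @ u3) \<in> grel M \<mu>"
        using IH[OF h(1) _ u(1,2) z1(1) z2(1) z3(1) h(6-8)] by blast
      have e: "(u, u1 @ u2 @ u3) \<in> rel1 M (grel M) E" using grel_proper_rel1[OF h(1), of M] uu(5) by blast
      define k1 where "k1 = fold A.mv u1 x"
      define k2 where "k2 = fold A.mv u2 k1"
      have c: "cwalk inc pos (fst x) u1" "cwalk inc pos (fst k1) u2" "cwalk inc pos (fst k2) u3"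
        using uu(4) by (simp_all add: cwalk_append A.fst_fold k1_def k2_def)
      have y: "y = fold A.mv u3 k2" using A.fold_eq[OF x, of u "u1 @ u2 @ u3"] e A.dom[OF e] u(3) by (simp add: k1_def k2_def)
      have l1: "A.I.lk d1 x k1" using A.lk_idxI[OF x z1(3) uu(1) c(1)] by (simp add: k1_def)
      have k1: "k1 \<in> A.idx" using A.I.lk_in[OF l1] by blast
      have l2: "A.I.lk d2 k1 k2" using A.lk_idxI[OF k1 z2(3) uu(2) c(2)] by (simp add: k2_def)
      have k2: "k2 \<in> A.idx" using A.I.lk_in[OF l2] by blast
      have l3: "A.I.lk d3 k2 y" using A.lk_idxI[OF k2 z3(3) uu(3) c(3) y] .
      show ?thesis using l1 l2 l3 by blast
    qed
  qed
  define x where "x = (t, rel1 M (grel M) E `` {[]})"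
  have x: "x \<in> A.idx" unfolding x_def using A.at_idx[OF t] by simp
  have fx: "fst x = t" by (simp add: x_def)
  \<comment> \<open>The index has one copy of the \<open>rel1\<close> group for each of at most
    \<open>M\<close> positions, and \<open>size2\<close> leaves room for the square of this
    number.\<close>
  have card: "(card A.idx)\<^sup>2 \<le> size2 M (grel M) E"
  proof -
    have "card A.idx = card V * nclasses E (rel1 M (grel M) E)"
      by (simp add: A.idx_def card_cartesian_product nclasses_def)
    also have "\<dots> \<le> M * nclasses E (rel1 M (grel M) E)" using cardV by simp
    finally have le: "card A.idx \<le> M * nclasses E (rel1 M (grel M) E)" .
    show ?thesis unfolding size2_def by (rule trans_le_add2[OF power_mono[OF le]]) simp
  qed
  have nx: "C.near x x" using C.adj_near[OF A.I.adj_refl[OF x, of "{}"]] d(1) by blast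
  have eqX: "fold C.A.act w (C.st x x) = fold C.A.act (z1 @ z2 @ z3) (C.st x x)"
    using C.grel_act_pts[OF card eq C.st_pts[OF nx]] .
  have eqr: "(w, z1 @ z2 @ z3) \<in> rel1 M (grel M) E" using grel_rel1[OF finE, of M] eq by blast
  have eqH: "fold A.mv w x = fold A.mv (z1 @ z2 @ z3) x"
    using A.fold_eq[OF x, of w "z1 @ z2 @ z3"] eqr A.dom[OF eqr] by blast
  define y where "y = fold A.mv w x"
  define a where "a = fold A.mv z1 x"
  define b where "b = fold A.mv z2 a"
  have yb: "y = fold A.mv z3 b" using eqH by (simp add: y_def a_def b_def)
  have cw: "cwalk (\<lambda>e p. inc e (fst p)) A.mv x w" using w(2) A.cwalk_idx[of x w] fx by simp
  have dE: "d1 \<subseteq> E" "d2 \<subseteq> E" "d3 \<subseteq> E" using d by auto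
  have zE: "z1 \<in> lists E" "z2 \<in> lists E" "z3 \<in> lists E"
    using lists_subD[OF z(1) dE(1)] lists_subD[OF z(2) dE(2)] lists_subD[OF z(3) dE(3)] .
  have "(\<exists>y1 y2. A.I.lk d1 x y1 \<and> A.I.lk d2 y1 y2 \<and> A.I.lk d3 y2 y \<and> A.I.adj (d1 \<inter> d2) y1 a \<and> A.I.adj (d2 \<inter> d3) y2 b) \<or>
      (\<exists>y0 h0. A.I.lk d1 x y0 \<and> A.I.lk d3 y0 y \<and> A.I.adj (d1 \<inter> d3) y0 h0 \<and> A.I.adj (d1 \<inter> d2) h0 a \<and> A.I.adj (d2 \<inter> d3) h0 b)"
    by (rule C.decompose_geo[OF _ d z x w(1) cw eqH eqX y_def a_def b_def]) (rule single)
  then show ?thesis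
  proof (elim disjE exE conjE)
    fix y1 y2
    assume l: "A.I.lk d1 x y1" "A.I.lk d2 y1 y2" "A.I.lk d3 y2 y" and a12: "A.I.adj (d1 \<inter> d2) y1 a"
      and a23: "A.I.adj (d2 \<inter> d3) y2 b"
    obtain u1 where u1: "u1 \<in> lists d1" "u1 \<in> lists E" "cwalk inc pos (fst x) u1" "y1 = fold A.mv u1 x" using A.lk_idxE[OF l(1)] .
    obtain u2 where u2: "u2 \<in> lists d2" "u2 \<in> lists E" "cwalk inc pos (fst y1) u2" "y2 = fold A.mv u2 y1" using A.lk_idxE[OF l(2)] .
    obtain u3 where u3: "u3 \<in> lists d3" "u3 \<in> lists E" "cwalk inc pos (fst y2) u3" "y = fold A.mv u3 y2" using A.lk_idxE[OF l(3)] .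
    obtain g1 where g1: "g1 \<in> lists (d1 \<inter> d2)" "g1 \<in> lists E" "a = fold A.mv g1 y1" using A.adj_idxE[OF a12] by metis
    obtain g2 where g2: "g2 \<in> lists (d2 \<inter> d3)" "g2 \<in> lists E" "b = fold A.mv g2 y2" using A.adj_idxE[OF a23] by metis
    have gl: "g1 \<in> lists d1" "g1 \<in> lists d2" "g2 \<in> lists d2" "g2 \<in> lists d3" using g1(1) g2(1) by auto
    have yi: "y1 \<in> A.idx" "y2 \<in> A.idx" using A.I.lk_in[OF l(2)] by auto
    \<comment> \<open>Each of these three equations involves letters of a single proper set only, so
      \<open>grel_A\<close> applies; chained together they give an equation over
      \<open>E\<close>.\<close>
    have 1: "(z1, u1 @ g1) \<in> grel M E" using grel_A[OF x d(1) z(1), of "u1 @ g1"] u1 g1 gl a_def by simp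
    have 2: "(g1 @ z2, u2 @ g2) \<in> grel M E" using grel_A[OF yi(1) d(2), of "g1 @ z2" "u2 @ g2"] u2 g1 g2 gl z b_def by simp
    have 3: "(g2 @ z3, u3) \<in> grel M E" using grel_A[OF yi(2) d(3), of "g2 @ z3" u3] u3 g2 gl z yb by simp
    have "(z1 @ z2 @ z3, (u1 @ g1) @ z2 @ z3) \<in> grel M E" using G.congR[OF 1, of "z2 @ z3"] zE by simp
    also have "(u1 @ g1) @ z2 @ z3 = u1 @ (g1 @ z2) @ z3" by simp
    finally have 4: "(z1 @ z2 @ z3, u1 @ (g1 @ z2) @ z3) \<in> grel M E" .
    have 5: "(u1 @ (g1 @ z2) @ z3, (u1 @ u2) @ g2 @ z3) \<in> grel M E" using G.cong[OF 2 u1(2) zE(3)] by simp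
    have "((u1 @ u2) @ g2 @ z3, (u1 @ u2) @ u3) \<in> grel M E" using G.congL[OF 3, of "u1 @ u2"] u1(2) u2(2) by simp
    then have "(w, (u1 @ u2) @ u3) \<in> grel M E" by (rule G.trans[OF eq G.trans[OF 4 G.trans[OF 5]]])
    then have "(w, u1 @ u2 @ u3) \<in> grel M E" by simp
    moreover have "cwalk inc pos t (u1 @ u2 @ u3)"
      using u1(3,4) u2(3,4) u3(3) fx by (simp add: cwalk_append A.fst_fold)
    ultimately show ?thesis using u1(1) u2(1) u3(1) by blast
  next
    fix y0 h0
    assume l: "A.I.lk d1 x y0" "A.I.lk d3 y0 y" and a13: "A.I.adj (d1 \<inter> d3) y0 h0"
      and a12: "A.I.adj (d1 \<inter> d2) h0 a" and a23: "A.I.adj (d2 \<inter> d3) h0 b"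
    obtain u1 where u1: "u1 \<in> lists d1" "u1 \<in> lists E" "cwalk inc pos (fst x) u1" "y0 = fold A.mv u1 x" using A.lk_idxE[OF l(1)] .
    obtain u3 where u3: "u3 \<in> lists d3" "u3 \<in> lists E" "cwalk inc pos (fst y0) u3" "y = fold A.mv u3 y0" using A.lk_idxE[OF l(2)] .
    obtain s where s: "s \<in> lists (d1 \<inter> d3)" "s \<in> lists E" "h0 = fold A.mv s y0" "h0 \<in> A.idx" using A.adj_idxE[OF a13] by metis
    obtain g1 where g1: "g1 \<in> lists (d1 \<inter> d2)" "g1 \<in> lists E" "a = fold A.mv g1 h0" using A.adj_idxE[OF a12] by metis
    obtain g2 where g2: "g2 \<in> lists (d2 \<inter> d3)" "g2 \<in> lists E" "b = fold A.mv g2 h0" using A.adj_idxE[OF a23] by metis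
    have gl: "g1 \<in> lists d1" "g1 \<in> lists d2" "g2 \<in> lists d2" "g2 \<in> lists d3" "s \<in> lists d1" "s \<in> lists d3"
      using g1(1) g2(1) s(1) by auto
    have yi: "y0 \<in> A.idx" using A.I.lk_in[OF l(1)] by auto
    have 1: "(z1, u1 @ s @ g1) \<in> grel M E" using grel_A[OF x d(1) z(1), of "u1 @ s @ g1"] u1 g1 s gl a_def by simp
    have 2: "(g1 @ z2, g2) \<in> grel M E" using grel_A[OF s(4) d(2), of "g1 @ z2" g2] g1 g2 gl z b_def by simp
    have 3: "(s @ g2 @ z3, u3) \<in> grel M E" using grel_A[OF yi d(3), of "s @ g2 @ z3" u3] u3 g2 s gl z yb by simp
    have "(z1 @ z2 @ z3, (u1 @ s @ g1) @ z2 @ z3) \<in> grel M E" using G.congR[OF 1, of "z2 @ z3"] zE by simp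
    also have "(u1 @ s @ g1) @ z2 @ z3 = (u1 @ s) @ (g1 @ z2) @ z3" by simp
    finally have 4: "(z1 @ z2 @ z3, (u1 @ s) @ (g1 @ z2) @ z3) \<in> grel M E" .
    have "((u1 @ s) @ (g1 @ z2) @ z3, (u1 @ s) @ g2 @ z3) \<in> grel M E" using G.cong[OF 2, of "u1 @ s" z3] u1(2) s(2) zE(3) by simp
    then have 5: "((u1 @ s) @ (g1 @ z2) @ z3, u1 @ s @ g2 @ z3) \<in> grel M E" by simp
    have "(u1 @ s @ g2 @ z3, u1 @ u3) \<in> grel M E" using G.congL[OF 3 u1(2)] .
    then have "(w, u1 @ u3) \<in> grel M E" by (rule G.trans[OF eq G.trans[OF 4 G.trans[OF 5]]])
    then have "(w, u1 @ [] @ u3) \<in> grel M E" by simp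
    moreover have "cwalk inc pos t (u1 @ [] @ u3)"
      using u1(3,4) u3(3) fx by (simp add: cwalk_append A.fst_fold)
    moreover have "[] \<in> lists d2" by simp
    ultimately show ?thesis using u1(1) u3(1) by blast
  qed
qed

end

text \<open>Induction on \<open>E\<close>. If one of the sets is all of \<open>E\<close>, then
  \<open>w\<close> itself is that piece; if \<open>E\<close> is a singleton and none is, the given
  pieces are empty. In the remaining case the induction hypothesis is the property
  \<open>ex4\<close> of the coarse index.\<close>

lemma composable_decomposition:
  assumes "position_system E V pos inc M" "t \<in> V" "w \<in> lists E" "cwalk inc pos t w"
    and "z1 \<in> lists d1" "z2 \<in> lists d2" "z3 \<in> lists d3" "d1 \<subseteq> E" "d2 \<subseteq> E" "d3 \<subseteq> E"
    and "(w, z1 @ z2 @ z3) \<in> grel M E"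
  shows "\<exists>u1\<in>lists d1. \<exists>u2\<in>lists d2. \<exists>u3\<in>lists d3. cwalk inc pos t (u1 @ u2 @ u3) \<and> (w, u1 @ u2 @ u3) \<in> grel M E"
proof -
  have "finite E" using assms(1) by (simp add: position_system_def)
  then show ?thesis using assms
  proof (induction E arbitrary: t w z1 z2 z3 d1 d2 d3 rule: finite_psubset_induct)
    case (psubset E)
    interpret position_system E V pos inc M by fact
    note w = \<open>w \<in> lists E\<close> \<open>cwalk inc pos t w\<close>
    have ww: "(w, w) \<in> grel M E" using word_group.refl[OF grel_word_group w(1)] .
    consider "d1 = E" | "d2 = E" | "d3 = E" | "d1 \<subset> E" "d2 \<subset> E" "d3 \<subset> E" using psubset.prems by blast
    then show ?case
    proof cases
      case 1
      then show ?thesis using w ww by (intro bexI[of _ w] bexI[of _ "[]"]) auto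
    next
      case 2
      then show ?thesis using w ww by (intro bexI[of _ w] bexI[of _ "[]"]) auto
    next
      case 3
      then show ?thesis using w ww by (intro bexI[of _ w] bexI[of _ "[]"]) auto
    next
      case 4
      show ?thesis
      proof (cases "\<exists>e. E = {e}")
        case True
        then have "d1 = {}" "d2 = {}" "d3 = {}" using 4 by auto
        then have "z1 = []" "z2 = []" "z3 = []" using psubset.prems by auto
        then show ?thesis using psubset.prems by (intro bexI[of _ "[]"]) auto
      next
        case False
        show ?thesis
        proof (rule decompose_step)
          show "{e} \<noteq> E" if "e \<in> E" for e using False by blast
          show "\<exists>u1\<in>lists d1. \<exists>u2\<in>lists d2. \<exists>u3\<in>lists d3. cwalk inc pos t (u1 @ u2 @ u3) \<and> (w, u1 @ u2 @ u3) \<in> grel M \<mu>"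
            if "\<mu> \<subset> E" "t \<in> V" "w \<in> lists \<mu>" "cwalk inc pos t w" "z1 \<in> lists d1" "z2 \<in> lists d2" "z3 \<in> lists d3"
              "d1 \<subseteq> \<mu>" "d2 \<subseteq> \<mu>" "d3 \<subseteq> \<mu>" "(w, z1 @ z2 @ z3) \<in> grel M \<mu>" for \<mu> t w z1 z2 z3 d1 d2 d3
          proof (rule psubset.IH[OF that(1) _ that(2-)])
            show "position_system \<mu> V pos inc M"
              using position_system_mono[OF psubset.prems(1)] that(1) by blast
          qed
        qed (use psubset.prems 4 in simp_all)
      qed
    qed
  qed
qed

text \<open>The group supplies a word over \<open>\<alpha> \<inter> \<beta>\<close>; a factorization
  with two empty pieces makes it composable.\<close>

lemma (in position_system) lk_meet:
  assumes "G.I.lk \<alpha> x y" "G.I.lk \<beta> x y" shows "G.I.lk (\<alpha> \<inter> \<beta>) x y"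
proof -
  obtain u where u: "u \<in> lists \<alpha>" "u \<in> lists E" "cwalk inc pos (fst x) u" "y = fold G.mv u x" using G.lk_idxE[OF assms(1)] .
  obtain v where v: "v \<in> lists \<beta>" "v \<in> lists E" "y = fold G.mv v x" using G.lk_idxE[OF assms(2)] by metis
  have x: "x \<in> G.idx" and ab: "\<alpha> \<subseteq> E" "\<beta> \<subseteq> E" using G.I.lk_in[OF assms(1)] G.I.lk_in[OF assms(2)] by auto
  have "(u, v) \<in> grel M E" using G.fold_eq[OF x u(2) v(2)] u(4) v(3) by simp
  then obtain d where d: "d \<in> lists (\<alpha> \<inter> \<beta>)" "(u, d) \<in> grel M E"
    using grel_meet[OF finE M0 ab u(1) v(1)] by blast
  have t: "fst x \<in> V" using x by (auto simp: G.idx_def)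
  have sub: "\<alpha> \<inter> \<beta> \<subseteq> E" using ab by blast
  have "position_system E V pos inc M" by unfold_locales
  then obtain u1 u2 u3 where uu: "u1 \<in> lists (\<alpha> \<inter> \<beta>)" "u2 \<in> lists {}" "u3 \<in> lists {}"
      "cwalk inc pos (fst x) (u1 @ u2 @ u3)" "(u, u1 @ u2 @ u3) \<in> grel M E"
    using composable_decomposition[of E V pos inc M "fst x" u d "\<alpha> \<inter> \<beta>" "[]" "{}" "[]" "{}"] t u sub d by auto
  then have 1: "cwalk inc pos (fst x) u1" "(u, u1) \<in> grel M E" by auto
  have "y = fold G.mv u1 x" using G.fold_eq[OF x u(2) G.dom(2)[OF 1(2)]] 1(2) u(4) by simp
  then show ?thesis using G.lk_idxI[OF x sub uu(1) 1(1)] by simp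
qed

section \<open>Symmetries of the generators\<close>

text \<open>An action of the renamed letters pulls back along \<open>f\<close>. The slack
  \<open>m' \<le> m\<close> saves an exact comparison of the sizes, because fewer tests only
  identify more words.\<close>

lemma step_map:
  fixes f :: "'e \<Rightarrow> 'e"
  assumes inj: "inj_on f E" and m: "m' \<le> m"
    and fwd: "\<And>\<gamma> u v. \<gamma> \<subset> E \<Longrightarrow> (u, v) \<in> r \<gamma> \<Longrightarrow> (map f u, map f v) \<in> r (f ` \<gamma>)"
    and sub: "\<And>\<gamma>. \<gamma> \<subset> E \<Longrightarrow> r \<gamma> \<subseteq> lists \<gamma> \<times> lists \<gamma>" and uv: "(u, v) \<in> step m r E"
  shows "(map f u, map f v) \<in> step m' r (f ` E)"
proof -
  have uv': "(u, v) \<in> step m' r E" using step_antimono[OF m sub] uv by blast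
  have "fold \<rho> (map f u) x = fold \<rho> (map f v) x"
    if h: "eset (f ` E) {..<m'} \<rho>" "\<forall>\<gamma>. \<gamma> \<subset> f ` E \<longrightarrow> (\<forall>x<m'. resp (r \<gamma>) \<rho> x)" "x < m'"
    for \<rho> :: "'e \<Rightarrow> nat \<Rightarrow> nat" and x
  proof -
    have e: "eset E {..<m'} (\<rho> \<circ> f)" using h(1) by (auto simp: eset_def)
    have "resp (r \<gamma>) (\<rho> \<circ> f) y" if g: "\<gamma> \<subset> E" "y < m'" for \<gamma> y
    proof -
      have "f ` \<gamma> \<subset> f ` E" using g(1) inj by (metis inj_on_image_eq_iff psubset_eq image_mono order_refl)
      then have "resp (r (f ` \<gamma>)) \<rho> y" using h(2) g(2) by blast
      then have "fold \<rho> (map f a) y = fold \<rho> (map f b) y" if "(a, b) \<in> r \<gamma>" for a b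
        using fwd[OF g(1) that] by (auto simp: resp_def)
      then show ?thesis by (auto simp: resp_def fold_map)
    qed
    then have "\<forall>\<gamma>. \<gamma> \<subset> E \<longrightarrow> (\<forall>y<m'. resp (r \<gamma>) (\<rho> \<circ> f) y)" by blast
    then have "fold (\<rho> \<circ> f) u x = fold (\<rho> \<circ> f) v x"
      using uv' e h(3) unfolding step_def by blast
    then show ?thesis by (simp add: fold_map)
  qed
  moreover have "map f u \<in> lists (f ` E)" "map f v \<in> lists (f ` E)"
    using uv' by (auto simp: step_def in_lists_conv_set)
  ultimately show ?thesis by (simp add: step_def)
qed

lemma nclasses_map:
  assumes "word_group \<gamma> R" "word_group (f ` \<gamma>) R'" "finite (lists \<gamma> // R)"
    and fwd: "\<And>u v. (u, v) \<in> R \<Longrightarrow> (map f u, map f v) \<in> R'"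
  shows "nclasses (f ` \<gamma>) R' \<le> nclasses \<gamma> R"
proof -
  have "lists (f ` \<gamma>) // R' = (\<lambda>u. R' `` {map f u}) ` lists \<gamma>"
    by (auto simp: quotient_def lists_image)
  moreover have "card ((\<lambda>u. R' `` {map f u}) ` lists \<gamma>) \<le> nclasses \<gamma> R"
  proof (rule word_group.card_image_classes[OF assms(1,3), THEN conjunct2])
    fix u v assume "(u, v) \<in> R"
    then have "(map f u, map f v) \<in> R'" by (rule fwd)
    then show "R' `` {map f u} = R' `` {map f v}"
      using word_group.class_eq[OF assms(2)] word_group.dom[OF assms(2)] by metis
  qed
  ultimately show ?thesis by (simp add: nclasses_def)
qed

lemma size1_map:
  assumes E: "finite E" and inj: "inj_on f E"
    and fwd: "\<And>\<gamma> u v. \<gamma> \<subset> E \<Longrightarrow> (u, v) \<in> grel M \<gamma> \<Longrightarrow> (map f u, map f v) \<in> grel M (f ` \<gamma>)"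
  shows "size1 M (grel M) (f ` E) \<le> size1 M (grel M) E"
proof -
  have eq: "{\<gamma>. \<gamma> \<subset> f ` E} = image f ` {\<gamma>. \<gamma> \<subset> E}"
  proof (intro subset_antisym subsetI)
    fix \<gamma> assume "\<gamma> \<in> {\<gamma>. \<gamma> \<subset> f ` E}"
    then have g: "\<gamma> \<subset> f ` E" by simp
    then obtain \<delta> where d: "\<delta> \<subseteq> E" "\<gamma> = f ` \<delta>" by (meson psubset_imp_subset subset_imageE)
    then have "\<delta> \<subset> E" using g by blast
    then show "\<gamma> \<in> image f ` {\<gamma>. \<gamma> \<subset> E}" using d(2) by blast
  next
    fix \<gamma> assume "\<gamma> \<in> image f ` {\<gamma>. \<gamma> \<subset> E}"
    then obtain \<delta> where d: "\<delta> \<subset> E" "\<gamma> = f ` \<delta>" by blast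
    then have "f ` \<delta> \<noteq> f ` E" using inj_on_image_eq_iff[OF inj, of \<delta> E] by blast
    then show "\<gamma> \<in> {\<gamma>. \<gamma> \<subset> f ` E}" using d by blast
  qed
  have "inj_on (image f) {\<gamma>. \<gamma> \<subset> E}" using inj_on_image_eq_iff[OF inj] by (auto intro!: inj_onI)
  then have "(\<Sum>\<gamma>\<in>{\<gamma>. \<gamma> \<subset> f ` E}. nclasses \<gamma> (grel M \<gamma>)) = (\<Sum>\<gamma>\<in>{\<gamma>. \<gamma> \<subset> E}. nclasses (f ` \<gamma>) (grel M (f ` \<gamma>)))"
    unfolding eq by (simp add: sum.reindex)
  also have "\<dots> \<le> (\<Sum>\<gamma>\<in>{\<gamma>. \<gamma> \<subset> E}. nclasses \<gamma> (grel M \<gamma>))"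
  proof (rule sum_mono)
    fix \<gamma> assume "\<gamma> \<in> {\<gamma>. \<gamma> \<subset> E}"
    then have g: "\<gamma> \<subset> E" by simp
    show "nclasses (f ` \<gamma>) (grel M (f ` \<gamma>)) \<le> nclasses \<gamma> (grel M \<gamma>)"
      by (rule nclasses_map[OF grel_word_group grel_word_group finite_grel fwd[OF g]])
        (use g E finite_subset in auto)
  qed
  finally show ?thesis unfolding size1_def by (intro mult_left_mono) auto
qed

text \<open>The construction never refers to the identity of letters. Sizes cannot grow under a
  renaming, as classes are mapped onto classes, and by \<open>step_map\<close> this
  suffices.\<close>

lemma
  fixes f :: "'e \<Rightarrow> 'e"
  assumes "finite E" "inj_on f E"
  shows grel_map: "(u, v) \<in> grel M E \<Longrightarrow> (map f u, map f v) \<in> grel M (f ` E)"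
    and rel1_map: "(u, v) \<in> rel1 M (grel M) E \<Longrightarrow> (map f u, map f v) \<in> rel1 M (grel M) (f ` E)"
proof -
  have r1: "(map f u, map f v) \<in> rel1 M (grel M) (f ` E)"
    if "finite E" "inj_on f E" "\<And>\<gamma> u v. \<gamma> \<subset> E \<Longrightarrow> (u, v) \<in> grel M \<gamma> \<Longrightarrow> (map f u, map f v) \<in> grel M (f ` \<gamma>)"
      "(u, v) \<in> rel1 M (grel M) E" for E u v
    using step_map[OF that(2) size1_map[OF that(1-3)] that(3) grel_sub, of u v] that(4)
    unfolding rel1_def by blast
  have g: "(map f u, map f v) \<in> grel M (f ` E)"
    if "finite E" "inj_on f E" "(u, v) \<in> grel M E" for E u v
    using that
  proof (induction E arbitrary: u v rule: finite_psubset_induct)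
    case (psubset E)
    have fwd: "(map f u, map f v) \<in> grel M (f ` \<gamma>)" if "\<gamma> \<subset> E" "(u, v) \<in> grel M \<gamma>" for \<gamma> u v
      using psubset.IH[OF that(1) _ that(2)] psubset.prems(1) that(1) inj_on_subset by blast
    have "nclasses (f ` E) (rel1 M (grel M) (f ` E)) \<le> nclasses E (rel1 M (grel M) E)"
      by (rule nclasses_map[OF rel1_word_group rel1_word_group finite_rel1[OF psubset.hyps(1)]])
        (rule r1[OF psubset.hyps(1) psubset.prems(1) fwd])
    then have "(M * nclasses (f ` E) (rel1 M (grel M) (f ` E)))\<^sup>2 \<le> (M * nclasses E (rel1 M (grel M) E))\<^sup>2"
      by (intro power_mono mult_left_mono) auto
    then have "size2 M (grel M) (f ` E) \<le> size2 M (grel M) E"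
      unfolding size2_def using size1_map[OF psubset.hyps(1) psubset.prems(1) fwd] by (intro add_mono)
    then show ?case
      using step_map[OF psubset.prems(1) _ fwd grel_sub, of _ "size2 M (grel M) E" u v] psubset.prems(2)
        grel_unfold[of E M] grel_unfold[of "f ` E" M] psubset.hyps(1) by simp
  qed
  show "(u, v) \<in> grel M E \<Longrightarrow> (map f u, map f v) \<in> grel M (f ` E)" using g[OF assms] .
  have "(map f u, map f v) \<in> grel M (f ` \<gamma>)" if "\<gamma> \<subset> E" "(u, v) \<in> grel M \<gamma>" for \<gamma> u v
    using g[OF _ _ that(2)] that(1) assms finite_subset inj_on_subset by blast
  then show "(u, v) \<in> rel1 M (grel M) E \<Longrightarrow> (map f u, map f v) \<in> rel1 M (grel M) (f ` E)"
    using r1[OF assms] by blast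
qed

lemma letter_map_iff:
  assumes f: "bij_betw f E E" and fwd: "\<And>f u v. inj_on f E \<Longrightarrow> (u, v) \<in> R E \<Longrightarrow> (map f u, map f v) \<in> R (f ` E)"
    and uv: "u \<in> lists E" "v \<in> lists E"
  shows "(map f u, map f v) \<in> R E \<longleftrightarrow> (u, v) \<in> R E"
proof
  have fE: "f ` E = E" "inj_on f E" using f by (auto simp: bij_betw_def)
  show "(map f u, map f v) \<in> R E" if "(u, v) \<in> R E" using fwd[OF fE(2) that] fE(1) by simp
  assume a: "(map f u, map f v) \<in> R E"
  have g: "bij_betw (inv_into E f) E E" using f by (rule bij_betw_inv_into)
  have "map (inv_into E f) (map f w) = w" if "w \<in> lists E" for w
    using that fE(2) by (induction w) auto
  then show "(u, v) \<in> R E" using fwd[of "inv_into E f" "map f u" "map f v"] a g uv by (simp add: bij_betw_def)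
qed

locale index_symmetry = word_index +
  fixes g :: "'a \<Rightarrow> 'a" and fV :: "'b \<Rightarrow> 'b" and z :: "'a list"
  assumes g: "bij_betw g E E" and g_iff: "u \<in> lists E \<Longrightarrow> v \<in> lists E \<Longrightarrow> (map g u, map g v) \<in> R \<longleftrightarrow> (u, v) \<in> R"
    and fV: "bij_betw fV V V" and g_pos: "e \<in> E \<Longrightarrow> t \<in> V \<Longrightarrow> pos (g e) (fV t) = fV (pos e t)"
    and g_inc: "e \<in> E \<Longrightarrow> t \<in> V \<Longrightarrow> inc (g e) (fV t) \<longleftrightarrow> inc e t" and z: "z \<in> lists E"
begin

text \<open>A renaming of letters followed by left multiplication with \<open>z\<close>. Left
  multiplication commutes with the action of the letters, and the choice of \<open>z\<close> makes
  the symmetries transitive on group elements.\<close>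

definition sy :: "'b \<times> 'a list set \<Rightarrow> 'b \<times> 'a list set" where
  "sy p = (fV (fst p), \<Union>w\<in>snd p. R `` {z @ map g w})"

lemma map_lists: "w \<in> lists E \<Longrightarrow> map g w \<in> lists E"
  using g by (auto simp: bij_betw_def in_lists_conv_set)

lemma gE: "e \<in> E \<Longrightarrow> g e \<in> E" using g by (auto simp: bij_betw_def)

lemma zg_iff: "u \<in> lists E \<Longrightarrow> v \<in> lists E \<Longrightarrow> R `` {z @ map g u} = R `` {z @ map g v} \<longleftrightarrow> (u, v) \<in> R"
  using class_eq[of "z @ map g u" "z @ map g v"] cancelL[OF z] g_iff map_lists z by simp

lemma sy_at: assumes "w \<in> lists E" shows "sy (t, R `` {w}) = (fV t, R `` {z @ map g w})"
proof -
  have "R `` {z @ map g v} = R `` {z @ map g w}" if "v \<in> R `` {w}" for v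
    using zg_iff[of v w] that dom[of w v] sym[of w v] by simp
  moreover have "w \<in> R `` {w}" using refl[OF assms] by simp
  ultimately have "(\<Union>v\<in>R `` {w}. R `` {z @ map g v}) = R `` {z @ map g w}" by blast
  then show ?thesis by (simp add: sy_def)
qed

lemma sy_bij: "bij_betw sy idx idx"
proof -
  have i: "sy p \<in> idx" if pi: "p \<in> idx" for p
  proof -
    obtain t w where p: "t \<in> V" "w \<in> lists E" "p = (t, R `` {w})" using idx_at[OF pi] by blast
    have "fV t \<in> V" using fV p(1) by (auto simp: bij_betw_def)
    moreover have "z @ map g w \<in> lists E" using z map_lists[OF p(2)] by simp
    ultimately show ?thesis using sy_at[OF p(2)] p(3) at_idx by metis
  qed
  have "inj_on sy idx"
  proof (rule inj_onI)
    fix p q assume a: "p \<in> idx" "q \<in> idx" "sy p = sy q"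
    obtain t w where p: "t \<in> V" "w \<in> lists E" "p = (t, R `` {w})" using idx_at[OF a(1)] by blast
    obtain t' w' where q: "t' \<in> V" "w' \<in> lists E" "q = (t', R `` {w'})" using idx_at[OF a(2)] by blast
    have "fV t = fV t'" "(w, w') \<in> R" using a(3) sy_at p q zg_iff[OF p(2) q(2)] by auto
    then have "t = t'" using fV p(1) q(1) by (auto simp: bij_betw_def dest: inj_onD)
    then show "p = q" using p q class_eq \<open>(w, w') \<in> R\<close> by simp
  qed
  moreover have "finite idx" using eset_idx by (simp add: eset_def)
  moreover have "sy ` idx \<subseteq> idx" using i by blast
  ultimately show ?thesis using endo_inj_surj[of idx sy] by (simp add: bij_betw_def)
qed

lemma sy_mv: assumes "e \<in> E" "p \<in> idx" shows "mv (g e) (sy p) = sy (mv e p)"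
proof -
  obtain t w where p: "t \<in> V" "w \<in> lists E" "p = (t, R `` {w})" using idx_at[OF assms(2)] by blast
  have "z @ map g w \<in> lists E" "w @ [e] \<in> lists E" using z map_lists[OF p(2)] p(2) assms(1) by auto
  then show ?thesis using p sy_at mv_at gE[OF assms(1)] assms(1) g_pos[OF assms(1) p(1)] by simp
qed

lemma sy_fold: "u \<in> lists E \<Longrightarrow> p \<in> idx \<Longrightarrow> fold mv (map g u) (sy p) = sy (fold mv u p) \<and>
    (cwalk inc pos (fst (sy p)) (map g u) \<longleftrightarrow> cwalk inc pos (fst p) u)"
proof (induction u arbitrary: p rule: list.induct)
  case (Cons e u)
  have e: "e \<in> E" "u \<in> lists E" "mv e p \<in> idx" using Cons.prems esetD(1)[OF eset_idx] by auto
  have t: "fst p \<in> V" using Cons.prems(2) by (auto simp: idx_def)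
  have f: "fst (sy p) = fV (fst p)" "fst (mv e p) = pos e (fst p)" "fst (sy (mv e p)) = fV (pos e (fst p))"
    by (simp_all add: sy_def mv_def)
  show ?case using Cons.IH[OF e(2,3)] sy_mv[OF e(1) Cons.prems(2)] g_inc[OF e(1) t] g_pos[OF e(1) t] f by simp
qed simp

lemma sy_lk: assumes "x \<in> idx" "y \<in> idx" "\<gamma> \<subseteq> E" shows "I.lk (g ` \<gamma>) (sy x) (sy y) \<longleftrightarrow> I.lk \<gamma> x y"
proof
  have sub: "g ` \<gamma> \<subseteq> E" using assms(3) gE by blast
  have s: "sy x \<in> idx" using sy_bij assms(1) by (auto simp: bij_betw_def)
  show "I.lk (g ` \<gamma>) (sy x) (sy y)" if xy: "I.lk \<gamma> x y"
  proof -
    obtain u where u: "u \<in> lists \<gamma>" "u \<in> lists E" "cwalk inc pos (fst x) u" "y = fold mv u x" using lk_idxE[OF xy] .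
    have "map g u \<in> lists (g ` \<gamma>)" using u(1) by (auto simp: in_lists_conv_set)
    then show ?thesis using lk_idxI[OF s sub, of "map g u"] sy_fold[OF u(2) assms(1)] u by simp
  qed
  assume "I.lk (g ` \<gamma>) (sy x) (sy y)"
  then obtain v where v: "v \<in> lists (g ` \<gamma>)" "cwalk inc pos (fst (sy x)) v" "sy y = fold mv v (sy x)" using lk_idxE by metis
  then obtain u where u: "u \<in> lists \<gamma>" "v = map g u" by (auto simp: lists_image)
  have uE: "u \<in> lists E" using lists_subD[OF u(1) assms(3)] .
  have "sy y = sy (fold mv u x)" using v(3) u(2) sy_fold[OF uE assms(1)] by simp
  moreover have "fold mv u x \<in> idx" using eset_fold[OF eset_idx uE assms(1)] .
  ultimately have "y = fold mv u x" using sy_bij assms(2) by (auto simp: bij_betw_def dest: inj_onD)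
  then show "I.lk \<gamma> x y" using lk_idxI[OF assms(1,3) u(1)] sy_fold[OF uE assms(1)] v(2) u(2) by simp
qed

end

section \<open>Gluing copies of a structure\<close>

lemma word_comp_snoc: "word_comp V (ps @ [p]) = p \<circ>\<^sub>m word_comp V ps"
  by (simp add: word_comp_def)

lemma word_comp_Nil: "word_comp V [] x = (if x \<in> V then Some x else None)"
  by (simp add: word_comp_def graph_on_def)

lemma word_comp_ran: "\<forall>p\<in>set ps. ran p \<subseteq> V \<Longrightarrow> word_comp V ps x = Some y \<Longrightarrow> x \<in> V \<and> y \<in> V"
proof (induction ps arbitrary: y rule: rev_induct)
  case Nil
  then show ?case by (auto simp: word_comp_Nil split: if_splits)
next
  case (snoc p ps)
  then obtain z where z: "word_comp V ps x = Some z" "p z = Some y"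
    by (auto simp: word_comp_snoc map_comp_Some_iff)
  then show ?case using snoc by (auto simp: ran_def)
qed

text \<open>The second word starts with the identity on \<open>V\<close>, which would cut off values
  outside \<open>V\<close>; hence the condition on ranges.\<close>

lemma word_comp_append:
  assumes "\<forall>p\<in>set ps. ran p \<subseteq> V"
  shows "word_comp V (ps @ qs) = word_comp V qs \<circ>\<^sub>m word_comp V ps"
proof (induction qs rule: rev_induct)
  case Nil
  show ?case
  proof
    fix x
    show "word_comp V (ps @ []) x = (word_comp V [] \<circ>\<^sub>m word_comp V ps) x"
      using word_comp_ran[OF assms, of x] by (auto simp: map_comp_def word_comp_Nil split: option.split)
  qed
next
  case (snoc q qs)
  have "word_comp V (ps @ qs @ [q]) = q \<circ>\<^sub>m (word_comp V qs \<circ>\<^sub>m word_comp V ps)"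
    using word_comp_snoc[of V "ps @ qs" q] snoc by simp
  also have "\<dots> = word_comp V (qs @ [q]) \<circ>\<^sub>m word_comp V ps"
    by (auto simp: word_comp_snoc map_comp_def fun_eq_iff split: option.split)
  finally show ?case .
qed

lemma partial_iso_rel:
  assumes p: "partial_iso \<sigma> A p" and R: "R \<in> symbols \<sigma>" "length xs = arity \<sigma> R" and xs: "\<And>x. x \<in> set xs \<Longrightarrow> p x = Some (f x)"
  shows "xs \<in> rel A R \<longleftrightarrow> map f xs \<in> rel A R"
proof -
  have d: "set xs \<subseteq> dom p" "dom p \<subseteq> univ A" using xs p by (auto simp: partial_iso_def)
  have m: "map (\<lambda>x. the (p x)) xs = map f xs" using xs by simp
  have "set (map f xs) \<subseteq> ran p" using xs by (auto intro: ranI)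
  moreover have "xs \<in> rel (induced A (dom p)) R \<longleftrightarrow> map (\<lambda>x. the (p x)) xs \<in> rel (induced A (ran p)) R"
    using p R d unfolding partial_iso_def isomorphism_def by (auto simp: induced_def)
  ultimately show ?thesis unfolding m using d by (simp add: induced_def)
qed

lemma word_comp_rel:
  assumes P: "\<forall>p\<in>set ps. partial_iso \<sigma> A p" and R: "R \<in> symbols \<sigma>"
  shows "length xs = arity \<sigma> R \<Longrightarrow> (\<And>x. x \<in> set xs \<Longrightarrow> word_comp (univ A) ps x = Some (f x)) \<Longrightarrow>
    xs \<in> rel A R \<longleftrightarrow> map f xs \<in> rel A R"
  using P
proof (induction ps arbitrary: f rule: rev_induct)
  case Nil
  have "f x = x" if "x \<in> set xs" for x
    using Nil.prems(2)[OF that] by (auto simp: word_comp_Nil split: if_splits)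
  then have "map f xs = xs" by (simp add: map_idI)
  then show ?case by simp
next
  case (snoc p ps)
  have "\<exists>g. \<forall>x\<in>set xs. word_comp (univ A) ps x = Some (g x) \<and> p (g x) = Some (f x)"
  proof (rule bchoice, rule ballI)
    fix x assume "x \<in> set xs"
    then have "(p \<circ>\<^sub>m word_comp (univ A) ps) x = Some (f x)" using snoc.prems(2) by (simp add: word_comp_snoc)
    then show "\<exists>y. word_comp (univ A) ps x = Some y \<and> p y = Some (f x)" by (auto simp: map_comp_Some_iff)
  qed
  then obtain g where g: "\<And>x. x \<in> set xs \<Longrightarrow> word_comp (univ A) ps x = Some (g x)"
    "\<And>x. x \<in> set xs \<Longrightarrow> p (g x) = Some (f x)" by blast
  have "xs \<in> rel A R \<longleftrightarrow> map g xs \<in> rel A R" using snoc g(1) by simp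
  also have "\<dots> \<longleftrightarrow> map (\<lambda>y. the (p y)) (map g xs) \<in> rel A R"
    using snoc.prems g(2) by (intro partial_iso_rel[where p = p]) (auto simp: R)
  also have "map (\<lambda>y. the (p y)) (map g xs) = map f xs" using g(2) by simp
  finally show ?case .
qed

text \<open>The automorphism that extends \<open>p\<close> has to permute the co-ordinate domains, so that it lifts to a
  structure glued from them.\<close>

definition good_atlas ::
  "'s signature \<Rightarrow> ('a, 's) struct \<Rightarrow> ('a \<rightharpoonup> 'a) set \<Rightarrow> ('b, 's) struct \<Rightarrow> 'b set set \<Rightarrow> ('b set \<Rightarrow> 'b \<Rightarrow> 'a) \<Rightarrow> 'b set \<Rightarrow> bool" where
  "good_atlas \<sigma> A0 P A U \<pi> u0 \<longleftrightarrow>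
     finite (univ A) \<and> A \<in> structures \<sigma> \<and> fully_symmetric_atlas \<sigma> A0 P A U \<pi> \<and> u0 \<in> U \<and>
     (\<forall>p\<in>P. \<exists>f. automorphism \<sigma> A f \<and> bij_betw (image f) U U \<and>
        (\<forall>v\<in>u0. \<forall>v'\<in>u0. p (\<pi> u0 v) = Some (\<pi> u0 v') \<longrightarrow> f v = v'))"

locale extension_problem =
  fixes \<sigma> :: "'s signature" and A0 :: "('a, 's) struct" and P :: "('a \<rightharpoonup> 'a) set"
  assumes inst: "extension_instance \<sigma> (structures \<sigma>) A0 P"
begin

abbreviation D :: "'a set" where "D \<equiv> univ A0"

lemma finite_D: "finite D" and A0_struct: "A0 \<in> structures \<sigma>" and P_iso: "p \<in> P \<Longrightarrow> partial_iso \<sigma> A0 p"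
  and P_inv: "p \<in> P \<Longrightarrow> pinv p \<in> P"
  using inst by (auto simp: extension_instance_def)

lemma P_ran: "p \<in> P \<Longrightarrow> ran p \<subseteq> D" and P_dom: "p \<in> P \<Longrightarrow> dom p \<subseteq> D"
  using P_iso by (auto simp: partial_iso_def)

lemma words_ran: "set ps \<subseteq> P \<Longrightarrow> \<forall>p\<in>set ps. ran p \<subseteq> D"
  using P_ran by blast

text \<open>The inverse of the chart at \<open>u0\<close> embeds \<open>A0\<close>, and the
  automorphisms recorded in \<open>good_atlas\<close> extend the images of the members of
  \<open>P\<close> under it.\<close>

lemma solution_of_good_atlas:
  assumes "good_atlas \<sigma> A0 P A U \<pi> u0" shows "solution \<sigma> (structures \<sigma>) A0 P A"
proof -
  have A: "A \<in> structures \<sigma>" "u0 \<in> U" "atlas \<sigma> A0 A U \<pi>"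
    using assms by (auto simp: good_atlas_def fully_symmetric_atlas_def)
  have u0: "u0 \<subseteq> univ A" "isomorphism \<sigma> (\<pi> u0) (induced A u0) A0" using A(2,3) by (auto simp: atlas_def)
  have b: "bij_betw (\<pi> u0) u0 D" using u0 by (simp add: isomorphism_def induced_def Int_absorb1)
  define e where "e = inv_into u0 (\<pi> u0)"
  have eb: "bij_betw e D u0" unfolding e_def using b by (rule bij_betw_inv_into)
  have pe: "\<pi> u0 (e x) = x" "e x \<in> u0" if "x \<in> D" for x
    using b that by (auto simp: e_def bij_betw_def f_inv_into_f inv_into_into)
  have eD: "e ` D = u0" using eb by (simp add: bij_betw_def)
  have "embedding \<sigma> e A0 A"
    unfolding embedding_def isomorphism_def
  proof (intro conjI ballI allI impI)
    show "e ` D \<subseteq> univ A" using eD u0(1) by simp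
    show "bij_betw e D (univ (induced A (e ` D)))" using eb u0(1) by (simp add: eD induced_def Int_absorb1)
    fix R xs assume R: "R \<in> symbols \<sigma>" and xs: "length xs = arity \<sigma> R \<and> set xs \<subseteq> D"
    have m: "map (\<pi> u0) (map e xs) = xs" unfolding map_map by (rule map_idI) (use xs pe in auto)
    have s: "set (map e xs) \<subseteq> u0" using xs pe by auto
    then have "map e xs \<in> rel (induced A u0) R \<longleftrightarrow> map (\<pi> u0) (map e xs) \<in> rel A0 R"
      using u0 R xs unfolding isomorphism_def by (simp add: induced_def)
    then show "xs \<in> rel A0 R \<longleftrightarrow> map e xs \<in> rel (induced A (e ` D)) R" using m eD by simp
  qed
  moreover have "\<exists>f. automorphism \<sigma> A f \<and> (\<forall>x y. p x = Some y \<longrightarrow> f (e x) = e y)" if p: "p \<in> P" for p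
  proof -
    obtain f where f: "automorphism \<sigma> A f"
      "\<And>v v'. v \<in> u0 \<Longrightarrow> v' \<in> u0 \<Longrightarrow> p (\<pi> u0 v) = Some (\<pi> u0 v') \<Longrightarrow> f v = v'"
      using assms p by (auto simp: good_atlas_def)
    have "f (e x) = e y" if "p x = Some y" for x y
    proof -
      have "x \<in> D" "y \<in> D" using P_dom[OF p] P_ran[OF p] that by (auto intro: ranI)
      then show ?thesis using f(2)[of "e x" "e y"] pe that by simp
    qed
    then show ?thesis using f(1) by blast
  qed
  ultimately show ?thesis using A(1) unfolding solution_def by blast
qed

end

text \<open>The structure glued from copies of \<open>A0\<close>, one for each index; the point with label \<open>v\<close>
  is shared by the copies that are linked by composable walks in \<open>al v\<close>.\<close>

locale cover = extension_problem \<sigma> A0 P + inc_eset E Ix \<rho> inc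
  for \<sigma> :: "'s signature" and A0 :: "('a, 's) struct" and P and E :: "'e set" and Ix :: "'i set" and \<rho> inc +
  fixes al :: "'l \<Rightarrow> 'e set" and L :: "'i \<Rightarrow> 'l set" and c :: "'i \<Rightarrow> 'l \<Rightarrow> 'a" and el :: "'i \<Rightarrow> 'l \<Rightarrow> 'b"
  assumes D_ne: "univ A0 \<noteq> {}"
    and c_bij: "i \<in> Ix \<Longrightarrow> bij_betw (c i) (L i) (univ A0)"
    and L_step: "i \<in> Ix \<Longrightarrow> e \<in> E \<Longrightarrow> inc e i \<Longrightarrow> v \<in> L i \<Longrightarrow> e \<in> al v \<Longrightarrow> v \<in> L (\<rho> e i)"
    and lk_meet: "lk \<alpha> i j \<Longrightarrow> lk \<beta> i j \<Longrightarrow> lk (\<alpha> \<inter> \<beta>) i j"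
    and al_E: "al v \<subseteq> E"
    and el_eq: "i \<in> Ix \<Longrightarrow> j \<in> Ix \<Longrightarrow> v \<in> L i \<Longrightarrow> v' \<in> L j \<Longrightarrow> el i v = el j v' \<longleftrightarrow> v = v' \<and> lk (al v) i j"
    and step_word: "i \<in> Ix \<Longrightarrow> e \<in> E \<Longrightarrow> inc e i \<Longrightarrow> v0 \<in> L i \<Longrightarrow> e \<in> al v0 \<Longrightarrow>
      \<exists>ps. set ps \<subseteq> P \<and> (\<forall>v\<in>L i. word_comp (univ A0) ps (c i v) = (if e \<in> al v then Some (c (\<rho> e i) v) else None))"
    and al_Int: "i \<in> Ix \<Longrightarrow> (\<Inter>v\<in>L i. al v) = {}"
begin

lemma finite_L: "i \<in> Ix \<Longrightarrow> finite (L i)" and card_L: "i \<in> Ix \<Longrightarrow> card (L i) = card D" and c_D: "i \<in> Ix \<Longrightarrow> v \<in> L i \<Longrightarrow> c i v \<in> D"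
  and c_inj: "i \<in> Ix \<Longrightarrow> inj_on (c i) (L i)"
  using bij_betw_finite[OF c_bij] finite_D c_bij bij_betw_same_card[OF c_bij] by (auto simp: bij_betw_def)

lemma L_ne: "i \<in> Ix \<Longrightarrow> L i \<noteq> {}"
  using c_bij[of i] D_ne by (auto simp: bij_betw_def)

lemma lk_Int:
  assumes "finite T" "lk \<alpha> i j" "\<And>v. v \<in> T \<Longrightarrow> lk (al v) i j" shows "lk (\<alpha> \<inter> (\<Inter>v\<in>T. al v)) i j"
  using assms(1,3)
proof (induction T rule: finite_induct)
  case (insert v T)
  have "lk (al v \<inter> (\<alpha> \<inter> (\<Inter>v\<in>T. al v))) i j" by (rule lk_meet) (use insert in simp_all)
  then show ?case by (simp add: Int_left_commute)
qed (simp add: assms(2))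

text \<open>By \<open>lk_meet\<close> a single walk would serve all labels of copy \<open>i\<close>,
  and no letter belongs to all of them. So a co-ordinate domain determines its index, and a chart
  can be attached to the domain.\<close>

lemma distinct_ix:
  assumes "i \<in> Ix" "\<And>v. v \<in> L i \<Longrightarrow> lk (al v) i j" shows "i = j"
proof -
  obtain v where v: "v \<in> L i" using L_ne[OF assms(1)] by blast
  have "lk (al v \<inter> (\<Inter>v\<in>L i. al v)) i j" using lk_Int[OF finite_L[OF assms(1)] assms(2)[OF v] assms(2)] .
  then show ?thesis using al_Int[OF assms(1)] lk_empty by simp
qed

text \<open>The label \<open>v0\<close> survives in every copy on the way, as
  \<open>step_word\<close> requires. The composite is defined at exactly the labels that survive all
  letters, so domains come out exactly.\<close>

lemma walk_word:
  assumes "i \<in> Ix" "w \<in> lists E" "cwalk inc \<rho> i w" "v0 \<in> L i" "set w \<subseteq> al v0"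
  shows "(\<exists>ps. set ps \<subseteq> P \<and> (\<forall>v\<in>L i. word_comp D ps (c i v) = (if set w \<subseteq> al v then Some (c (fold \<rho> w i) v) else None))) \<and>
    (\<forall>v\<in>L i. set w \<subseteq> al v \<longrightarrow> v \<in> L (fold \<rho> w i))"
  using assms
proof (induction w arbitrary: i rule: list.induct)
  case Nil
  have "\<forall>v\<in>L i. word_comp D [] (c i v) = Some (c i v)" using c_D[OF Nil.prems(1)] by (auto simp: word_comp_Nil)
  then show ?case by (intro conjI exI[of _ "[]"]) auto
next
  case (Cons e w)
  have e: "e \<in> E" "inc e i" "e \<in> al v0" "w \<in> lists E" "cwalk inc \<rho> (\<rho> e i) w" "set w \<subseteq> al v0" using Cons.prems by auto
  have i': "\<rho> e i \<in> Ix" using esetD(1)[OF es e(1) Cons.prems(1)] .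
  have v0: "v0 \<in> L (\<rho> e i)" using L_step[OF Cons.prems(1) e(1,2) Cons.prems(4) e(3)] .
  obtain ps where ps: "set ps \<subseteq> P" "\<And>v. v \<in> L i \<Longrightarrow> word_comp D ps (c i v) = (if e \<in> al v then Some (c (\<rho> e i) v) else None)"
    using step_word[OF Cons.prems(1) e(1,2) Cons.prems(4) e(3)] by blast
  have IH: "(\<exists>ps. set ps \<subseteq> P \<and> (\<forall>v\<in>L (\<rho> e i). word_comp D ps (c (\<rho> e i) v) = (if set w \<subseteq> al v then Some (c (fold \<rho> w (\<rho> e i)) v) else None))) \<and>
    (\<forall>v\<in>L (\<rho> e i). set w \<subseteq> al v \<longrightarrow> v \<in> L (fold \<rho> w (\<rho> e i)))"
    using Cons.IH[OF i' e(4,5) v0 e(6)] .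
  then obtain qs where qs: "set qs \<subseteq> P"
    "\<And>v. v \<in> L (\<rho> e i) \<Longrightarrow> word_comp D qs (c (\<rho> e i) v) = (if set w \<subseteq> al v then Some (c (fold \<rho> w (\<rho> e i)) v) else None)" by blast
  have st: "v \<in> L (\<rho> e i)" if "v \<in> L i" "e \<in> al v" for v using L_step[OF Cons.prems(1) e(1,2) that] .
  have "word_comp D (ps @ qs) (c i v) = (if set (e # w) \<subseteq> al v then Some (c (fold \<rho> (e # w) i) v) else None)"
    if "v \<in> L i" for v
    using ps(2)[OF that] qs(2)[of v] st[OF that] by (auto simp: word_comp_append[OF words_ran[OF ps(1)]] map_comp_def)
  moreover have "v \<in> L (fold \<rho> (e # w) i)" if "v \<in> L i" "set (e # w) \<subseteq> al v" for v
    using IH st[OF that(1)] that(2) by simp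
  ultimately show ?case using ps(1) qs(1) by (intro conjI exI[of _ "ps @ qs"]) auto
qed

text \<open>Each shared label has its own walk; \<open>lk_meet\<close> replaces these by one walk
  over the letters common to all shared labels. Conversely, any label carried by this walk is
  shared. So the domain is the one that condition (ii) demands.\<close>

lemma transfer_word:
  assumes ij: "i \<in> Ix" "j \<in> Ix" and ne: "v0 \<in> L i" "v0 \<in> L j" "lk (al v0) i j"
  shows "\<exists>ps. set ps \<subseteq> P \<and> (\<forall>v\<in>L i. word_comp D ps (c i v) = (if v \<in> L j \<and> lk (al v) i j then Some (c j v) else None))"
proof -
  define S where "S = {v \<in> L i. v \<in> L j \<and> lk (al v) i j}"
  have fS: "finite S" using finite_L[OF ij(1)] by (simp add: S_def)
  have "lk (al v0 \<inter> (\<Inter>v\<in>S. al v)) i j" by (rule lk_Int[OF fS ne(3)]) (simp add: S_def)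
  then obtain w where w: "w \<in> lists (al v0 \<inter> (\<Inter>v\<in>S. al v))" "cwalk inc \<rho> i w" "j = fold \<rho> w i" by (auto simp: lk_def)
  have wE: "w \<in> lists E" using w(1) al_E[of v0] by (auto simp: in_lists_conv_set)
  have w0: "set w \<subseteq> al v0" and wS: "\<And>v. v \<in> S \<Longrightarrow> set w \<subseteq> al v" using w(1) by (auto simp: in_lists_conv_set)
  note ww = walk_word[OF ij(1) wE w(2) ne(1) w0]
  have "set w \<subseteq> al v \<longleftrightarrow> v \<in> L j \<and> lk (al v) i j" if "v \<in> L i" for v
  proof
    assume a: "set w \<subseteq> al v"
    then have "w \<in> lists (al v)" by (auto simp: in_lists_conv_set)
    then have "lk (al v) i j" unfolding lk_def using ij(1) al_E w(2,3) by blast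
    then show "v \<in> L j \<and> lk (al v) i j" using ww that a w(3) by blast
  qed (use wS that in \<open>simp add: S_def\<close>)
  then show ?thesis using ww w(3) by auto
qed

definition A :: "('b, 's) struct" where
  "A = \<lparr>univ = (\<Union>i\<in>Ix. el i ` L i),
    rel = (\<lambda>R. {map (el i) vs |i vs. i \<in> Ix \<and> set vs \<subseteq> L i \<and> map (c i) vs \<in> rel A0 R})\<rparr>"

definition u :: "'i \<Rightarrow> 'b set" where "u i = el i ` L i"

definition U :: "'b set set" where "U = u ` Ix"

text \<open>Charts are indexed by domains, so index and label have to be recovered from
  \<open>s\<close> and \<open>x\<close>; they are unique by \<open>u_inj\<close> and
  \<open>el_inj\<close>.\<close>

definition \<pi> :: "'b set \<Rightarrow> 'b \<Rightarrow> 'a" where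
  "\<pi> s x = (THE a. \<exists>i\<in>Ix. \<exists>v\<in>L i. s = u i \<and> x = el i v \<and> a = c i v)"

lemma el_inj: "i \<in> Ix \<Longrightarrow> v \<in> L i \<Longrightarrow> v' \<in> L i \<Longrightarrow> el i v = el i v' \<longleftrightarrow> v = v'"
  using el_eq[of i i v v'] lk_refl[OF _ al_E] by auto

lemma el_in_u: "i \<in> Ix \<Longrightarrow> j \<in> Ix \<Longrightarrow> v \<in> L i \<Longrightarrow> el i v \<in> u j \<longleftrightarrow> v \<in> L j \<and> lk (al v) i j"
  unfolding u_def using el_eq[of i j v] by auto

lemma u_inj: assumes "i \<in> Ix" "j \<in> Ix" "u i = u j" shows "i = j"
proof -
  have "lk (al v) i j" if "v \<in> L i" for v
    using el_in_u[OF assms(1,2) that] assms(3) that by (auto simp: u_def)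
  then show ?thesis using distinct_ix[OF assms(1)] by blast
qed

lemma \<pi>_el: assumes "i \<in> Ix" "v \<in> L i" shows "\<pi> (u i) (el i v) = c i v"
  unfolding \<pi>_def
proof (rule the_equality)
  fix a assume "\<exists>j\<in>Ix. \<exists>v'\<in>L j. u i = u j \<and> el i v = el j v' \<and> a = c j v'"
  then obtain j v' where "j \<in> Ix" "v' \<in> L j" "u i = u j" "el i v = el j v'" "a = c j v'" by blast
  then show "a = c i v" using u_inj[OF assms(1), of j] el_inj[OF assms, of v'] by simp
qed (use assms in blast)

lemma univ_A: "univ A = (\<Union>i\<in>Ix. u i)" by (simp add: A_def u_def)

lemma finite_A: "finite (univ A)"
  using es finite_L by (simp add: A_def eset_def)

lemma A_struct: "A \<in> structures \<sigma>"
proof -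
  have "length xs = arity \<sigma> R \<and> set xs \<subseteq> univ A" if R: "R \<in> symbols \<sigma>" "xs \<in> rel A R" for R xs
  proof -
    obtain i vs where i: "i \<in> Ix" "set vs \<subseteq> L i" "map (c i) vs \<in> rel A0 R" "xs = map (el i) vs"
      using R(2) by (auto simp: A_def)
    have "length (map (c i) vs) = arity \<sigma> R" using A0_struct R(1) i(3) unfolding structures_def by blast
    then show ?thesis using i by (auto simp: A_def)
  qed
  then show ?thesis by (simp add: structures_def)
qed

lemma rel_AI: "i \<in> Ix \<Longrightarrow> set vs \<subseteq> L i \<Longrightarrow> map (c i) vs \<in> rel A0 R \<Longrightarrow> map (el i) vs \<in> rel A R"
  by (auto simp: A_def)

text \<open>A tuple contributed by copy \<open>j\<close> must not create a new one in copy
  \<open>i\<close>. All its entries are shared, so one word over \<open>P\<close> moves it from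
  \<open>i\<close> to \<open>j\<close>, and such words preserve relations.\<close>

lemma rel_A:
  assumes i: "i \<in> Ix" and vs: "set vs \<subseteq> L i" and R: "R \<in> symbols \<sigma>" "length vs = arity \<sigma> R"
  shows "map (el i) vs \<in> rel A R \<longleftrightarrow> map (c i) vs \<in> rel A0 R"
proof
  assume "map (el i) vs \<in> rel A R"
  then obtain j ws where j: "j \<in> Ix" "set ws \<subseteq> L j" "map (c j) ws \<in> rel A0 R" "map (el i) vs = map (el j) ws"
    by (auto simp: A_def)
  have len: "length vs = length ws" using j(4) by (metis length_map)
  have nth: "vs ! k = ws ! k \<and> lk (al (vs ! k)) i j" if "k < length vs" for k
  proof -
    have "vs ! k \<in> L i" "ws ! k \<in> L j" using vs j(2) that len by auto
    moreover have "el i (vs ! k) = el j (ws ! k)" using j(4) that len by (metis nth_map)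
    ultimately show ?thesis using el_eq[OF i j(1)] by blast
  qed
  then have eq: "vs = ws" using len by (intro nth_equalityI) auto
  have l: "lk (al v) i j" if "v \<in> set vs" for v using nth that by (metis in_set_conv_nth)
  show "map (c i) vs \<in> rel A0 R"
  proof (cases vs)
    \<comment> \<open>The empty tuple has no shared label from which a walk could start, but all
      copies contribute the same nullary relations.\<close>
    case Nil
    then show ?thesis using j(3) eq by simp
  next
    case (Cons v0 vs')
    then have v0: "v0 \<in> L i" "v0 \<in> L j" "lk (al v0) i j" using vs j(2) eq l by auto
    obtain ps where ps: "set ps \<subseteq> P"
      "\<And>v. v \<in> L i \<Longrightarrow> word_comp D ps (c i v) = (if v \<in> L j \<and> lk (al v) i j then Some (c j v) else None)"
      using transfer_word[OF i j(1) v0] by blast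
    define f where "f = (\<lambda>x. the (word_comp D ps x))"
    have w: "word_comp D ps (c i v) = Some (c j v)" if "v \<in> set vs" for v
    proof -
      have "v \<in> L i" "v \<in> L j" using vs j(2) eq that by auto
      then show ?thesis using ps(2)[of v] l[OF that] by simp
    qed
    have "map (c i) vs \<in> rel A0 R \<longleftrightarrow> map f (map (c i) vs) \<in> rel A0 R"
      using ps(1) P_iso w R(2) by (intro word_comp_rel[where ps = ps]) (auto simp: f_def R(1))
    also have "map f (map (c i) vs) = map (c j) ws" using w eq by (simp add: f_def)
    finally show ?thesis using j(3) by simp
  qed
qed (rule rel_AI[OF i vs])

lemma atlas_A: "atlas \<sigma> A0 A U \<pi>"
  unfolding atlas_def
proof (intro conjI ballI)
  show "s \<subseteq> univ A" if "s \<in> U" for s using that by (auto simp: U_def univ_A)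
  show "\<exists>s\<in>U. a \<in> s" if "a \<in> univ A" for a using that by (auto simp: U_def univ_A)
  show "\<exists>s\<in>U. set xs \<subseteq> s" if x: "R \<in> symbols \<sigma>" "xs \<in> rel A R" for R xs
  proof -
    obtain i vs where "i \<in> Ix" "set vs \<subseteq> L i" "xs = map (el i) vs" using x(2) by (auto simp: A_def)
    then have "u i \<in> U" "set xs \<subseteq> u i" by (auto simp: U_def u_def)
    then show ?thesis by blast
  qed
  fix s assume "s \<in> U"
  then obtain i where i: "i \<in> Ix" "s = u i" by (auto simp: U_def)
  have un: "univ (induced A (u i)) = u i" using i(1) by (auto simp: induced_def univ_A)
  have "bij_betw (\<pi> (u i)) (u i) D"
  proof -
    have b: "bij_betw (el i) (L i) (u i)" unfolding bij_betw_def u_def using el_inj[OF i(1)] by (auto intro: inj_onI)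
    have "bij_betw (\<pi> (u i) \<circ> el i) (L i) D \<longleftrightarrow> bij_betw (c i) (L i) D"
      by (rule bij_betw_cong) (use \<pi>_el[OF i(1)] in simp)
    then show ?thesis using c_bij[OF i(1)] bij_betw_comp_iff[OF b] by blast
  qed
  moreover have "xs \<in> rel (induced A (u i)) R \<longleftrightarrow> map (\<pi> (u i)) xs \<in> rel A0 R"
    if R: "R \<in> symbols \<sigma>" and xs: "length xs = arity \<sigma> R" "set xs \<subseteq> u i" for R xs
  proof -
    have "\<forall>x\<in>set xs. \<exists>v. v \<in> L i \<and> x = el i v" using xs(2) by (auto simp: u_def)
    then obtain h where h: "\<And>x. x \<in> set xs \<Longrightarrow> h x \<in> L i \<and> x = el i (h x)" by metis
    have e: "xs = map (el i) (map h xs)" using h by (simp add: map_idI)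
    have "xs \<in> rel A R \<longleftrightarrow> map (c i) (map h xs) \<in> rel A0 R"
      by (subst e, rule rel_A[OF i(1) _ R]) (use h xs(1) in auto)
    also have "c i (h x) = \<pi> (u i) x" if "x \<in> set xs" for x
      using h[OF that] \<pi>_el[OF i(1), of "h x"] by metis
    then have "map (c i) (map h xs) = map (\<pi> (u i)) xs" by simp
    finally show ?thesis using xs by (simp add: induced_def)
  qed
  ultimately show "isomorphism \<sigma> (\<pi> s) (induced A s) A0" unfolding isomorphism_def i(2) un by blast
qed

lemma chart_change:
  assumes "s \<in> U" "s' \<in> U" "s \<inter> s' \<noteq> {}"
  shows "\<exists>ps. set ps \<subseteq> P \<and> graph_on s' (\<pi> s') \<circ>\<^sub>m pinv (graph_on s (\<pi> s)) = word_comp D ps"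
proof -
  obtain i j where ij: "i \<in> Ix" "s = u i" "j \<in> Ix" "s' = u j" using assms(1,2) by (auto simp: U_def)
  obtain v0 where v0: "v0 \<in> L i" "el i v0 \<in> u j" using assms(3) ij by (auto simp: u_def)
  then have v0': "v0 \<in> L j" "lk (al v0) i j" using el_in_u[OF ij(1,3)] by auto
  obtain ps where ps: "set ps \<subseteq> P"
    "\<And>v. v \<in> L i \<Longrightarrow> word_comp D ps (c i v) = (if v \<in> L j \<and> lk (al v) i j then Some (c j v) else None)"
    using transfer_word[OF ij(1,3) v0(1) v0'] by blast
  have g: "graph_on (u i) (\<pi> (u i)) y = Some x \<longleftrightarrow> (\<exists>v\<in>L i. y = el i v \<and> x = c i v)" for x y
    using \<pi>_el[OF ij(1)] by (auto simp: graph_on_def u_def)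
  have "(graph_on s' (\<pi> s') \<circ>\<^sub>m pinv (graph_on s (\<pi> s))) x = word_comp D ps x" for x
  proof (cases "x \<in> D")
    case False
    have "x \<notin> ran (graph_on s (\<pi> s))" using g c_D[OF ij(1)] False ij(2) by (auto simp: ran_def)
    moreover have "word_comp D ps x = None"
      using word_comp_ran[OF words_ran[OF ps(1)], of x] False by (cases "word_comp D ps x") auto
    ultimately show ?thesis by (simp add: map_comp_def pinv_def)
  next
    case True
    then obtain v where v: "v \<in> L i" "x = c i v" using c_bij[OF ij(1)] by (auto simp: bij_betw_def)
    have "graph_on s (\<pi> s) y = Some x \<longleftrightarrow> y = el i v" for y
      using g v c_inj[OF ij(1)] ij(2) by (auto dest: inj_onD)
    then have "pinv (graph_on s (\<pi> s)) x = Some (el i v)" by (auto simp: pinv_def ran_def)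
    then have "(graph_on s' (\<pi> s') \<circ>\<^sub>m pinv (graph_on s (\<pi> s))) x = (if el i v \<in> u j then Some (\<pi> (u j) (el i v)) else None)"
      using ij(4) by (simp add: map_comp_def graph_on_def)
    also have "\<dots> = word_comp D ps x"
    proof (cases "v \<in> L j \<and> lk (al v) i j")
      case True
      then have "el i v = el j v" using el_eq[OF ij(1,3) v(1)] by blast
      then show ?thesis using True ps(2)[OF v(1)] v(2) \<pi>_el[OF ij(3), of v] el_in_u[OF ij(1,3) v(1)] by simp
    next
      case False
      then show ?thesis using ps(2)[OF v(1)] v(2) el_in_u[OF ij(1,3) v(1)] by auto
    qed
    finally show ?thesis .
  qed
  then show ?thesis using ps(1) by blast
qed

section \<open>Symmetries of the index and the automorphisms they induce\<close>

definition symm :: "('i \<Rightarrow> 'i) \<Rightarrow> ('l \<Rightarrow> 'l) \<Rightarrow> ('i \<Rightarrow> 'a \<Rightarrow> 'a) \<Rightarrow> bool" where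
  "symm f h \<kappa> \<longleftrightarrow> bij_betw f Ix Ix \<and> inj_on h (\<Union>i\<in>Ix. L i) \<and>
     (\<forall>i\<in>Ix. automorphism \<sigma> A0 (\<kappa> i) \<and> (\<forall>v\<in>L i. h v \<in> L (f i) \<and> c (f i) (h v) = \<kappa> i (c i v))) \<and>
     (\<forall>i\<in>Ix. \<forall>j\<in>Ix. \<forall>v\<in>L i. lk (al (h v)) (f i) (f j) \<longleftrightarrow> lk (al v) i j)"

text \<open>The last clause of \<open>symm\<close> says that identifications of points are preserved
  and reflected, so \<open>f\<close> and \<open>h\<close> act on glued points. Copy \<open>i\<close>
  goes to copy \<open>f i\<close> through the automorphism \<open>\<kappa> i\<close>; if all of
  these are \<open>id\<close>, charts are respected.\<close>

lemma symm_automorphism: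
  assumes s: "symm f h \<kappa>"
  shows "\<exists>F. automorphism \<sigma> A F \<and> (\<forall>i\<in>Ix. F ` u i = u (f i) \<and> (\<forall>v\<in>L i. F (el i v) = el (f i) (h v))) \<and> bij_betw (image F) U U"
proof -
  have f: "bij_betw f Ix Ix" and fI: "\<And>i. i \<in> Ix \<Longrightarrow> f i \<in> Ix" using s by (auto simp: symm_def bij_betw_def)
  have h: "\<And>i v. i \<in> Ix \<Longrightarrow> v \<in> L i \<Longrightarrow> h v \<in> L (f i)" "\<And>i v. i \<in> Ix \<Longrightarrow> v \<in> L i \<Longrightarrow> c (f i) (h v) = \<kappa> i (c i v)"
    "\<And>i j v. i \<in> Ix \<Longrightarrow> j \<in> Ix \<Longrightarrow> v \<in> L i \<Longrightarrow> lk (al (h v)) (f i) (f j) \<longleftrightarrow> lk (al v) i j"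
    "\<And>i. i \<in> Ix \<Longrightarrow> automorphism \<sigma> A0 (\<kappa> i)"
    using s by (auto simp: symm_def)
  have hinj: "h v = h v' \<longleftrightarrow> v = v'" if "i \<in> Ix" "j \<in> Ix" "v \<in> L i" "v' \<in> L j" for i j v v'
    using s that unfolding symm_def inj_on_def by blast
  have eqF: "el (f i) (h v) = el (f j) (h v') \<longleftrightarrow> el i v = el j v'" if "i \<in> Ix" "j \<in> Ix" "v \<in> L i" "v' \<in> L j" for i j v v'
    using el_eq[OF fI[OF that(1)] fI[OF that(2)] h(1)[OF that(1,3)] h(1)[OF that(2,4)]] el_eq[OF that] hinj[OF that] h(3)[OF that(1-3)] by blast
  define F where "F = (\<lambda>x. SOME y. \<exists>i\<in>Ix. \<exists>v\<in>L i. x = el i v \<and> y = el (f i) (h v))"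
  have F: "F (el i v) = el (f i) (h v)" if "i \<in> Ix" "v \<in> L i" for i v
    unfolding F_def
  proof (rule some_equality)
    fix y assume "\<exists>j\<in>Ix. \<exists>v'\<in>L j. el i v = el j v' \<and> y = el (f j) (h v')"
    then obtain j v' where "j \<in> Ix" "v' \<in> L j" "el i v = el j v'" "y = el (f j) (h v')" by blast
    then show "y = el (f i) (h v)" using eqF[of i j v v'] that by simp
  qed (use that in blast)
  have hL: "h ` L i = L (f i)" if "i \<in> Ix" for i
  proof (rule card_subset_eq)
    show "finite (L (f i))" using finite_L fI that by blast
    show "h ` L i \<subseteq> L (f i)" using h(1) that by blast
    have "inj_on h (L i)" using hinj that by (auto intro: inj_onI)
    then show "card (h ` L i) = card (L (f i))" using card_L fI that by (simp add: card_image)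
  qed
  have Fu: "F ` u i = u (f i)" if "i \<in> Ix" for i
  proof -
    have "F ` u i = (\<lambda>v. el (f i) (h v)) ` L i" unfolding u_def image_image using F[OF that] by (intro image_cong) auto
    also have "\<dots> = el (f i) ` h ` L i" by (simp add: image_image)
    finally show ?thesis using hL[OF that] by (simp add: u_def)
  qed
  have bF: "bij_betw F (univ A) (univ A)"
    unfolding bij_betw_def
  proof
    show "inj_on F (univ A)"
    proof (rule inj_onI)
      fix x y assume "x \<in> univ A" "y \<in> univ A" "F x = F y"
      moreover then obtain i v j v' where "i \<in> Ix" "v \<in> L i" "x = el i v" "j \<in> Ix" "v' \<in> L j" "y = el j v'" by (auto simp: A_def)
      ultimately show "x = y" using F eqF by metis
    qed
    have "F ` univ A = (\<Union>i\<in>Ix. u (f i))" using Fu by (simp add: univ_A image_UN)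
    also have "\<dots> = (\<Union>i\<in>f ` Ix. u i)" by simp
    also have "f ` Ix = Ix" using f by (simp add: bij_betw_def)
    finally show "F ` univ A = univ A" by (simp only: univ_A)
  qed
  have imp: "map F xs \<in> rel A R" if R: "R \<in> symbols \<sigma>" and x: "xs \<in> rel A R" for R xs
  proof -
    obtain i vs where i: "i \<in> Ix" "set vs \<subseteq> L i" "map (c i) vs \<in> rel A0 R" "xs = map (el i) vs" using x by (auto simp: A_def)
    have len: "length (map (c i) vs) = arity \<sigma> R" using A0_struct R i(3) unfolding structures_def by blast
    have "set (map (c i) vs) \<subseteq> D" using i(2) c_D[OF i(1)] by auto
    then have "map (\<kappa> i) (map (c i) vs) \<in> rel A0 R"
      using h(4)[OF i(1)] i(3) R len unfolding automorphism_def isomorphism_def by blast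
    moreover have "map (\<kappa> i) (map (c i) vs) = map (c (f i)) (map h vs)" using h(2)[OF i(1)] i(2) by auto
    moreover have "map F xs = map (el (f i)) (map h vs)" using F[OF i(1)] i(2,4) by auto
    moreover have "set (map h vs) \<subseteq> L (f i)" using h(1)[OF i(1)] i(2) by auto
    ultimately show ?thesis using rel_AI[OF fI[OF i(1)], of "map h vs" R] by metis
  qed
  have conv: "xs \<in> rel A R" if R: "R \<in> symbols \<sigma>" and xs: "length xs = arity \<sigma> R" "set xs \<subseteq> univ A" and Fx: "map F xs \<in> rel A R" for R xs
  proof -
    obtain j ws where j: "j \<in> Ix" "set ws \<subseteq> L j" "map (c j) ws \<in> rel A0 R" "map F xs = map (el j) ws" using Fx by (auto simp: A_def)
    obtain i where i: "i \<in> Ix" "f i = j" using f j(1) by (metis bij_betw_def imageE)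
    have "\<forall>w\<in>set ws. \<exists>v. v \<in> L i \<and> w = h v" using j(2) hL[OF i(1)] i(2) by auto
    then obtain k where k: "\<And>w. w \<in> set ws \<Longrightarrow> k w \<in> L i \<and> w = h (k w)" by metis
    define vs where "vs = map k ws"
    have vs: "set vs \<subseteq> L i" "ws = map h vs" using k by (auto simp: vs_def map_idI)
    have "map F xs = map F (map (el i) vs)" using j(4) i vs F[OF i(1)] by auto
    moreover have "set (map (el i) vs) \<subseteq> univ A" using vs(1) i(1) by (auto simp: A_def)
    ultimately have xe: "xs = map (el i) vs" using inj_on_map_eq_map[of F xs "map (el i) vs"] bF xs(2)
      by (metis bij_betw_def inj_on_subset Un_least)
    have "map (c j) ws = map (\<kappa> i) (map (c i) vs)" using vs h(2)[OF i(1)] i(2) by auto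
    moreover have "set (map (c i) vs) \<subseteq> D" "length (map (c i) vs) = arity \<sigma> R" using vs(1) c_D[OF i(1)] xs(1) xe by auto
    ultimately have "map (c i) vs \<in> rel A0 R"
      using h(4)[OF i(1)] j(3) R unfolding automorphism_def isomorphism_def by metis
    then show ?thesis using xe i(1) vs(1) by (auto simp: A_def)
  qed
  have "automorphism \<sigma> A F" unfolding automorphism_def isomorphism_def using bF imp conv by blast
  moreover have "bij_betw (image F) U U"
    unfolding bij_betw_def
  proof
    show "inj_on (image F) U"
    proof (rule inj_onI)
      fix a b assume ab: "a \<in> U" "b \<in> U" "F ` a = F ` b"
      have "a \<subseteq> univ A" "b \<subseteq> univ A" using ab by (auto simp: U_def univ_A)
      then show "a = b" using ab(3) bF inj_on_image_eq_iff unfolding bij_betw_def by metis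
    qed
    have "image F ` U = u ` f ` Ix" unfolding U_def image_image using Fu by (intro image_cong) auto
    then show "image F ` U = U" using f by (simp add: U_def bij_betw_def)
  qed
  ultimately show ?thesis using F Fu by blast
qed

lemma automorphism_id: "automorphism \<sigma> A0 id"
  by (simp add: automorphism_def isomorphism_def)

text \<open>To extend \<open>p\<close>, each label in its domain has to go to the label of its
  image, while copy \<open>i0\<close> has to go to a copy that is glued to \<open>i0\<close> at the
  image labels.\<close>

lemma good:
  assumes tr: "\<And>i j. i \<in> Ix \<Longrightarrow> j \<in> Ix \<Longrightarrow> \<exists>f h. symm f h (\<lambda>_. id) \<and> f i = j"
    and i0: "i0 \<in> Ix"
    and ext: "\<And>p. p \<in> P \<Longrightarrow> \<exists>f h \<kappa>. symm f h \<kappa> \<and>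
      (\<forall>v\<in>L i0. \<forall>v'\<in>L i0. p (c i0 v) = Some (c i0 v') \<longrightarrow> h v = v' \<and> lk (al v') (f i0) i0)"
  shows "good_atlas \<sigma> A0 P A U \<pi> (u i0)"
  unfolding good_atlas_def fully_symmetric_atlas_def
proof (intro conjI ballI impI)
  show "finite (univ A)" "A \<in> structures \<sigma>" "atlas \<sigma> A0 A U \<pi>" by (rule finite_A A_struct atlas_A)+
  show "\<exists>ps. set ps \<subseteq> P \<and> graph_on s' (\<pi> s') \<circ>\<^sub>m pinv (graph_on s (\<pi> s)) = word_comp D ps"
    if "s \<in> U" "s' \<in> U" "s \<inter> s' \<noteq> {}" for s s' using that by (rule chart_change)
  show "u i0 \<in> U" using i0 by (simp add: U_def)
next
  fix s s' assume "s \<in> U" "s' \<in> U"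
  then obtain i j where ij: "i \<in> Ix" "s = u i" "j \<in> Ix" "s' = u j" by (auto simp: U_def)
  obtain f h where f: "symm f h (\<lambda>_. id)" "f i = j" using tr[OF ij(1,3)] by blast
  obtain F where FF: "automorphism \<sigma> A F" "\<forall>i\<in>Ix. F ` u i = u (f i) \<and> (\<forall>v\<in>L i. F (el i v) = el (f i) (h v))"
    "bij_betw (image F) U U" using symm_automorphism[OF f(1)] by metis
  have F: "automorphism \<sigma> A F" "\<And>i. i \<in> Ix \<Longrightarrow> F ` u i = u (f i)"
    "\<And>i v. i \<in> Ix \<Longrightarrow> v \<in> L i \<Longrightarrow> F (el i v) = el (f i) (h v)" "bij_betw (image F) U U"
    using FF by simp_all
  have "\<pi> (F ` u k) (F x) = \<pi> (u k) x" if k: "k \<in> Ix" "x \<in> u k" for k x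
  proof -
    obtain v where v: "v \<in> L k" "x = el k v" using k(2) by (auto simp: u_def)
    have "f k \<in> Ix" "h v \<in> L (f k)" "c (f k) (h v) = c k v"
      using f(1) k(1) v(1) by (auto simp: symm_def bij_betw_def)
    then show ?thesis using F(2,3)[OF k(1)] v \<pi>_el[OF k(1) v(1)] \<pi>_el[of "f k" "h v"] by simp
  qed
  then have "rigid_symmetry \<sigma> A U \<pi> F" unfolding rigid_symmetry_def using F(1,4) by (auto simp: U_def)
  then show "\<exists>f. rigid_symmetry \<sigma> A U \<pi> f \<and> f ` s = s'" using F(2)[OF ij(1)] ij(2,4) f(2) by blast
next
  fix p assume "p \<in> P"
  then obtain f h \<kappa> where f: "symm f h \<kappa>"
    "\<forall>v\<in>L i0. \<forall>v'\<in>L i0. p (c i0 v) = Some (c i0 v') \<longrightarrow> h v = v' \<and> lk (al v') (f i0) i0"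
    using ext by metis
  obtain F where FF: "automorphism \<sigma> A F" "\<forall>i\<in>Ix. F ` u i = u (f i) \<and> (\<forall>v\<in>L i. F (el i v) = el (f i) (h v))"
    "bij_betw (image F) U U" using symm_automorphism[OF f(1)] by metis
  have F: "automorphism \<sigma> A F" "\<And>i v. i \<in> Ix \<Longrightarrow> v \<in> L i \<Longrightarrow> F (el i v) = el (f i) (h v)" "bij_betw (image F) U U"
    using FF by simp_all
  have "F x = y" if xy: "x \<in> u i0" "y \<in> u i0" "p (\<pi> (u i0) x) = Some (\<pi> (u i0) y)" for x y
  proof -
    obtain v v' where v: "v \<in> L i0" "x = el i0 v" "v' \<in> L i0" "y = el i0 v'" using xy(1,2) by (auto simp: u_def)
    have "p (c i0 v) = Some (c i0 v')" using xy(3) v \<pi>_el[OF i0] by simp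
    then have "h v = v'" "lk (al v') (f i0) i0" using f(2) v(1,3) by auto
    moreover have "f i0 \<in> Ix" "h v \<in> L (f i0)" using f(1) i0 v(1) by (auto simp: symm_def bij_betw_def)
    ultimately have "el (f i0) (h v) = el i0 v'" using el_eq[of "f i0" i0 "h v" v'] i0 v(3) by simp
    then show ?thesis using F(2)[OF i0 v(1)] v by simp
  qed
  then show "\<exists>f. automorphism \<sigma> A f \<and> bij_betw (image f) U U \<and> (\<forall>v\<in>u i0. \<forall>v'\<in>u i0. p (\<pi> (u i0) v) = Some (\<pi> (u i0) v') \<longrightarrow> f v = v')"
    using F(1,3) by blast
qed

end

section \<open>Acyclicity of the glued structure\<close>

lemma (in inc_eset) lk_iff_adj:
  assumes "\<And>e x. e \<in> E \<Longrightarrow> x \<in> H \<Longrightarrow> inc e x" shows "lk \<gamma> x y \<longleftrightarrow> adj \<gamma> x y"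
proof
  assume a: "adj \<gamma> x y"
  obtain u where u: "u \<in> lists \<gamma>" "y = fold \<rho> u x" using adj_word[OF a] by blast
  have x: "x \<in> H" "\<gamma> \<subseteq> E" using adj_in[OF a] by auto
  have "cwalk inc \<rho> x u" if "x \<in> H" "u \<in> lists E" for x u
    using that
  proof (induction u arbitrary: x rule: list.induct)
    case (Cons e u)
    then show ?case using assms esetD(1)[OF es, of e x] by simp
  qed simp
  then show "lk \<gamma> x y" using x u lists_subD[OF u(1) x(2)] unfolding lk_def by blast
qed (rule lk_adj)

text \<open>A glued point is a label together with a class of indices. Encoding these pairs as
  numbers keeps the type of the solution fixed although gluing is repeated.\<close>

lemma (in inc_eset) exists_labelling:
  fixes al :: "'l \<Rightarrow> 'e set"
  assumes fin: "\<And>i. i \<in> H \<Longrightarrow> finite (L i)" and al: "\<And>v. al v \<subseteq> E"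
  obtains el :: "'h \<Rightarrow> 'l \<Rightarrow> nat" where
    "\<And>i j v v'. i \<in> H \<Longrightarrow> j \<in> H \<Longrightarrow> v \<in> L i \<Longrightarrow> v' \<in> L j \<Longrightarrow> el i v = el j v' \<longleftrightarrow> v = v' \<and> lk (al v) i j"
proof -
  define g where "g = (\<lambda>i v. (v, {j. lk (al v) i j}))"
  define X where "X = (\<Union>i\<in>H. g i ` L i)"
  have "finite X" using es fin by (simp add: X_def eset_def)
  then obtain enc :: "'l \<times> 'h set \<Rightarrow> nat" where enc: "inj_on enc X" using finite_imp_inj_to_nat_seg by blast
  have "enc (g i v) = enc (g j v') \<longleftrightarrow> v = v' \<and> lk (al v) i j"
    if ij: "i \<in> H" "j \<in> H" "v \<in> L i" "v' \<in> L j" for i j v v'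
  proof -
    have "enc (g i v) = enc (g j v') \<longleftrightarrow> g i v = g j v'"
    proof (rule inj_on_eq_iff[OF enc])
      show "g i v \<in> X" "g j v' \<in> X" using ij by (auto simp: X_def)
    qed
    also have "\<dots> \<longleftrightarrow> v = v' \<and> lk (al v) i j"
    proof
      assume "g i v = g j v'"
      then have "v = v'" "j \<in> {k. lk (al v) j k} \<longrightarrow> j \<in> {k. lk (al v) i k}" by (auto simp: g_def)
      then show "v = v' \<and> lk (al v) i j" using lk_refl[OF ij(2) al] by simp
    next
      assume a: "v = v' \<and> lk (al v) i j"
      have "lk (al v) i k \<longleftrightarrow> lk (al v) j k" for k
        using a lk_trans[of "al v" i j k] lk_trans[of "al v" j i k] lk_sym[of "al v" i j] by blast
      then have "{k. lk (al v) i k} = {k. lk (al v) j k}" by (intro Collect_cong)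
      then show "g i v = g j v'" using a unfolding g_def by metis
    qed
    finally show ?thesis .
  qed
  then show ?thesis using that[of "\<lambda>i v. enc (g i v)"] by blast
qed

locale acyclic_cover = cover +
  fixes N :: nat
  assumes inc_all: "e \<in> E \<Longrightarrow> i \<in> Ix \<Longrightarrow> inc e i"
    and cyc: "3 \<le> n \<Longrightarrow> n \<le> N + 3 \<Longrightarrow> (\<And>i. i < n \<Longrightarrow> adj (\<alpha> i) (x i) (x (Suc i))) \<Longrightarrow> x n = x 0 \<Longrightarrow>
      \<exists>i m. 0 < i \<and> Suc i < n \<and> adj (\<alpha> (i - 1)) (x i) m \<and> adj (\<alpha> i) (x i) m \<and> adj (\<alpha> (Suc i)) (x (Suc i)) m"
begin

lemma lk_is_adj: "lk \<gamma> i j \<longleftrightarrow> adj \<gamma> i j"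
  using lk_iff_adj inc_all by blast

lemma triangle:
  assumes "adj \<alpha> x y" "adj \<beta> y z" "adj \<gamma> z x" shows "\<exists>m. adj \<alpha> y m \<and> adj \<beta> y m \<and> adj \<gamma> z m"
proof -
  have a: "adj ([\<alpha>, \<beta>, \<gamma>] ! i) ([x, y, z, x] ! i) ([x, y, z, x] ! Suc i)" if "i < 3" for i
    using that assms by (auto simp: less_Suc_eq numeral_3_eq_3)
  obtain i m where i: "0 < i" "Suc i < 3" "adj ([\<alpha>, \<beta>, \<gamma>] ! (i - 1)) ([x, y, z, x] ! i) m"
      "adj ([\<alpha>, \<beta>, \<gamma>] ! i) ([x, y, z, x] ! i) m" "adj ([\<alpha>, \<beta>, \<gamma>] ! Suc i) ([x, y, z, x] ! Suc i) m"
    using cyc[of 3 "\<lambda>i. [\<alpha>, \<beta>, \<gamma>] ! i" "\<lambda>i. [x, y, z, x] ! i"] a by auto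
  then have "i = 1" by simp
  then show ?thesis using i by (intro exI[of _ m]) simp
qed

definition "lab x = (SOME v. \<exists>i\<in>Ix. v \<in> L i \<and> x = el i v)"

lemma lab_el: assumes "i \<in> Ix" "v \<in> L i" shows "lab (el i v) = v"
proof -
  have "\<exists>j\<in>Ix. v \<in> L j \<and> el i v = el j v" using assms by blast
  then have "\<exists>j\<in>Ix. lab (el i v) \<in> L j \<and> el i v = el j (lab (el i v))" unfolding lab_def by (rule someI)
  then obtain j where j: "j \<in> Ix" "lab (el i v) \<in> L j" "el i v = el j (lab (el i v))" by metis
  then show ?thesis using el_eq[OF assms(1) j(1) assms(2) j(2)] by simp
qed

lemma u_lab: "j \<in> Ix \<Longrightarrow> x \<in> u j \<Longrightarrow> lab x \<in> L j \<and> x = el j (lab x)"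
  using lab_el[of j] unfolding u_def by auto

lemma u_adj: assumes "j \<in> Ix" "k \<in> Ix" "x \<in> u j" "x \<in> u k" shows "adj (al (lab x)) j k"
proof -
  have "el j (lab x) \<in> u k" "lab x \<in> L j" using u_lab[OF assms(1,3)] assms(4) by auto
  then show ?thesis using el_in_u[OF assms(1,2)] lk_is_adj by blast
qed

lemma adj_u: assumes "x \<in> u j" "adj (al (lab x)) j k" shows "x \<in> u k" "k \<in> Ix"
proof -
  have jk: "j \<in> Ix" "k \<in> Ix" using adj_in[OF assms(2)] by auto
  have l: "lab x \<in> L j" "x = el j (lab x)" using u_lab[OF jk(1) assms(1)] by auto
  have lk: "lk (al (lab x)) j k" using assms(2) lk_is_adj by blast
  then obtain w where w: "w \<in> lists (al (lab x))" "cwalk inc \<rho> j w" "k = fold \<rho> w j" by (auto simp: lk_def)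
  have "w \<in> lists E" using lists_subD[OF w(1) al_E] .
  moreover have "set w \<subseteq> al (lab x)" using w(1) by (auto simp: in_lists_conv_set)
  ultimately have "lab x \<in> L k" using walk_word[OF jk(1) _ w(2) l(1)] l(1) w(3) by blast
  then show "x \<in> u k" using el_in_u[OF jk l(1)] lk l(2) by simp
  show "k \<in> Ix" by (rule jk(2))
qed

text \<open>Cosets without short cycles have the Helly property. Once \<open>x\<close> is reached at
  \<open>m0\<close>, the other points are sought within \<open>\<beta> \<inter> al (lab x)\<close>.
  For each \<open>y\<close>, take the triangle of \<open>m0\<close>, a copy with \<open>y\<close>
  and a copy with both points; it has a centre that contains \<open>y\<close> and is reached from
  \<open>m0\<close> over both sets.\<close>

lemma helly:
  assumes "finite K" "\<And>x. x \<in> K \<Longrightarrow> \<exists>m. adj \<beta> i m \<and> x \<in> u m" "\<And>x y. x \<in> K \<Longrightarrow> y \<in> K \<Longrightarrow> \<exists>m\<in>Ix. x \<in> u m \<and> y \<in> u m"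
    and "i \<in> Ix" "\<beta> \<subseteq> E"
  shows "\<exists>m. adj \<beta> i m \<and> K \<subseteq> u m"
  using assms
proof (induction K arbitrary: \<beta> i rule: finite_induct)
  case empty
  then show ?case using adj_refl by blast
next
  case (insert x K)
  obtain m0 where m0: "adj \<beta> i m0" "x \<in> u m0" using insert.prems(1) by blast
  have m0I: "m0 \<in> Ix" using adj_in[OF m0(1)] by simp
  define \<delta> where "\<delta> = \<beta> \<inter> al (lab x)"
  have d: "\<delta> \<subseteq> E" using insert.prems(4) by (auto simp: \<delta>_def)
  have "\<exists>m. adj \<delta> m0 m \<and> y \<in> u m" if y: "y \<in> K" for y
  proof -
    obtain m1 where m1: "adj \<beta> i m1" "y \<in> u m1" using insert.prems(1) y by blast
    have m1I: "m1 \<in> Ix" using adj_in[OF m1(1)] by simp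
    obtain m2 where m2: "m2 \<in> Ix" "x \<in> u m2" "y \<in> u m2" using insert.prems(2)[of x y] y by blast
    obtain m where m: "adj \<beta> m1 m" "adj (al (lab y)) m1 m" "adj (al (lab x)) m2 m"
      using triangle[OF adj_trans[OF adj_sym[OF m0(1)] m1(1)] u_adj[OF m1I m2(1) m1(2) m2(3)] u_adj[OF m2(1) m0I m2(2) m0(2)]] by blast
    have "adj \<beta> m0 m" using adj_trans[OF adj_sym[OF m0(1)] adj_trans[OF m1(1) m(1)]] .
    moreover have "adj (al (lab x)) m0 m" using adj_trans[OF u_adj[OF m0I m2(1) m0(2) m2(2)] m(3)] .
    ultimately have "adj \<delta> m0 m" unfolding \<delta>_def using lk_meet lk_is_adj by blast
    then show ?thesis using adj_u(1)[OF m1(2) m(2)] by blast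
  qed
  then obtain m where m: "adj \<delta> m0 m" "K \<subseteq> u m" using insert.IH[of \<delta> m0] insert.prems(2) m0I d by blast
  have "adj \<beta> m0 m" by (rule adj_mono[OF m(1) _ insert.prems(4)]) (simp add: \<delta>_def)
  moreover have "adj (al (lab x)) m0 m" by (rule adj_mono[OF m(1) _ al_E]) (simp add: \<delta>_def)
  ultimately show ?case using adj_trans[OF m0(1)] adj_u(1)[OF m0(2)] m(2) by blast
qed

lemma gaifman_induced:
  assumes "a \<in> W" "b \<in> W"
  shows "gaifman (induced_hyperedges U W) a b \<longleftrightarrow> a \<noteq> b \<and> (\<exists>i\<in>Ix. a \<in> u i \<and> b \<in> u i)"
proof
  assume "gaifman (induced_hyperedges U W) a b"
  then show "a \<noteq> b \<and> (\<exists>i\<in>Ix. a \<in> u i \<and> b \<in> u i)"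
    unfolding gaifman_def induced_hyperedges_def U_def by auto
next
  assume a: "a \<noteq> b \<and> (\<exists>i\<in>Ix. a \<in> u i \<and> b \<in> u i)"
  then obtain i where i: "i \<in> Ix" "a \<in> u i" "b \<in> u i" by blast
  have "u i \<inter> W \<in> induced_hyperedges U W"
    unfolding induced_hyperedges_def U_def using assms(1) i by auto
  then show "gaifman (induced_hyperedges U W) a b"
    unfolding gaifman_def using a i(2,3) assms by (intro conjI bexI[of _ "u i \<inter> W"]) simp_all
qed

text \<open>Any two elements of a clique lie in a common copy, so \<open>helly\<close> applies, with
  the letters of one element \<open>x0\<close> as \<open>\<beta>\<close>.\<close>

lemma conformal:
  assumes W: "W \<subseteq> univ A" "finite W" and K: "K \<subseteq> W" "K \<noteq> {}" "clique (gaifman (induced_hyperedges U W)) K"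
  shows "\<exists>s\<in>induced_hyperedges U W. K \<subseteq> s"
proof -
  obtain x0 where x0: "x0 \<in> K" using K(2) by blast
  obtain i where i: "i \<in> Ix" "x0 \<in> u i" using x0 K(1) W(1) univ_A by auto
  have pair: "\<exists>m\<in>Ix. x \<in> u m \<and> y \<in> u m" if xy: "x \<in> K" "y \<in> K" for x y
  proof (cases "x = y")
    case True
    have "x \<in> univ A" using xy K(1) W(1) by blast
    then show ?thesis using True by (auto simp: univ_A)
  next
    case False
    then have "gaifman (induced_hyperedges U W) x y" using K(3) xy by (auto simp: clique_def)
    then show ?thesis using gaifman_induced[of x W y] xy K(1) by blast
  qed
  have "\<exists>m. adj (al (lab x0)) i m \<and> x \<in> u m" if x: "x \<in> K" for x
  proof -
    obtain m where "m \<in> Ix" "x0 \<in> u m" "x \<in> u m" using pair[OF x0 x] by blast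
    then show ?thesis using u_adj[OF i(1) _ i(2)] by blast
  qed
  then obtain m where m: "adj (al (lab x0)) i m" "K \<subseteq> u m"
    using helly[of K "al (lab x0)" i] pair i(1) al_E K(1) W(2) finite_subset by blast
  have "m \<in> Ix" using adj_in[OF m(1)] by simp
  then have "u m \<inter> W \<in> induced_hyperedges U W"
    using m(2) K(1,2) unfolding induced_hyperedges_def U_def by blast
  then show ?thesis using m(2) K(1) by blast
qed

lemma no_chordless_cycle:
  assumes W: "W \<subseteq> univ A" "finite W" "card W \<le> N" and xs: "set xs \<subseteq> W" "length xs > 3"
  shows "\<not> chordless_cycle (gaifman (induced_hyperedges U W)) xs"
proof
  assume c: "chordless_cycle (gaifman (induced_hyperedges U W)) xs"
  define n where "n = length xs"
  have n: "3 < n" "distinct xs" using xs(2) c by (simp_all add: n_def chordless_cycle_def)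
  have "n \<le> N" using card_mono[OF W(2) xs(1)] distinct_card[OF n(2)] W(3) by (simp add: n_def)
  have mem: "xs ! i \<in> W" if "i < n" for i using that xs(1) nth_mem by (auto simp: n_def)
  have edge: "gaifman (induced_hyperedges U W) (xs ! i) (xs ! (Suc i mod n))" if "i < n" for i
    using c that by (simp add: chordless_cycle_def n_def)
  have "\<exists>j. i < n \<longrightarrow> j \<in> Ix \<and> xs ! i \<in> u j \<and> xs ! (Suc i mod n) \<in> u j" for i
    using edge gaifman_induced[of "xs ! i" W "xs ! (Suc i mod n)"] mem[of i] mem[of "Suc i mod n"] n(1) by fastforce
  then obtain j where j: "\<And>i. i < n \<Longrightarrow> j i \<in> Ix" "\<And>i. i < n \<Longrightarrow> xs ! i \<in> u (j i)"
    "\<And>i. i < n \<Longrightarrow> xs ! (Suc i mod n) \<in> u (j i)" by metis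
  \<comment> \<open>Copy \<open>x i\<close> belongs to the edge that ends in \<open>xs ! i\<close>,
    so \<open>x i\<close> and \<open>x (Suc i)\<close> share \<open>xs ! i\<close>. The case
    distinction is the predecessor modulo \<open>n\<close>.\<close>
  define x where "x = (\<lambda>i. j (if i = 0 then n - 1 else i - 1))"
  have xI: "x i \<in> Ix" if "i \<le> n" for i using that j(1) n(1) by (auto simp: x_def)
  have left: "xs ! i \<in> u (x i)" if "i < n" for i
    using that j(3)[of "n - 1"] j(3)[of "i - 1"] n(1) by (cases "i = 0") (auto simp: x_def)
  have right: "xs ! i \<in> u (x (Suc i))" if "i < n" for i using that j(2)[of i] by (simp add: x_def)
  have "adj (al (lab (xs ! i))) (x i) (x (Suc i))" if "i < n" for i
    using u_adj[OF xI xI left[OF that] right[OF that]] that by simp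
  moreover have "x n = x 0" using n(1) by (simp add: x_def)
  \<comment> \<open>The copy \<open>m\<close> contains both neighbours of \<open>xs ! i\<close>.
    This is a chord, because the cycle has more than three vertices.\<close>
  ultimately obtain i m where i: "0 < i" "Suc i < n" "adj (al (lab (xs ! (i - 1)))) (x i) m"
      "adj (al (lab (xs ! Suc i))) (x (Suc i)) m"
    using cyc[of n "\<lambda>i. al (lab (xs ! i))" x] n(1) \<open>n \<le> N\<close> by auto
  have "xs ! (i - 1) \<in> u (x i)" using right[of "i - 1"] i(1,2) by simp
  then have 1: "xs ! (i - 1) \<in> u m" "m \<in> Ix" using adj_u i(3) by auto
  have 2: "xs ! Suc i \<in> u m" using adj_u(1)[OF left[OF i(2)] i(4)] .
  have lt: "i - 1 < n" "i - 1 \<noteq> Suc i" using i by auto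
  then have "xs ! (i - 1) \<noteq> xs ! Suc i" using n(2) i(2) nth_eq_iff_index_eq n_def by metis
  then have "gaifman (induced_hyperedges U W) (xs ! (i - 1)) (xs ! Suc i)"
    using gaifman_induced mem lt(1) i(2) 1 2 by blast
  then have "Suc i = Suc (i - 1) mod n \<or> i - 1 = Suc (Suc i) mod n"
    using c lt(1) i(2) unfolding chordless_cycle_def n_def by blast
  then show False
  proof
    assume "Suc i = Suc (i - 1) mod n"
    then show False using i(1,2) by simp
  next
    assume a: "i - 1 = Suc (Suc i) mod n"
    show False
    proof (cases "Suc (Suc i) = n")
      case True
      then show False using a i(1) n(1) by simp
    next
      case False
      then show False using a i(2) by simp
    qed
  qed
qed

lemma N_acyclic: "N_acyclic_hypergraph N (univ A) U"
  unfolding N_acyclic_hypergraph_def hypergraph_def acyclic_hypergraph_def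
proof (intro conjI allI impI ballI)
  fix s assume "s \<in> U"
  then obtain i where "i \<in> Ix" "s = u i" by (auto simp: U_def)
  then show "finite s" "s \<noteq> {}" using finite_L L_ne by (auto simp: u_def)
next
  show "univ A = \<Union>U" by (simp add: univ_A U_def)
next
  fix W assume W: "W \<subseteq> univ A \<and> finite W \<and> card W \<le> N"
  show "\<not> (\<exists>xs. set xs \<subseteq> W \<and> chordless_cycle (gaifman (induced_hyperedges U W)) xs \<and> length xs > 3)"
    using no_chordless_cycle[of W] W by blast
  show "\<exists>s\<in>induced_hyperedges U W. K \<subseteq> s"
    if "K \<subseteq> W \<and> K \<noteq> {} \<and> clique (gaifman (induced_hyperedges U W)) K" for K
    using conformal[of W K] W that by blast
qed

end

section \<open>From a symmetric solution to an acyclic one\<close>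

lemma isomorphism_rel:
  "isomorphism \<sigma> f A B \<Longrightarrow> R \<in> symbols \<sigma> \<Longrightarrow> length xs = arity \<sigma> R \<Longrightarrow> set xs \<subseteq> univ A \<Longrightarrow>
    xs \<in> rel A R \<longleftrightarrow> map f xs \<in> rel B R"
  by (simp add: isomorphism_def)

locale symmetric_solution = extension_problem \<sigma> A0 P for \<sigma> :: "'s signature" and A0 :: "('a, 's) struct" and P +
  fixes A1 :: "('b, 's) struct" and U1 :: "'b set set" and \<pi>1 :: "'b set \<Rightarrow> 'b \<Rightarrow> 'a" and u1 :: "'b set" and N :: nat
  assumes ne: "univ A0 \<noteq> {}" and ga: "good_atlas \<sigma> A0 P A1 U1 \<pi>1 u1"
begin

lemma fin1: "finite (univ A1)" and u1: "u1 \<in> U1"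
  and sub1: "s \<in> U1 \<Longrightarrow> s \<subseteq> univ A1" and iso1: "s \<in> U1 \<Longrightarrow> isomorphism \<sigma> (\<pi>1 s) (induced A1 s) A0"
  using ga by (auto simp: good_atlas_def fully_symmetric_atlas_def atlas_def)

lemma rigid1: "s \<in> U1 \<Longrightarrow> s' \<in> U1 \<Longrightarrow> \<exists>f. rigid_symmetry \<sigma> A1 U1 \<pi>1 f \<and> f ` s = s'"
  using ga by (simp add: good_atlas_def fully_symmetric_atlas_def)

lemma univ_ind: "s \<in> U1 \<Longrightarrow> univ (induced A1 s) = s"
  using sub1 by (auto simp: induced_def)

lemma bij1: "s \<in> U1 \<Longrightarrow> bij_betw (\<pi>1 s) s D"
  using iso1[of s] univ_ind[of s] by (simp add: isomorphism_def)

lemma rel1_iff: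
  assumes "s \<in> U1" "R \<in> symbols \<sigma>" "length xs = arity \<sigma> R" "set xs \<subseteq> s"
  shows "xs \<in> rel A1 R \<longleftrightarrow> map (\<pi>1 s) xs \<in> rel A0 R"
proof -
  have "xs \<in> rel (induced A1 s) R \<longleftrightarrow> map (\<pi>1 s) xs \<in> rel A0 R"
    by (rule isomorphism_rel[OF iso1[OF assms(1)] assms(2,3)]) (simp add: univ_ind[OF assms(1)] assms(4))
  then show ?thesis using assms(4) by (simp add: induced_def)
qed

lemma finU: "finite U1"
  using finite_subset[of U1 "Pow (univ A1)"] fin1 sub1 by blast

lemma change_word:
  assumes "s \<in> U1" "s' \<in> U1" "v0 \<in> s" "v0 \<in> s'"
  shows "\<exists>ps. set ps \<subseteq> P \<and> (\<forall>v\<in>s. word_comp D ps (\<pi>1 s v) = (if v \<in> s' then Some (\<pi>1 s' v) else None))"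
proof -
  have "s \<inter> s' \<noteq> {}" using assms by blast
  then obtain ps where ps: "set ps \<subseteq> P" "graph_on s' (\<pi>1 s') \<circ>\<^sub>m pinv (graph_on s (\<pi>1 s)) = word_comp D ps"
    using ga assms(1,2) unfolding good_atlas_def fully_symmetric_atlas_def by metis
  have "word_comp D ps (\<pi>1 s v) = (if v \<in> s' then Some (\<pi>1 s' v) else None)" if v: "v \<in> s" for v
  proof -
    have g: "graph_on s (\<pi>1 s) y = Some (\<pi>1 s v) \<longleftrightarrow> y = v" for y
      using bij1[OF assms(1)] v by (auto simp: graph_on_def bij_betw_def dest: inj_onD)
    then have "pinv (graph_on s (\<pi>1 s)) (\<pi>1 s v) = Some v" by (auto simp: pinv_def ran_def)
    then show ?thesis unfolding ps(2)[symmetric] by (simp add: map_comp_def graph_on_def)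
  qed
  then show ?thesis using ps(1) by blast
qed

definition E2 :: "('b set \<times> 'b set) set" where "E2 = {e \<in> U1 \<times> U1. fst e \<noteq> snd e \<and> fst e \<inter> snd e \<noteq> {}}"

definition pos2 :: "'b set \<times> 'b set \<Rightarrow> 'b set \<Rightarrow> 'b set" where
  "pos2 e t = (if t = fst e then snd e else if t = snd e then fst e else t)"

definition inc2 :: "'b set \<times> 'b set \<Rightarrow> 'b set \<Rightarrow> bool" where "inc2 e t = True"

text \<open>It has to bound the number of positions, the 4 of \<open>position_system\<close> and the
  length \<open>N + 3\<close> of the cycles in \<open>acyclic_cover\<close>, which includes
  triangles for every \<open>N\<close>.\<close>

definition M2 :: nat where "M2 = N + card U1 + 4"

definition al2 :: "'b \<Rightarrow> ('b set \<times> 'b set) set" where "al2 v = {e \<in> E2. v \<in> fst e \<and> v \<in> snd e}"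

sublocale PS: position_system E2 U1 pos2 inc2 M2
proof
  show "finite E2" using finU by (simp add: E2_def)
  show "eset E2 U1 pos2" using finU by (auto simp: eset_def E2_def pos2_def)
qed (auto simp: M2_def inc2_def)

definition c2 :: "'b set \<times> ('b set \<times> 'b set) list set \<Rightarrow> 'b \<Rightarrow> 'a" where "c2 i v = \<pi>1 (fst i) v"

lemma idx_U1: "i \<in> PS.A.idx \<Longrightarrow> fst i \<in> U1"
  by (auto simp: PS.A.idx_def)

lemma al2_E2: "al2 v \<subseteq> E2" by (auto simp: al2_def)

text \<open>The way from \<open>t\<close> through both ends of \<open>e\<close> to the new position
  is a word over \<open>P\<close>. If \<open>t\<close> is not an end, the letter does not move it,
  and this word is the identity on the labels common to all three domains. So no position has to be
  excluded, and \<open>inc2\<close> can be constant.\<close>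

lemma pos2_word:
  assumes t: "t \<in> U1" "v0 \<in> t" and e: "e \<in> al2 v0"
  shows "\<exists>ps. set ps \<subseteq> P \<and> (\<forall>v\<in>t. word_comp D ps (\<pi>1 t v) = (if e \<in> al2 v then Some (\<pi>1 (pos2 e t) v) else None))"
proof -
  have ee: "e \<in> E2" "fst e \<in> U1" "snd e \<in> U1" "v0 \<in> fst e" "v0 \<in> snd e" using e by (auto simp: al2_def E2_def)
  have t': "pos2 e t \<in> U1" "v0 \<in> pos2 e t" using t ee by (auto simp: pos2_def)
  obtain ps where ps: "set ps \<subseteq> P" "\<And>v. v \<in> t \<Longrightarrow> word_comp D ps (\<pi>1 t v) = (if v \<in> fst e then Some (\<pi>1 (fst e) v) else None)"
    using change_word[OF t(1) ee(2) t(2) ee(4)] by metis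
  obtain qs where qs: "set qs \<subseteq> P" "\<And>v. v \<in> fst e \<Longrightarrow> word_comp D qs (\<pi>1 (fst e) v) = (if v \<in> snd e then Some (\<pi>1 (snd e) v) else None)"
    using change_word[OF ee(2,3,4,5)] by metis
  obtain rs where rs: "set rs \<subseteq> P" "\<And>v. v \<in> snd e \<Longrightarrow> word_comp D rs (\<pi>1 (snd e) v) = (if v \<in> pos2 e t then Some (\<pi>1 (pos2 e t) v) else None)"
    using change_word[OF ee(3) t'(1) ee(5) t'(2)] by metis
  have "word_comp D (ps @ qs @ rs) (\<pi>1 t v) = (if e \<in> al2 v then Some (\<pi>1 (pos2 e t) v) else None)" if v: "v \<in> t" for v
  proof -
    have "e \<in> al2 v \<longleftrightarrow> v \<in> fst e \<and> v \<in> snd e" using ee(1) by (simp add: al2_def)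
    moreover have "v \<in> pos2 e t" if "v \<in> fst e" "v \<in> snd e" using v that by (simp add: pos2_def)
    ultimately show ?thesis
      using ps(2)[OF v] qs(2)[of v] rs(2)[of v]
      by (auto simp: word_comp_append[OF words_ran[OF ps(1)]] word_comp_append[OF words_ran[OF qs(1)]] map_comp_def)
  qed
  then show ?thesis using ps(1) qs(1) rs(1) by (intro exI[of _ "ps @ qs @ rs"]) auto
qed

text \<open>All domains have the size of \<open>A0\<close>. A domain inside both ends of a letter
  would thus equal both, but the ends are distinct.\<close>

lemma al2_Int: "t \<in> U1 \<Longrightarrow> (\<Inter>v\<in>t. al2 v) = {}"
proof (rule ccontr)
  assume t: "t \<in> U1" and "(\<Inter>v\<in>t. al2 v) \<noteq> {}"
  then obtain e where e: "\<And>v. v \<in> t \<Longrightarrow> e \<in> al2 v" by blast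
  have "t \<noteq> {}" using bij1[OF t] ne by (auto simp: bij_betw_def)
  then obtain x where "x \<in> t" by blast
  then have e2: "fst e \<in> U1" "snd e \<in> U1" "fst e \<noteq> snd e" using e[of x] by (simp_all add: al2_def E2_def mem_Times_iff)
  have "t = s" if s: "s \<in> U1" "t \<subseteq> s" for s
  proof (rule card_subset_eq[OF _ s(2)])
    show "finite s" using sub1[OF s(1)] fin1 finite_subset by blast
    show "card t = card s" using bij_betw_same_card[OF bij1[OF t]] bij_betw_same_card[OF bij1[OF s(1)]] by simp
  qed
  moreover have "t \<subseteq> fst e" "t \<subseteq> snd e" using e by (auto simp: al2_def)
  ultimately show False using e2 by blast
qed

text \<open>An automorphism that extends \<open>p\<close> need not respect the charts. On each
  domain the defect is an automorphism of \<open>A0\<close>, which the parameter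
  \<open>\<kappa>\<close> of \<open>symm\<close> allows for.\<close>

lemma chart_automorphism:
  assumes F: "automorphism \<sigma> A1 F" and t: "t \<in> U1" "F ` t \<in> U1"
  shows "\<exists>\<kappa>. automorphism \<sigma> A0 \<kappa> \<and> (\<forall>v\<in>t. \<pi>1 (F ` t) (F v) = \<kappa> (\<pi>1 t v))"
proof -
  define g where "g = inv_into t (\<pi>1 t)"
  define \<kappa> where "\<kappa> = (\<lambda>x. \<pi>1 (F ` t) (F (g x)))"
  have g: "bij_betw g D t" unfolding g_def by (rule bij_betw_inv_into[OF bij1[OF t(1)]])
  have gt: "g x \<in> t" "\<pi>1 t (g x) = x" if "x \<in> D" for x
    using bij1[OF t(1)] that by (auto simp: g_def bij_betw_def f_inv_into_f inv_into_into)
  have Fi: "inj_on F (univ A1)" using F by (simp add: automorphism_def isomorphism_def bij_betw_def)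
  have "bij_betw F t (F ` t)" using Fi sub1[OF t(1)] by (auto simp: bij_betw_def intro: inj_on_subset)
  then have "bij_betw (\<pi>1 (F ` t) \<circ> (F \<circ> g)) D D" using bij_betw_trans[OF bij_betw_trans[OF g] bij1[OF t(2)]] by blast
  then have b: "bij_betw \<kappa> D D" by (simp add: \<kappa>_def comp_def)
  have "xs \<in> rel A0 R \<longleftrightarrow> map \<kappa> xs \<in> rel A0 R"
    if R: "R \<in> symbols \<sigma>" and xs: "length xs = arity \<sigma> R" "set xs \<subseteq> D" for R xs
  proof -
    have 1: "map (\<pi>1 t) (map g xs) = xs" unfolding map_map by (rule map_idI) (use xs gt in auto)
    have 2: "set (map g xs) \<subseteq> t" using xs gt by auto
    have "xs \<in> rel A0 R \<longleftrightarrow> map g xs \<in> rel A1 R" using rel1_iff[OF t(1) R _ 2] 1 xs(1) by simp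
    also have "\<dots> \<longleftrightarrow> map F (map g xs) \<in> rel A1 R"
      using isomorphism_rel[of \<sigma> F A1 A1 R "map g xs"] F R xs(1) 2 sub1[OF t(1)] by (auto simp: automorphism_def)
    also have "\<dots> \<longleftrightarrow> map (\<pi>1 (F ` t)) (map F (map g xs)) \<in> rel A0 R"
      by (rule rel1_iff[OF t(2) R]) (use xs(1) 2 in auto)
    also have "map (\<pi>1 (F ` t)) (map F (map g xs)) = map \<kappa> xs" by (simp add: \<kappa>_def)
    finally show ?thesis .
  qed
  then have "automorphism \<sigma> A0 \<kappa>" using b by (simp add: automorphism_def isomorphism_def)
  moreover have "\<pi>1 (F ` t) (F v) = \<kappa> (\<pi>1 t v)" if "v \<in> t" for v
    using bij1[OF t(1)] that by (simp add: \<kappa>_def g_def bij_betw_def)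
  ultimately show ?thesis by blast
qed

end

locale symmetric_solution_cover = symmetric_solution +
  fixes el2 :: "'c set \<times> ('c set \<times> 'c set) list set \<Rightarrow> 'c \<Rightarrow> nat"
  assumes el2_eq: "i \<in> PS.A.idx \<Longrightarrow> j \<in> PS.A.idx \<Longrightarrow> v \<in> fst i \<Longrightarrow> v' \<in> fst j \<Longrightarrow>
      el2 i v = el2 j v' \<longleftrightarrow> v = v' \<and> PS.A.I.lk (al2 v) i j"
begin

sublocale C: acyclic_cover \<sigma> A0 P E2 PS.A.idx PS.A.mv "\<lambda>e p. inc2 e (fst p)" al2 fst c2 el2 N
proof
  show "univ A0 \<noteq> {}" by (rule ne)
  show "bij_betw (c2 i) (fst i) D" if "i \<in> PS.A.idx" for i
    using bij1[OF idx_U1[OF that]] by (simp add: c2_def[abs_def])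
  show "v \<in> fst (PS.A.mv e i)" if "v \<in> fst i" "e \<in> al2 v" for i e v
    using that by (simp add: PS.A.mv_def pos2_def al2_def)
  show "PS.A.I.lk (\<alpha> \<inter> \<beta>) i j" if "PS.A.I.lk \<alpha> i j" "PS.A.I.lk \<beta> i j" for \<alpha> \<beta> i j
  proof -
    have e: "PS.A.I.lk \<gamma> i j \<longleftrightarrow> PS.A.I.adj \<gamma> i j" for \<gamma> by (rule PS.A.I.lk_iff_adj) (simp add: inc2_def)
    show ?thesis using that PS.A.adj_meet unfolding e by blast
  qed
  show "al2 v \<subseteq> E2" for v by (rule al2_E2)
  show "el2 i v = el2 j v' \<longleftrightarrow> v = v' \<and> PS.A.I.lk (al2 v) i j"
    if "i \<in> PS.A.idx" "j \<in> PS.A.idx" "v \<in> fst i" "v' \<in> fst j" for i j v v' using el2_eq[OF that] .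
  show "\<exists>ps. set ps \<subseteq> P \<and> (\<forall>v\<in>fst i. word_comp D ps (c2 i v) = (if e \<in> al2 v then Some (c2 (PS.A.mv e i) v) else None))"
    if "i \<in> PS.A.idx" "v0 \<in> fst i" "e \<in> al2 v0" for i e v0
    unfolding c2_def PS.A.mv_def fst_conv by (rule pos2_word[OF idx_U1[OF that(1)] that(2,3)])
  show "(\<Inter>v\<in>fst i. al2 v) = {}" if "i \<in> PS.A.idx" for i using al2_Int[OF idx_U1[OF that]] .
  show "inc2 e (fst i)" for e i by (simp add: inc2_def)
  show "\<exists>i m. 0 < i \<and> Suc i < n \<and> PS.A.I.adj (\<alpha> (i - 1)) (x i) m \<and> PS.A.I.adj (\<alpha> i) (x i) m \<and> PS.A.I.adj (\<alpha> (Suc i)) (x (Suc i)) m"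
    if "3 \<le> n" "n \<le> N + 3" "\<And>i. i < n \<Longrightarrow> PS.A.I.adj (\<alpha> i) (x i) (x (Suc i))" "x n = x 0" for n \<alpha> x
  proof -
    have "n \<le> M2" using that(2) by (simp add: M2_def)
    then show ?thesis using PS.A.adj_cycle[OF that(1) _ that(3,4)] by metis
  qed
qed

lemma image_E2:
  assumes F: "automorphism \<sigma> A1 F" "bij_betw (image F) U1 U1" and e: "e \<in> E2"
  shows "map_prod (image F) (image F) e \<in> E2"
proof -
  have Fi: "inj_on F (univ A1)" using F(1) by (simp add: automorphism_def isomorphism_def bij_betw_def)
  have e': "fst e \<in> U1" "snd e \<in> U1" "fst e \<noteq> snd e" "fst e \<inter> snd e \<noteq> {}" using e by (auto simp: E2_def)
  then have "F ` fst e \<in> U1" "F ` snd e \<in> U1" using F(2) by (auto simp: bij_betw_def)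
  moreover have "F ` fst e \<noteq> F ` snd e" using inj_on_image_eq_iff[OF Fi sub1[OF e'(1)] sub1[OF e'(2)]] e'(3) by simp
  moreover have "F ` fst e \<inter> F ` snd e \<noteq> {}" using e'(4) by blast
  ultimately show ?thesis by (simp add: E2_def mem_Times_iff)
qed

lemma lift_symmetry:
  assumes F: "automorphism \<sigma> A1 F" "bij_betw (image F) U1 U1" and z: "z \<in> lists E2"
    and \<kappa>: "\<And>t. t \<in> U1 \<Longrightarrow> automorphism \<sigma> A0 (\<kappa> t) \<and> (\<forall>v\<in>t. \<pi>1 (F ` t) (F v) = \<kappa> t (\<pi>1 t v))"
  shows "\<exists>f. C.symm f F (\<lambda>i. \<kappa> (fst i)) \<and> (\<forall>t. \<forall>w\<in>lists E2. f (t, rel1 M2 (grel M2) E2 `` {w}) =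
    (F ` t, rel1 M2 (grel M2) E2 `` {z @ map (map_prod (image F) (image F)) w}))"
proof -
  define g where "g = map_prod (image F) (image F)"
  have Fi: "inj_on F (univ A1)" using F(1) by (simp add: automorphism_def isomorphism_def bij_betw_def)
  have FU: "F ` s \<in> U1" if "s \<in> U1" for s using F(2) that by (auto simp: bij_betw_def)
  have Feq: "F ` s = F ` s' \<longleftrightarrow> s = s'" if "s \<in> U1" "s' \<in> U1" for s s'
    using inj_on_image_eq_iff[OF Fi sub1[OF that(1)] sub1[OF that(2)]] .
  have Fm: "F v \<in> F ` s \<longleftrightarrow> v \<in> s" if "s \<in> U1" "v \<in> univ A1" for s v
    using inj_on_image_mem_iff[OF Fi that(2) sub1[OF that(1)]] .
  have gE: "g e \<in> E2" if "e \<in> E2" for e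
    using image_E2[OF F that] by (simp add: g_def)
  have "inj_on g E2"
    by (rule inj_onI) (auto simp: E2_def g_def Feq)
  moreover have "g ` E2 \<subseteq> E2" using gE by blast
  ultimately have gb: "bij_betw g E2 E2" using endo_inj_surj[of E2 g] PS.finE by (simp add: bij_betw_def)
  interpret Y: index_symmetry E2 "rel1 M2 (grel M2) E2" U1 pos2 inc2 g "image F" z
  proof
    show "bij_betw g E2 E2" by (rule gb)
    show "(map g u, map g v) \<in> rel1 M2 (grel M2) E2 \<longleftrightarrow> (u, v) \<in> rel1 M2 (grel M2) E2"
      if "u \<in> lists E2" "v \<in> lists E2" for u v
      by (rule letter_map_iff[OF gb _ that, of "rel1 M2 (grel M2)"]) (rule rel1_map[OF PS.finE])
    show "bij_betw (image F) U1 U1" by (rule F(2))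
    show "pos2 (g e) (F ` t) = F ` pos2 e t" if "e \<in> E2" "t \<in> U1" for e t
      using that Feq[of t "fst e"] Feq[of t "snd e"] by (auto simp: pos2_def g_def E2_def)
    show "inc2 (g e) (F ` t) \<longleftrightarrow> inc2 e t" for e t by (simp add: inc2_def)
    show "z \<in> lists E2" by (rule z)
  qed
  have fst_sy: "fst (Y.sy i) = F ` fst i" for i by (simp add: Y.sy_def)
  have alF: "al2 (F v) = g ` al2 v" if v: "v \<in> univ A1" for v
  proof (intro subset_antisym subsetI)
    fix e assume e: "e \<in> al2 (F v)"
    then have "e \<in> g ` E2" using gb by (simp add: bij_betw_def al2_def)
    then obtain e0 where e0: "e0 \<in> E2" "e = g e0" by (metis imageE)
    have "F v \<in> F ` fst e0" "F v \<in> F ` snd e0" using e e0 by (auto simp: al2_def g_def)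
    then have "v \<in> fst e0" "v \<in> snd e0" using e0(1) Fm[OF _ v, of "fst e0"] Fm[OF _ v, of "snd e0"] by (simp_all add: E2_def mem_Times_iff)
    then have "e0 \<in> al2 v" using e0(1) by (simp add: al2_def)
    then show "e \<in> g ` al2 v" using e0(2) by blast
  next
    fix e assume "e \<in> g ` al2 v"
    then obtain e0 where "e0 \<in> al2 v" "e = g e0" by blast
    then show "e \<in> al2 (F v)" using gE[of e0] by (auto simp: al2_def g_def)
  qed
  have "C.symm Y.sy F (\<lambda>i. \<kappa> (fst i))"
    unfolding C.symm_def
  proof (intro conjI ballI)
    show "bij_betw Y.sy PS.A.idx PS.A.idx" by (rule Y.sy_bij)
    have "(\<Union>i\<in>PS.A.idx. fst i) \<subseteq> univ A1" using idx_U1 sub1 by blast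
    then show "inj_on F (\<Union>i\<in>PS.A.idx. fst i)" using Fi inj_on_subset by blast
    show "automorphism \<sigma> A0 (\<kappa> (fst i))" if "i \<in> PS.A.idx" for i using \<kappa>[OF idx_U1[OF that]] by simp
    show "F v \<in> fst (Y.sy i)" if "v \<in> fst i" for i v using that by (simp add: fst_sy)
    show "c2 (Y.sy i) (F v) = \<kappa> (fst i) (c2 i v)" if "i \<in> PS.A.idx" "v \<in> fst i" for i v
      using \<kappa>[OF idx_U1[OF that(1)]] that(2) by (simp add: c2_def fst_sy)
    show "PS.A.I.lk (al2 (F v)) (Y.sy i) (Y.sy j) \<longleftrightarrow> PS.A.I.lk (al2 v) i j"
      if "i \<in> PS.A.idx" "j \<in> PS.A.idx" "v \<in> fst i" for i j v
    proof -
      have "v \<in> univ A1" using that(3) sub1[OF idx_U1[OF that(1)]] by blast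
      then show ?thesis using Y.sy_lk[OF that(1,2) al2_E2] by (simp add: alF)
    qed
  qed
  moreover have "Y.sy (t, rel1 M2 (grel M2) E2 `` {w}) = (F ` t, rel1 M2 (grel M2) E2 `` {z @ map g w})"
    if "w \<in> lists E2" for t w using Y.sy_at[OF that] .
  ultimately show ?thesis unfolding g_def[symmetric] by blast
qed

lemma good_cover: "good_atlas \<sigma> A0 P C.A C.U C.\<pi> (C.u (u1, rel1 M2 (grel M2) E2 `` {[]}))"
proof (rule C.good)
  let ?cl = "\<lambda>w. rel1 M2 (grel M2) E2 `` {w}"
  have i0: "(u1, ?cl []) \<in> PS.A.idx" using PS.A.at_idx[OF u1, of "[]"] by simp
  then show "(u1, ?cl []) \<in> PS.A.idx" .
  have aut: "bij_betw (image F) U1 U1 \<Longrightarrow> t \<in> U1 \<Longrightarrow> F ` t \<in> U1" for F t by (auto simp: bij_betw_def)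
  show "\<exists>f h. C.symm f h (\<lambda>_. id) \<and> f i = j" if ij: "i \<in> PS.A.idx" "j \<in> PS.A.idx" for i j
  proof -
    obtain t w where i: "t \<in> U1" "w \<in> lists E2" "i = (t, ?cl w)" using PS.A.idx_at[OF ij(1)] by blast
    obtain t' w' where j: "t' \<in> U1" "w' \<in> lists E2" "j = (t', ?cl w')" using PS.A.idx_at[OF ij(2)] by blast
    obtain F where F: "rigid_symmetry \<sigma> A1 U1 \<pi>1 F" "F ` t = t'" using rigid1[OF i(1) j(1)] by blast
    define w2 where "w2 = map (map_prod (image F) (image F)) w"
    have F': "automorphism \<sigma> A1 F" "bij_betw (image F) U1 U1"
      "\<And>t. t \<in> U1 \<Longrightarrow> automorphism \<sigma> A0 id \<and> (\<forall>v\<in>t. \<pi>1 (F ` t) (F v) = id (\<pi>1 t v))"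
      using F(1) by (simp_all add: rigid_symmetry_def C.automorphism_id)
    have w2: "w2 \<in> lists E2"
      using i(2) image_E2[OF F'(1,2)] by (auto simp: w2_def in_lists_conv_set)
    \<comment> \<open>Left multiplication by this word takes the image \<open>w2\<close> of
      \<open>w\<close> to \<open>w'\<close>.\<close>
    have "w' @ rev w2 \<in> lists E2" using j(2) w2 by simp
    then obtain f where f: "C.symm f F (\<lambda>_. id)" "\<forall>t. \<forall>w\<in>lists E2. f (t, ?cl w) =
        (F ` t, ?cl ((w' @ rev w2) @ map (map_prod (image F) (image F)) w))"
      using lift_symmetry[OF F'(1,2) _ F'(3)] by blast
    have "f (t, ?cl w) = (F ` t, ?cl ((w' @ rev w2) @ w2))" using bspec[OF spec[OF f(2), of t] i(2)] by (simp only: w2_def)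
    then have "f i = j" using F(2) i(3) j(3) PS.A.class_cancel[OF j(2) w2] by simp
    then show ?thesis using f(1) by blast
  qed
  show "\<exists>f h \<kappa>. C.symm f h \<kappa> \<and> (\<forall>v\<in>fst (u1, ?cl []). \<forall>v'\<in>fst (u1, ?cl []). p (c2 (u1, ?cl []) v) = Some (c2 (u1, ?cl []) v') \<longrightarrow>
      h v = v' \<and> PS.A.I.lk (al2 v') (f (u1, ?cl [])) (u1, ?cl []))" if p: "p \<in> P" for p
  proof -
    obtain F where F: "automorphism \<sigma> A1 F" "bij_betw (image F) U1 U1"
      "\<And>v v'. v \<in> u1 \<Longrightarrow> v' \<in> u1 \<Longrightarrow> p (\<pi>1 u1 v) = Some (\<pi>1 u1 v') \<Longrightarrow> F v = v'"
      using ga p by (auto simp: good_atlas_def)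
    have "\<exists>\<kappa>. automorphism \<sigma> A0 \<kappa> \<and> (\<forall>v\<in>t. \<pi>1 (F ` t) (F v) = \<kappa> (\<pi>1 t v))" if "t \<in> U1" for t
      using chart_automorphism[OF F(1) that aut[OF F(2) that]] .
    then have "\<forall>t\<in>U1. \<exists>\<kappa>. automorphism \<sigma> A0 \<kappa> \<and> (\<forall>v\<in>t. \<pi>1 (F ` t) (F v) = \<kappa> (\<pi>1 t v))" by (rule ballI)
    then obtain \<kappa> where \<kappa>': "\<forall>t\<in>U1. automorphism \<sigma> A0 (\<kappa> t) \<and> (\<forall>v\<in>t. \<pi>1 (F ` t) (F v) = \<kappa> t (\<pi>1 t v))"
      by (rule bchoice[THEN exE])
    then have \<kappa>: "t \<in> U1 \<Longrightarrow> automorphism \<sigma> A0 (\<kappa> t) \<and> (\<forall>v\<in>t. \<pi>1 (F ` t) (F v) = \<kappa> t (\<pi>1 t v))" for t by (rule bspec)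
    \<comment> \<open>The base copy should go to its neighbour along this letter. If the pair is not
      a letter, the image of \<open>u1\<close> is \<open>u1\<close> itself or disjoint from it: then
      the index stays in place, or there is nothing to glue.\<close>
    define \<epsilon> where "\<epsilon> = (u1, F ` u1)"
    define z where "z = (if \<epsilon> \<in> E2 then [\<epsilon>] else [])"
    have "z \<in> lists E2" by (simp add: z_def)
    then obtain f where f': "C.symm f F (\<lambda>i. \<kappa> (fst i))" "\<forall>t. \<forall>w\<in>lists E2. f (t, ?cl w) =
        (F ` t, ?cl (z @ map (map_prod (image F) (image F)) w))"
      using lift_symmetry[OF F(1,2) _ \<kappa>] by blast
    have f: "C.symm f F (\<lambda>i. \<kappa> (fst i))" "f (u1, ?cl []) = (F ` u1, ?cl z)" using f'(1) bspec[OF spec[OF f'(2), of u1], of "[]"] by simp_all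
    have "F v = v' \<and> PS.A.I.lk (al2 v') (f (u1, ?cl [])) (u1, ?cl [])"
      if v: "v \<in> u1" "v' \<in> u1" "p (\<pi>1 u1 v) = Some (\<pi>1 u1 v')" for v v'
    proof -
      have Fv: "F v = v'" using F(3)[OF v] .
      then have v': "v' \<in> u1" "v' \<in> F ` u1" using v by auto
      have "PS.A.I.lk (al2 v') (f (u1, ?cl [])) (u1, ?cl [])"
      proof (cases "F ` u1 = u1")
        case True
        then have "f (u1, ?cl []) = (u1, ?cl [])" using f(2) by (simp add: z_def \<epsilon>_def E2_def)
        then show ?thesis using PS.A.I.lk_refl[OF i0 al2_E2] by simp
      next
        case False
        then have e: "\<epsilon> \<in> E2" "\<epsilon> \<in> al2 v'" using v' u1 aut[OF F(2) u1] by (auto simp: \<epsilon>_def E2_def al2_def)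
        have "PS.A.mv \<epsilon> (u1, ?cl []) = f (u1, ?cl [])"
          using PS.A.mv_at[of "[]" \<epsilon> u1] e(1) f(2) by (simp add: z_def pos2_def \<epsilon>_def)
        then show ?thesis using PS.A.lk_mv[OF i0 al2_E2 e(2)] by (simp add: inc2_def)
      qed
      then show ?thesis using Fv by blast
    qed
    then show ?thesis using f(1) unfolding c2_def fst_conv by blast
  qed
qed

end

lemma (in symmetric_solution) N_acyclic_solution:
  "\<exists>(A :: (nat, 's) struct) U \<pi> u0. good_atlas \<sigma> A0 P A U \<pi> u0 \<and> N_acyclic_hypergraph N (univ A) U"
proof -
  have fin: "finite (fst i)" if "i \<in> PS.A.idx" for i using finite_subset[OF sub1[OF idx_U1[OF that]] fin1] .
  show ?thesis
  proof (rule PS.A.I.exists_labelling[of fst al2, OF fin al2_E2])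
    fix el :: "'b set \<times> ('b set \<times> 'b set) list set \<Rightarrow> 'b \<Rightarrow> nat"
    assume el: "\<And>i j v v'. i \<in> PS.A.idx \<Longrightarrow> j \<in> PS.A.idx \<Longrightarrow> v \<in> fst i \<Longrightarrow> v' \<in> fst j \<Longrightarrow>
      el i v = el j v' \<longleftrightarrow> v = v' \<and> PS.A.I.lk (al2 v) i j"
    interpret S: symmetric_solution_cover \<sigma> A0 P A1 U1 \<pi>1 u1 N el
      by unfold_locales (rule el)
    show ?thesis using S.good_cover S.C.N_acyclic by blast
  qed
qed

section \<open>A symmetric solution\<close>

lemma word_comp_single: "x \<in> V \<Longrightarrow> word_comp V [p] x = p x"
  by (simp add: word_comp_def graph_on_def)

lemma partial_iso_inj: assumes "partial_iso \<sigma> A p" "p x = Some z" "p y = Some z" shows "x = y"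
proof -
  have "inj_on (\<lambda>x. the (p x)) (univ A \<inter> dom p)"
    using assms(1) by (simp add: partial_iso_def isomorphism_def bij_betw_def induced_def)
  moreover have "x \<in> univ A \<inter> dom p" "y \<in> univ A \<inter> dom p" using assms by (auto simp: partial_iso_def)
  ultimately show ?thesis using assms(2,3) by (simp add: inj_on_def)
qed

lemma pinv_Some: assumes "partial_iso \<sigma> A p" "p x = Some y" shows "pinv p y = Some x"
proof -
  have "(THE x. p x = Some y) = x" using partial_iso_inj[OF assms(1) _ assms(2)] assms(2) by blast
  then show ?thesis using assms(2) by (auto simp: pinv_def ran_def)
qed

lemma pinv_None: "y \<notin> ran p \<Longrightarrow> pinv p y = None"
  by (simp add: pinv_def)

text \<open>A frame is a permutation of the base set that identifies the labels with the elements of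
  one copy of it; a letter matches two frames along the label set \<open>X\<close>.\<close>

locale permutation_cover = extension_problem \<sigma> A0 P for \<sigma> :: "'s signature" and A0 :: "('a, 's) struct" and P +
  assumes ne: "univ A0 \<noteq> {}"
begin

text \<open>In frame \<open>h\<close> the label \<open>v\<close> names the element
  \<open>inv h v\<close>. The word has to translate from one naming to the other on exactly the
  labels in \<open>X\<close>.\<close>

definition matched :: "('a \<Rightarrow> 'a) \<Rightarrow> ('a \<Rightarrow> 'a) \<Rightarrow> 'a set \<Rightarrow> bool" where
  "matched h h' X \<longleftrightarrow> (\<exists>ps. set ps \<subseteq> P \<and> (\<forall>v\<in>D. word_comp D ps (inv h v) = (if v \<in> X then Some (inv h' v) else None)))"

definition V1 :: "('a \<Rightarrow> 'a) set" where "V1 = {h. h permutes D}"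

text \<open>With \<open>X = D\<close> a letter would belong to all labels and violate
  \<open>al_Int\<close>; total members of \<open>P\<close> are therefore realized through
  \<open>mover\<close>. Matching is required both ways because a letter is traversed in both
  directions.\<close>

definition E1 :: "(('a \<Rightarrow> 'a) \<times> ('a \<Rightarrow> 'a) \<times> 'a set) set" where
  "E1 = {(h, h', X). h permutes D \<and> h' permutes D \<and> X \<subset> D \<and> matched h h' X \<and> matched h' h X}"

definition pos1 :: "('a \<Rightarrow> 'a) \<times> ('a \<Rightarrow> 'a) \<times> 'a set \<Rightarrow> ('a \<Rightarrow> 'a) \<Rightarrow> ('a \<Rightarrow> 'a)" where
  "pos1 e t = (if t = fst e then fst (snd e) else if t = fst (snd e) then fst e else t)"

definition inc1 :: "('a \<Rightarrow> 'a) \<times> ('a \<Rightarrow> 'a) \<times> 'a set \<Rightarrow> ('a \<Rightarrow> 'a) \<Rightarrow> bool" where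
  "inc1 e t \<longleftrightarrow> t = fst e \<or> t = fst (snd e)"

definition M1 :: nat where "M1 = card V1 + 4"

definition al1 :: "'a \<Rightarrow> (('a \<Rightarrow> 'a) \<times> ('a \<Rightarrow> 'a) \<times> 'a set) set" where "al1 v = {e \<in> E1. v \<in> snd (snd e)}"

lemma finite_V1: "finite V1"
  unfolding V1_def by (rule finite_permutations[OF finite_D])

lemma E1_V1: "e \<in> E1 \<Longrightarrow> fst e \<in> V1" "e \<in> E1 \<Longrightarrow> fst (snd e) \<in> V1"
  by (auto simp: E1_def V1_def)

sublocale PS: position_system E1 V1 pos1 inc1 M1
proof
  have "E1 \<subseteq> V1 \<times> V1 \<times> Pow D" by (auto simp: E1_def V1_def)
  then show "finite E1" using finite_V1 finite_D finite_subset by blast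
  show "eset E1 V1 pos1" unfolding eset_def using finite_V1 E1_V1 by (auto simp: pos1_def)
qed (auto simp: M1_def inc1_def pos1_def)

definition c1 :: "('a \<Rightarrow> 'a) \<times> (('a \<Rightarrow> 'a) \<times> ('a \<Rightarrow> 'a) \<times> 'a set) list set \<Rightarrow> 'a \<Rightarrow> 'a" where
  "c1 i = inv (fst i)"

lemma al1_E1: "al1 v \<subseteq> E1" by (auto simp: al1_def)

lemma idx_V1: "i \<in> PS.G.idx \<Longrightarrow> fst i permutes D"
  using PS.G.idx_at[of i] by (auto simp: V1_def)

text \<open>The words for \<open>\<tau>\<close> and its inverse ensure that matchings conjugated by
  \<open>\<tau>\<close> still come from \<open>P\<close>.\<close>

definition mover :: "('a \<Rightarrow> 'a) \<Rightarrow> bool" where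
  "mover \<tau> \<longleftrightarrow> \<tau> permutes D \<and> automorphism \<sigma> A0 \<tau> \<and> (\<exists>ps. set ps \<subseteq> P \<and> (\<forall>x\<in>D. word_comp D ps x = Some (\<tau> x))) \<and>
     (\<exists>ps. set ps \<subseteq> P \<and> (\<forall>x\<in>D. word_comp D ps x = Some (inv \<tau> x)))"

lemma mover_id: "mover id"
  unfolding mover_def
proof (intro conjI exI[of _ "[]"])
  show "automorphism \<sigma> A0 id" by (simp add: automorphism_def isomorphism_def)
qed (auto simp: permutes_id word_comp_Nil)

text \<open>Labels are renamed by \<open>s\<close> and elements are moved by \<open>\<tau>\<close>:
  in the new frame \<open>s v\<close> names the \<open>\<tau>\<close>-image of what \<open>v\<close>
  named before.\<close>

definition fr :: "('a \<Rightarrow> 'a) \<Rightarrow> ('a \<Rightarrow> 'a) \<Rightarrow> ('a \<Rightarrow> 'a) \<Rightarrow> ('a \<Rightarrow> 'a)" where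
  "fr s \<tau> t = s \<circ> t \<circ> inv \<tau>"

lemma fr_permutes: "s permutes D \<Longrightarrow> \<tau> permutes D \<Longrightarrow> t permutes D \<Longrightarrow> fr s \<tau> t permutes D"
  unfolding fr_def by (intro permutes_compose permutes_inv)

lemma inv_fr: assumes "s permutes D" "\<tau> permutes D" "t permutes D" shows "inv (fr s \<tau> t) = \<tau> \<circ> inv t \<circ> inv s"
proof -
  note b = assms[THEN permutes_bij]
  have "inv (s \<circ> t \<circ> inv \<tau>) = inv (inv \<tau>) \<circ> inv (s \<circ> t)" using b by (intro o_inv_distrib bij_comp bij_imp_bij_inv)
  also have "inv (s \<circ> t) = inv t \<circ> inv s" using b by (intro o_inv_distrib)
  finally show ?thesis unfolding fr_def inv_inv_eq[OF b(2)] comp_assoc .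
qed

lemma fr_inj: assumes "s permutes D" "\<tau> permutes D" shows "fr s \<tau> t = fr s \<tau> t' \<longleftrightarrow> t = t'"
proof
  assume a: "fr s \<tau> t = fr s \<tau> t'"
  have "t x = t' x" for x
  proof -
    have "fr s \<tau> t (\<tau> x) = fr s \<tau> t' (\<tau> x)" using a by simp
    then have "s (t x) = s (t' x)" by (simp add: fr_def permutes_inverses[OF assms(2)])
    then show ?thesis using permutes_inj[OF assms(1)] by (simp add: inj_eq)
  qed
  then show "t = t'" by blast
qed simp

text \<open>The new word undoes \<open>\<tau>\<close>, matches the old frames and applies
  \<open>\<tau>\<close> again.\<close>

lemma matched_fr:
  assumes s: "s permutes D" and \<tau>: "mover \<tau>" and h: "h permutes D" "h' permutes D" and m: "matched h h' X"
  shows "matched (fr s \<tau> h) (fr s \<tau> h') (s ` X)"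
proof -
  have t: "\<tau> permutes D" using \<tau> by (simp add: mover_def)
  obtain ps where ps: "set ps \<subseteq> P" "\<forall>v\<in>D. word_comp D ps (inv h v) = (if v \<in> X then Some (inv h' v) else None)"
    using m by (auto simp: matched_def)
  obtain qs where qs: "set qs \<subseteq> P" "\<forall>x\<in>D. word_comp D qs x = Some (inv \<tau> x)" using \<tau> by (auto simp: mover_def)
  obtain rs where rs: "set rs \<subseteq> P" "\<forall>x\<in>D. word_comp D rs x = Some (\<tau> x)" using \<tau> by (auto simp: mover_def)
  have "word_comp D (qs @ ps @ rs) (inv (fr s \<tau> h) w) = (if w \<in> s ` X then Some (inv (fr s \<tau> h') w) else None)"
    if w: "w \<in> D" for w
  proof -
    define v where "v = inv s w"
    have v: "v \<in> D" "w \<in> s ` X \<longleftrightarrow> v \<in> X"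
      using permutes_in_image[OF permutes_inv[OF s]] w by (auto simp: v_def permutes_inverses[OF s] intro: image_eqI[where x = "inv s w"])
    have vD: "inv h v \<in> D" "inv h' v \<in> D" using permutes_in_image[OF permutes_inv[OF h(1)]] permutes_in_image[OF permutes_inv[OF h(2)]] v(1) by auto
    have "\<tau> (inv h v) \<in> D" using permutes_in_image[OF t] vD by simp
    then have 1: "word_comp D qs (\<tau> (inv h v)) = Some (inv h v)" using qs(2) permutes_inverses[OF t] by simp
    have 2: "word_comp D ps (inv h v) = (if v \<in> X then Some (inv h' v) else None)" using ps(2) v(1) by blast
    have 3: "word_comp D rs (inv h' v) = Some (\<tau> (inv h' v))" using rs(2) vD by blast
    have "word_comp D (qs @ ps @ rs) (\<tau> (inv h v)) = (if v \<in> X then Some (\<tau> (inv h' v)) else None)"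
      using 1 2 3 by (simp add: word_comp_append[OF words_ran[OF qs(1)]] word_comp_append[OF words_ran[OF ps(1)]] map_comp_def)
    then show ?thesis using v(2) inv_fr[OF s t h(1)] inv_fr[OF s t h(2)] by (simp add: v_def)
  qed
  moreover have "set (qs @ ps @ rs) \<subseteq> P" using ps(1) qs(1) rs(1) by simp
  ultimately show ?thesis unfolding matched_def by blast
qed

text \<open>Frames are total permutations, so \<open>p\<close> has to be completed; domain and range
  have complements of equal size in the finite set \<open>D\<close>, and any bijection between these
  will do.\<close>

lemma perm_extension:
  assumes p: "p \<in> P" shows "\<exists>q. q permutes D \<and> (\<forall>x y. p x = Some y \<longrightarrow> q x = y)"
proof -
  have b: "bij_betw (\<lambda>x. the (p x)) (dom p) (ran p)"
    unfolding bij_betw_def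
  proof
    show "inj_on (\<lambda>x. the (p x)) (dom p)"
      by (rule inj_onI) (auto intro: partial_iso_inj[OF P_iso[OF p]])
    show "(\<lambda>x. the (p x)) ` dom p = ran p" by (force simp: ran_def image_iff)
  qed
  have f: "finite (dom p)" "finite (ran p)" using P_dom[OF p] P_ran[OF p] finite_D by (auto intro: finite_subset)
  have "card (D - dom p) = card (D - ran p)"
    using bij_betw_same_card[OF b] f P_dom[OF p] P_ran[OF p] by (simp add: card_Diff_subset)
  then obtain r where r: "bij_betw r (D - dom p) (D - ran p)"
    using finite_same_card_bij[of "D - dom p" "D - ran p"] finite_D by auto
  define q where "q x = (if x \<in> dom p then the (p x) else if x \<in> D then r x else x)" for x
  have "bij_betw q (dom p \<union> (D - dom p)) (ran p \<union> (D - ran p))"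
  proof (rule bij_betw_combine)
    show "bij_betw q (dom p) (ran p)" using b by (rule bij_betw_cong[THEN iffD1, rotated]) (simp add: q_def)
    show "bij_betw q (D - dom p) (D - ran p)" using r by (rule bij_betw_cong[THEN iffD1, rotated]) (simp add: q_def)
  qed blast
  moreover have "dom p \<union> (D - dom p) = D" "ran p \<union> (D - ran p) = D" using P_dom[OF p] P_ran[OF p] by auto
  ultimately have "q permutes D" using P_dom[OF p] by (intro bij_imp_permutes) (auto simp: q_def)
  moreover have "p x = Some y \<longrightarrow> q x = y" for x y by (auto simp: q_def)
  ultimately show ?thesis by blast
qed

lemma total_mover:
  assumes p: "p \<in> P" "dom p = D" and q: "q permutes D" "\<And>x y. p x = Some y \<Longrightarrow> q x = y"
  shows "mover q"
proof -
  have pq: "p x = Some (q x)" if x: "x \<in> D" for x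
  proof -
    obtain y where "p x = Some y" using p(2) x by blast
    then show ?thesis using q(2) by simp
  qed
  have "xs \<in> rel A0 R \<longleftrightarrow> map q xs \<in> rel A0 R"
    if R: "R \<in> symbols \<sigma>" and xs: "length xs = arity \<sigma> R" "set xs \<subseteq> D" for R xs
    by (rule partial_iso_rel[OF P_iso[OF p(1)] R xs(1)]) (use xs(2) pq in blast)
  then have "automorphism \<sigma> A0 q" using permutes_imp_bij[OF q(1)] by (simp add: automorphism_def isomorphism_def)
  moreover have "word_comp D [p] x = Some (q x)" if "x \<in> D" for x using word_comp_single that pq by metis
  moreover have "word_comp D [pinv p] x = Some (inv q x)" if x: "x \<in> D" for x
  proof -
    have "inv q x \<in> D" using permutes_in_image[OF permutes_inv[OF q(1)]] x by simp
    then have "p (inv q x) = Some x" using pq permutes_inverses[OF q(1)] by simp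
    then show ?thesis using pinv_Some[OF P_iso[OF p(1)]] word_comp_single[OF x] by simp
  qed
  moreover have "set [p] \<subseteq> P" "set [pinv p] \<subseteq> P" using p(1) P_inv by auto
  ultimately show ?thesis unfolding mover_def using q(1) by blast
qed

text \<open>Label \<open>v\<close> names \<open>inv q v\<close> in frame \<open>q\<close> and
  \<open>v\<close> in frame \<open>id\<close>. So on \<open>ran p\<close> the change of frame is
  \<open>p\<close> itself.\<close>

lemma partial_letter:
  assumes p: "p \<in> P" "dom p \<noteq> D" and q: "q permutes D" "\<And>x y. p x = Some y \<Longrightarrow> q x = y"
  shows "(q, id, ran p) \<in> E1"
proof -
  have "q ` dom p = ran p"
  proof (intro subset_antisym subsetI)
    fix y assume "y \<in> q ` dom p"
    then obtain x z where "y = q x" "p x = Some z" by blast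
    then show "y \<in> ran p" using q(2) by (auto intro: ranI)
  next
    fix y assume "y \<in> ran p"
    then obtain x where "p x = Some y" by (auto simp: ran_def)
    then show "y \<in> q ` dom p" using q(2)[of x y] by blast
  qed
  then have "ran p \<noteq> D" using p(2) permutes_image[OF q(1)] permutes_inj[OF q(1)] by (metis inj_image_eq_iff)
  then have X: "ran p \<subset> D" using P_ran[OF p(1)] by blast
  have r: "p (inv q v) = Some v" if v: "v \<in> ran p" for v
  proof -
    obtain x where x: "p x = Some v" using v by (auto simp: ran_def)
    then have "inv q v = x" using q(2)[OF x] permutes_inverses(2)[OF q(1)] by blast
    then show ?thesis using x by simp
  qed
  have n: "p (inv q v) = None" if v: "v \<notin> ran p" for v
  proof (rule ccontr)
    assume "p (inv q v) \<noteq> None"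
    then obtain y where y: "p (inv q v) = Some y" by blast
    then have "v = y" using q(2)[OF y] permutes_inverses(1)[OF q(1)] by simp
    then show False using y v by (auto intro: ranI)
  qed
  have "word_comp D [p] (inv q v) = (if v \<in> ran p then Some (inv id v) else None)" if v: "v \<in> D" for v
  proof -
    have "inv q v \<in> D" using permutes_in_image[OF permutes_inv[OF q(1)]] v by simp
    then show ?thesis using r n by (simp add: word_comp_single)
  qed
  moreover have "word_comp D [pinv p] (inv id v) = (if v \<in> ran p then Some (inv q v) else None)" if v: "v \<in> D" for v
    using v pinv_Some[OF P_iso[OF p(1)] r] pinv_None[of v p] by (simp add: word_comp_single)
  moreover have "set [p] \<subseteq> P" "set [pinv p] \<subseteq> P" using p(1) P_inv by auto
  ultimately have "matched q id (ran p)" "matched id q (ran p)" unfolding matched_def by blast+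
  then show ?thesis using X q(1) by (simp add: E1_def permutes_id)
qed

end

locale labelled_permutation_cover = permutation_cover +
  fixes el1 :: "('b \<Rightarrow> 'b) \<times> (('b \<Rightarrow> 'b) \<times> ('b \<Rightarrow> 'b) \<times> 'b set) list set \<Rightarrow> 'b \<Rightarrow> nat"
  assumes el1_eq: "i \<in> PS.G.idx \<Longrightarrow> j \<in> PS.G.idx \<Longrightarrow> v \<in> D \<Longrightarrow> v' \<in> D \<Longrightarrow>
      el1 i v = el1 j v' \<longleftrightarrow> v = v' \<and> PS.G.I.lk (al1 v) i j"
begin

sublocale C: cover \<sigma> A0 P E1 PS.G.idx PS.G.mv "\<lambda>e p. inc1 e (fst p)" al1 "\<lambda>_. D" c1 el1
proof
  show "univ A0 \<noteq> {}" by (rule ne)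
  show "bij_betw (c1 i) D D" if "i \<in> PS.G.idx" for i
    unfolding c1_def by (rule permutes_imp_bij[OF permutes_inv[OF idx_V1[OF that]]])
  show "PS.G.I.lk (\<alpha> \<inter> \<beta>) i j" if "PS.G.I.lk \<alpha> i j" "PS.G.I.lk \<beta> i j" for \<alpha> \<beta> i j
    using that by (rule PS.lk_meet)
  show "al1 v \<subseteq> E1" for v by (rule al1_E1)
  show "el1 i v = el1 j v' \<longleftrightarrow> v = v' \<and> PS.G.I.lk (al1 v) i j"
    if "i \<in> PS.G.idx" "j \<in> PS.G.idx" "v \<in> D" "v' \<in> D" for i j v v' using el1_eq[OF that] .
  show "\<exists>ps. set ps \<subseteq> P \<and> (\<forall>v\<in>D. word_comp D ps (c1 i v) = (if e \<in> al1 v then Some (c1 (PS.G.mv e i) v) else None))"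
    if "e \<in> E1" "inc1 e (fst i)" for i e
  proof -
    have "matched (fst i) (pos1 e (fst i)) (snd (snd e))" using that by (auto simp: inc1_def pos1_def E1_def)
    then show ?thesis using that(1) unfolding matched_def by (simp only: c1_def PS.G.mv_def fst_conv al1_def mem_Collect_eq simp_thms)
  qed
  show "(\<Inter>v\<in>D. al1 v) = {}"
  proof (rule ccontr)
    assume "(\<Inter>v\<in>D. al1 v) \<noteq> {}"
    then obtain e where e: "\<forall>v\<in>D. e \<in> al1 v" by blast
    then have "e \<in> E1" "D \<subseteq> snd (snd e)" using ne by (auto simp: al1_def)
    then show False by (auto simp: E1_def)
  qed
qed

lemma lift_symmetry:
  assumes s: "s permutes D" and \<tau>: "mover \<tau>" and z: "z \<in> lists E1"
  shows "\<exists>f. C.symm f s (\<lambda>i. \<tau>) \<and> (\<forall>t. \<forall>w\<in>lists E1. f (t, grel M1 E1 `` {w}) =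
    (fr s \<tau> t, grel M1 E1 `` {z @ map (map_prod (fr s \<tau>) (map_prod (fr s \<tau>) (image s))) w})) \<and>
    map_prod (fr s \<tau>) (map_prod (fr s \<tau>) (image s)) ` E1 \<subseteq> E1"
proof -
  define g where "g = map_prod (fr s \<tau>) (map_prod (fr s \<tau>) (image s))"
  have t: "\<tau> permutes D" using \<tau> by (simp add: mover_def)
  note si = permutes_inj[OF s]
  have gE: "g e \<in> E1" if "e \<in> E1" for e
  proof -
    obtain h h' X where e: "e = (h, h', X)" by (cases e)
    have h: "h permutes D" "h' permutes D" "X \<subset> D" "matched h h' X" "matched h' h X" using that e by (auto simp: E1_def)
    have "s ` X \<subset> s ` D" using h(3) si by (simp add: inj_image_subset_iff psubset_eq inj_image_eq_iff)
    then have "s ` X \<subset> D" using permutes_image[OF s] by simp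
    then show ?thesis
      using fr_permutes[OF s t h(1)] fr_permutes[OF s t h(2)] matched_fr[OF s \<tau> h(1,2,4)] matched_fr[OF s \<tau> h(2,1,5)]
      by (simp add: g_def e E1_def)
  qed
  have "inj g"
    unfolding g_def by (intro prod.inj_map injI) (simp_all add: fr_inj[OF s t] inj_image_eq_iff[OF si])
  then have "inj_on g E1" using inj_on_subset by blast
  moreover have gs: "g ` E1 \<subseteq> E1" using gE by blast
  ultimately have gb: "bij_betw g E1 E1" using endo_inj_surj[of E1 g] PS.finE by (simp add: bij_betw_def)
  have "inj_on (fr s \<tau>) V1" by (rule inj_onI) (simp add: fr_inj[OF s t])
  moreover have "fr s \<tau> ` V1 \<subseteq> V1" using fr_permutes[OF s t] by (auto simp: V1_def)
  ultimately have fb: "bij_betw (fr s \<tau>) V1 V1" using endo_inj_surj[of V1 "fr s \<tau>"] finite_V1 by (simp add: bij_betw_def)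
  interpret Y: index_symmetry E1 "grel M1 E1" V1 pos1 inc1 g "fr s \<tau>" z
  proof
    show "bij_betw g E1 E1" by (rule gb)
    show "(map g u, map g v) \<in> grel M1 E1 \<longleftrightarrow> (u, v) \<in> grel M1 E1"
      if "u \<in> lists E1" "v \<in> lists E1" for u v
      by (rule letter_map_iff[OF gb _ that, of "grel M1"]) (rule grel_map[OF PS.finE])
    show "bij_betw (fr s \<tau>) V1 V1" by (rule fb)
    show "pos1 (g e) (fr s \<tau> t) = fr s \<tau> (pos1 e t)" for e t
      by (cases e) (simp add: pos1_def g_def fr_inj[OF s \<open>\<tau> permutes D\<close>])
    show "inc1 (g e) (fr s \<tau> t) \<longleftrightarrow> inc1 e t" for e t
      by (cases e) (simp add: inc1_def g_def fr_inj[OF s \<open>\<tau> permutes D\<close>])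
    show "z \<in> lists E1" by (rule z)
  qed
  have fst_sy: "fst (Y.sy i) = fr s \<tau> (fst i)" for i by (simp add: Y.sy_def)
  have alF: "al1 (s v) = g ` al1 v" for v
  proof (intro subset_antisym subsetI)
    fix e assume e: "e \<in> al1 (s v)"
    then have "e \<in> g ` E1" using gb by (simp add: bij_betw_def al1_def)
    then obtain e0 where e0: "e0 \<in> E1" "e = g e0" by (metis imageE)
    have "s v \<in> s ` snd (snd e0)" using e e0 by (cases e0) (simp add: al1_def g_def)
    then have "e0 \<in> al1 v" using e0(1) by (simp add: al1_def inj_image_mem_iff[OF si])
    then show "e \<in> g ` al1 v" using e0(2) by blast
  next
    fix e assume "e \<in> g ` al1 v"
    then obtain e0 where "e0 \<in> al1 v" "e = g e0" by blast
    then show "e \<in> al1 (s v)" using gE[of e0] by (cases e0) (simp add: al1_def g_def)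
  qed
  have "C.symm Y.sy s (\<lambda>i. \<tau>)"
    unfolding C.symm_def
  proof (intro conjI ballI)
    show "bij_betw Y.sy PS.G.idx PS.G.idx" by (rule Y.sy_bij)
    show "inj_on s (\<Union>i\<in>PS.G.idx. D)" using si inj_on_subset by blast
    show "automorphism \<sigma> A0 \<tau>" using \<tau> by (simp add: mover_def)
    show "s v \<in> D" if "v \<in> D" for v using permutes_in_image[OF s] that by simp
    show "c1 (Y.sy i) (s v) = \<tau> (c1 i v)" if "i \<in> PS.G.idx" for i v
      using inv_fr[OF s t idx_V1[OF that]] permutes_inverses(2)[OF s] by (simp add: c1_def fst_sy)
    show "PS.G.I.lk (al1 (s v)) (Y.sy i) (Y.sy j) \<longleftrightarrow> PS.G.I.lk (al1 v) i j"
      if "i \<in> PS.G.idx" "j \<in> PS.G.idx" for i j v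
      using Y.sy_lk[OF that al1_E1] by (simp add: alF)
  qed
  moreover have "\<forall>t. \<forall>w\<in>lists E1. Y.sy (t, grel M1 E1 `` {w}) = (fr s \<tau> t, grel M1 E1 `` {z @ map g w})"
    using Y.sy_at by blast
  ultimately show ?thesis using gs unfolding g_def[symmetric] by blast
qed

lemma good_cover: "good_atlas \<sigma> A0 P C.A C.U C.\<pi> (C.u (id, grel M1 E1 `` {[]}))"
proof (rule C.good)
  let ?cl = "\<lambda>w. grel M1 E1 `` {w}"
  have i0: "(id, ?cl []) \<in> PS.G.idx" using PS.G.at_idx[of id "[]"] by (simp add: V1_def permutes_id)
  then show "(id, ?cl []) \<in> PS.G.idx" .
  have c0: "c1 (id, ?cl []) v = v" for v by (simp add: c1_def)
  show "\<exists>f h. C.symm f h (\<lambda>_. id) \<and> f i = j" if ij: "i \<in> PS.G.idx" "j \<in> PS.G.idx" for i j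
  proof -
    obtain t w where i: "t \<in> V1" "w \<in> lists E1" "i = (t, ?cl w)" using PS.G.idx_at[OF ij(1)] by blast
    obtain t' w' where j: "t' \<in> V1" "w' \<in> lists E1" "j = (t', ?cl w')" using PS.G.idx_at[OF ij(2)] by blast
    \<comment> \<open>Renaming labels is already transitive on frames. So elements need not be
      moved, and the symmetry is rigid.\<close>
    define s where "s = t' \<circ> inv t"
    have tp: "t permutes D" "t' permutes D" using i(1) j(1) by (auto simp: V1_def)
    have s: "s permutes D" unfolding s_def by (intro permutes_compose permutes_inv tp)
    have st: "fr s id t = t'"
      by (simp add: fr_def s_def fun_eq_iff permutes_inverses(2)[OF tp(1)])
    define w2 where "w2 = map (map_prod (fr s id) (map_prod (fr s id) (image s))) w"
    have "map_prod (fr s id) (map_prod (fr s id) (image s)) ` E1 \<subseteq> E1"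
      using lift_symmetry[OF s mover_id, of "[]"] by auto
    then have w2: "w2 \<in> lists E1" using i(2) by (auto simp: w2_def in_lists_conv_set)
    have "w' @ rev w2 \<in> lists E1" using j(2) w2 by simp
    then obtain f where f: "C.symm f s (\<lambda>_. id)" "\<forall>t. \<forall>w\<in>lists E1. f (t, ?cl w) =
        (fr s id t, ?cl ((w' @ rev w2) @ map (map_prod (fr s id) (map_prod (fr s id) (image s))) w))"
      using lift_symmetry[OF s mover_id] by blast
    have "f (t, ?cl w) = (fr s id t, ?cl ((w' @ rev w2) @ w2))" using bspec[OF spec[OF f(2), of t] i(2)] by (simp only: w2_def)
    then have "f i = j" using st i(3) j(3) PS.G.class_cancel[OF j(2) w2] by simp
    then show ?thesis using f(1) by blast
  qed
  show "\<exists>f h \<kappa>. C.symm f h \<kappa> \<and> (\<forall>v\<in>D. \<forall>v'\<in>D. p (c1 (id, ?cl []) v) = Some (c1 (id, ?cl []) v') \<longrightarrow>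
      h v = v' \<and> PS.G.I.lk (al1 v') (f (id, ?cl [])) (id, ?cl []))" if p: "p \<in> P" for p
  proof -
    obtain q where q: "q permutes D" "\<And>x y. p x = Some y \<Longrightarrow> q x = y" using perm_extension[OF p] by blast
    show ?thesis
    proof (cases "dom p = D")
      case True
      \<comment> \<open>Moving labels and elements by the same \<open>q\<close> fixes the frame
        \<open>id\<close>, so the base copy is mapped to itself by \<open>q\<close>.\<close>
      obtain f where f: "C.symm f q (\<lambda>_. q)" "\<forall>t. \<forall>w\<in>lists E1. f (t, ?cl w) =
          (fr q q t, ?cl ([] @ map (map_prod (fr q q) (map_prod (fr q q) (image q))) w))"
        using lift_symmetry[OF q(1) total_mover[OF p True q], of "[]"] by blast
      have "fr q q id = id" by (simp add: fr_def fun_eq_iff permutes_inverses(1)[OF q(1)])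
      then have "f (id, ?cl []) = (id, ?cl [])" using bspec[OF spec[OF f(2), of id], of "[]"] by simp
      then have "\<forall>v\<in>D. \<forall>v'\<in>D. p (c1 (id, ?cl []) v) = Some (c1 (id, ?cl []) v') \<longrightarrow>
          q v = v' \<and> PS.G.I.lk (al1 v') (f (id, ?cl [])) (id, ?cl [])"
        using PS.G.I.lk_refl[OF i0 al1_E1] q(2) by (simp add: c0)
      then show ?thesis using f(1) by blast
    next
      case False
      obtain \<epsilon> where \<epsilon>_def: "\<epsilon> = (q, id, ran p)" and e: "\<epsilon> \<in> E1" using partial_letter[OF p False q] by blast
      then have "[\<epsilon>] \<in> lists E1" by simp
      \<comment> \<open>Only labels are renamed, so the base copy goes to frame \<open>q\<close>.
        Left multiplication by the letter makes it the neighbour of the base copy across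
        \<open>\<epsilon>\<close>, glued to it along \<open>ran p\<close>.\<close>
      then obtain f where f: "C.symm f q (\<lambda>_. id)" "\<forall>t. \<forall>w\<in>lists E1. f (t, ?cl w) =
          (fr q id t, ?cl ([\<epsilon>] @ map (map_prod (fr q id) (map_prod (fr q id) (image q))) w))"
        using lift_symmetry[OF q(1) mover_id, of "[\<epsilon>]"] by blast
      have "f (id, ?cl []) = (q, ?cl [\<epsilon>])" using bspec[OF spec[OF f(2), of id], of "[]"] by (simp add: fr_def)
      moreover have "PS.G.mv \<epsilon> (id, ?cl []) = (q, ?cl [\<epsilon>])"
        using PS.G.mv_at[of "[]" \<epsilon> id] e by (simp add: pos1_def \<epsilon>_def)
      moreover have "inc1 \<epsilon> (fst (id, ?cl []))" by (simp add: inc1_def \<epsilon>_def)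
      ultimately have "PS.G.I.lk (al1 v') (f (id, ?cl [])) (id, ?cl [])" if "v' \<in> ran p" for v'
        using PS.G.lk_mv[OF i0 al1_E1, of \<epsilon> v'] that e by (simp add: al1_def \<epsilon>_def)
      then have "\<forall>v\<in>D. \<forall>v'\<in>D. p (c1 (id, ?cl []) v) = Some (c1 (id, ?cl []) v') \<longrightarrow>
          q v = v' \<and> PS.G.I.lk (al1 v') (f (id, ?cl [])) (id, ?cl [])"
        using q(2) by (simp add: c0 ranI)
      then show ?thesis using f(1) by blast
    qed
  qed
qed

end

lemma (in permutation_cover) exists_symmetric_solution:
  "\<exists>(A :: (nat, 's) struct) U \<pi> u0. good_atlas \<sigma> A0 P A U \<pi> u0"
proof (rule PS.G.I.exists_labelling[of "\<lambda>_. D" al1, OF finite_D al1_E1])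
  fix el :: "('a \<Rightarrow> 'a) \<times> (('a \<Rightarrow> 'a) \<times> ('a \<Rightarrow> 'a) \<times> 'a set) list set \<Rightarrow> 'a \<Rightarrow> nat"
  assume el: "\<And>i j v v'. i \<in> PS.G.idx \<Longrightarrow> j \<in> PS.G.idx \<Longrightarrow> v \<in> D \<Longrightarrow> v' \<in> D \<Longrightarrow>
      el i v = el j v' \<longleftrightarrow> v = v' \<and> PS.G.I.lk (al1 v) i j"
  interpret S: labelled_permutation_cover \<sigma> A0 P el
    by unfold_locales (rule el)
  show ?thesis using S.good_cover by blast
qed

theorem theorem5p10:
  fixes \<sigma> :: "'s signature"
    and A0 :: "('a, 's) struct"
    and P :: "('a \<rightharpoonup> 'a) set"
    and N :: nat
  assumes "finite (symbols \<sigma>)"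
    and "univ A0 \<noteq> {} \<or> (\<forall>R\<in>symbols \<sigma>. arity \<sigma> R > 0)"
    and "extension_instance \<sigma> (structures \<sigma>) A0 P"
  shows "\<exists>(A :: (nat, 's) struct) U \<pi>.
           finite (univ A) \<and>
           solution \<sigma> (structures \<sigma>) A0 P A \<and>
           fully_symmetric_atlas \<sigma> A0 P A U \<pi> \<and>
           N_acyclic_hypergraph N (univ A) U"
proof (cases "univ A0 = {}")
  case False
  interpret extension_problem \<sigma> A0 P by unfold_locales (rule assms(3))
  have "permutation_cover \<sigma> A0 P" by unfold_locales (rule False)
  then obtain A1 :: "(nat, 's) struct" and U1 \<pi>1 u1 where A1: "good_atlas \<sigma> A0 P A1 U1 \<pi>1 u1"
    using permutation_cover.exists_symmetric_solution by blast
  have "symmetric_solution \<sigma> A0 P A1 U1 \<pi>1 u1" by unfold_locales (rule False A1)+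
  then obtain A :: "(nat, 's) struct" and U \<pi> u0 where A: "good_atlas \<sigma> A0 P A U \<pi> u0" "N_acyclic_hypergraph N (univ A) U"
    using symmetric_solution.N_acyclic_solution by blast
  have "finite (univ A) \<and> fully_symmetric_atlas \<sigma> A0 P A U \<pi>" using A(1) by (simp add: good_atlas_def)
  then show ?thesis using solution_of_good_atlas[OF A(1)] A(2) by blast
next
  \<comment> \<open>A chart onto an empty structure would be an empty hyperedge, so the atlas has to
    be empty and cannot cover any tuple. By the second assumption all arities are positive, so
    \<open>A0\<close> has no tuples and a structure without points is a solution.\<close>
  case True
  interpret extension_problem \<sigma> A0 P by unfold_locales (rule assms(3))
  define A :: "(nat, 's) struct" where "A = \<lparr>univ = {}, rel = \<lambda>_. {}\<rparr>"
  have pos: "arity \<sigma> R > 0" if "R \<in> symbols \<sigma>" for R using assms(2) True that by blast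
  have r0: "xs \<notin> rel A0 R" if R: "R \<in> symbols \<sigma>" for R xs
    using A0_struct pos[OF R] R True unfolding structures_def by fastforce
  have "embedding \<sigma> (\<lambda>_. 0) A0 A"
    using True r0 by (auto simp: embedding_def isomorphism_def A_def induced_def bij_betw_def)
  moreover have "p x = None" if "p \<in> P" for p x using P_dom[OF that] True by blast
  moreover have "automorphism \<sigma> A id" by (simp add: automorphism_def isomorphism_def)
  moreover have "A \<in> structures \<sigma>" by (simp add: structures_def A_def)
  ultimately have "solution \<sigma> (structures \<sigma>) A0 P A" unfolding solution_def by fastforce
  moreover have "fully_symmetric_atlas \<sigma> A0 P A {} (\<lambda>_ _. undefined)"
    by (simp add: fully_symmetric_atlas_def atlas_def A_def)
  moreover have "N_acyclic_hypergraph N (univ A) {}"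
    by (simp add: N_acyclic_hypergraph_def hypergraph_def acyclic_hypergraph_def A_def chordless_cycle_def)
  ultimately show ?thesis by (intro exI[of _ A] exI[of _ "{}"] exI[of _ "\<lambda>_ _. undefined"]) (simp add: A_def)
qed

end
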